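(* Let $\{Y_t\}$ satisfy $Y_0=0$, $Y_t=\rho Y_{t-1}+\epsilon_t$, $t\ge 1$, with $\rho=1$, where the innovations $\{\epsilon_t\}$ satisfy (E1), and let the kernel $K$ satisfy (K1)-(K3) (conditions given in the context). Let $D_T$ be the weighted Dickey-Fuller process and $\kappa\in(0,1)$. Then $$D_T(s)\Rightarrow \mathcal{D}_\vartheta(s)\qquad\text{in } (D[\kappa,1],d),$$ as $T\to\infty$, where the stochastic process $$\mathcal{D}_\vartheta(s)=\frac{\frac{s}{2}\left\{K(0)B(s)^2+\zeta\int_0^s B(r)^2K'(\zeta(s-r))\,dr-\vartheta^{-2}\int_0^s K(\zeta(s-r))\,dr\right\}}{\int_0^s B(r)^2\,dr},\quad s\in(0,1],$$ $\mathcal{D}_\vartheta(0)=0$, is continuous with probability $1$. Here $B$ is a standard Brownian motion.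
   Context: Notation: $\Rightarrow$ denotes weak convergence in the space of cadlag functions (on the indicated interval) equipped with the Skorokhod metric $d$; $\lfloor\cdot\rfloor$ is the floor function. (E1): $\{\epsilon_t\}$ is strictly stationary with mean zero, $E|\epsilon_1|^4<\infty$, $\sum_{t=1}^\infty \mathrm{Cov}(\epsilon_1^2,\epsilon_{1+t}^2)<\infty$, and for constants $0<\eta,\eta'<\infty$, as $T\to\infty$, in $D[0,1]$, $$T^{-1/2}\sum_{i\le\lfloor Ts\rfloor}\epsilon_i\Rightarrow\eta B(s),\qquad T^{-1/2}\sum_{i\le\lfloor Ts\rfloor}(\epsilon_i^2-E\epsilon_i^2)\Rightarrow\eta' B^{(2)}(s),$$ with $B,B^{(2)}$ standard Brownian motions started at $0$. Put $\sigma^2=E\epsilon_1^2$; the scale parameter $\eta$ is given by $\eta^2=\lim_{T\to\infty}\eta_T^2$, $\eta_T^2=\sigma^2+2\sum_{t=1}^T\frac{T-t}{T}E(\epsilon_1\epsilon_{1+t})$, and $\vartheta=\eta/\sigma$. Kernel $K:\mathbb{R}\to[0,\infty)$: (K1) $\|K\|_\infty<\infty$, $\int K(z)\,dz=1$, $\int zK(z)\,dz=0$; (K2) $K$ is $C^2$ with bounded derivative; (K3) $K$ has bounded variation. The bandwidth $h=h_T>0$ satisfies $T/h_T\to\zeta$ as $T\to\infty$ for some $1\le\zeta<\infty$. Weighted Dickey-Fuller process: with $\Delta Y_t=Y_t-Y_{t-1}$ and the convention $0/0=0$, $$D_T(s)=\frac{\lfloor Ts\rfloor^{-1}\sum_{t=1}^{\lfloor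 Ts\rfloor}Y_{t-1}\Delta Y_t\,K((\lfloor Ts\rfloor-t)/h)}{\lfloor Ts\rfloor^{-2}\sum_{t=1}^{\lfloor Ts\rfloor}Y_{t-1}^2},\qquad s\in[0,1].$$
   Formalization: Almost sure continuity of the limit process is proved on (0,1] only; at s=0, with the value set to 0, continuity fails whenever K(0)>0, since near 0 the process behaves like a scale-invariant nondegenerate ratio. *)

theory Defs
  imports "HOL-Probability.Probability"
begin

section \<open>The Skorokhod space \<open>D[a,b]\<close>\<close>

definition cadlag_on :: "real \<Rightarrow> real \<Rightarrow> (real \<Rightarrow> real) \<Rightarrow> bool" where
  "cadlag_on a b x \<longleftrightarrow>
     (\<forall>t. a \<le> t \<and> t < b \<longrightarrow> (x \<longlongrightarrow> x t) (at_right t)) \<and>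
     (\<forall>t. a < t \<and> t \<le> b \<longrightarrow> (\<exists>l. (x \<longlongrightarrow> l) (at_left t)))"

text \<open>Paths are total functions that are \<open>undefined\<close> outside \<open>[a,b]\<close>, so that a path is
  determined by its values on \<open>[a,b]\<close>.\<close>

definition skorokhod_space :: "real \<Rightarrow> real \<Rightarrow> (real \<Rightarrow> real) set" where
  "skorokhod_space a b = {x \<in> extensional {a..b}. cadlag_on a b x}"

definition time_changes :: "real \<Rightarrow> real \<Rightarrow> (real \<Rightarrow> real) set" where
  "time_changes a b =
     {l. strict_mono_on {a..b} l \<and> continuous_on {a..b} l \<and> l ` {a..b} = {a..b}}"

text \<open>Billingsley's form of the \<open>J\<^sub>1\<close> metric: the infimum of all \<open>e\<close> for which some time change
  \<open>l\<close> satisfies \<open>\<parallel>l - id\<parallel> \<le> e\<close> and \<open>\<parallel>x - y \<circ> l\<parallel> \<le> e\<close> on \<open>[a,b]\<close>.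
  The value 0 outside the space only serves to make the function total.\<close>

definition skorokhod_dist :: "real \<Rightarrow> real \<Rightarrow> (real \<Rightarrow> real) \<Rightarrow> (real \<Rightarrow> real) \<Rightarrow> real" where
  "skorokhod_dist a b x y =
     (if x \<in> skorokhod_space a b \<and> y \<in> skorokhod_space a b
      then Inf {e. 0 \<le> e \<and> (\<exists>l\<in>time_changes a b. \<forall>t\<in>{a..b}. \<bar>l t - t\<bar> \<le> e \<and> \<bar>x t - y (l t)\<bar> \<le> e)}
      else 0)"

lemma cadlag_on_bounded:
  assumes "cadlag_on a b x"
  shows "\<exists>C. \<forall>t\<in>{a..b}. \<bar>x t\<bar> \<le> C"
proof -
  have loc: "\<exists>U C. open U \<and> t \<in> U \<and> (\<forall>s\<in>U \<inter> {a..b}. \<bar>x s\<bar> \<le> C)" if t: "t \<in> {a..b}" for t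
  proof -
    have "\<exists>C r. r > t \<and> (\<forall>s. t < s \<and> s < r \<and> s \<in> {a..b} \<longrightarrow> \<bar>x s\<bar> \<le> C)"
    proof (cases "t < b")
      case True
      then have "(x \<longlongrightarrow> x t) (at_right t)"
        using assms t by (auto simp: cadlag_on_def)
      then have "eventually (\<lambda>s. dist (x s) (x t) < 1) (at_right t)"
        by (rule tendstoD) simp
      then obtain r where "r > t" "\<forall>s>t. s < r \<longrightarrow> dist (x s) (x t) < 1"
        by (auto simp: eventually_at_right_field)
      then show ?thesis
        by (intro exI[of _ "\<bar>x t\<bar> + 1"] exI[of _ r]) (fastforce simp: dist_real_def)
    next
      case False
      then show ?thesis by (intro exI[of _ 0] exI[of _ "t + 1"]) auto
    qed
    then obtain C1 r where r: "r > t" "\<And>s. t < s \<Longrightarrow> s < r \<Longrightarrow> s \<in> {a..b} \<Longrightarrow> \<bar>x s\<bar> \<le> C1"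
      by blast
    have "\<exists>C q. q < t \<and> (\<forall>s. q < s \<and> s < t \<and> s \<in> {a..b} \<longrightarrow> \<bar>x s\<bar> \<le> C)"
    proof (cases "a < t")
      case True
      then obtain l where "(x \<longlongrightarrow> l) (at_left t)"
        using assms t by (auto simp: cadlag_on_def)
      then have "eventually (\<lambda>s. dist (x s) l < 1) (at_left t)"
        by (rule tendstoD) simp
      then obtain q where "q < t" "\<forall>s>q. s < t \<longrightarrow> dist (x s) l < 1"
        by (auto simp: eventually_at_left_field)
      then show ?thesis
        by (intro exI[of _ "\<bar>l\<bar> + 1"] exI[of _ q]) (fastforce simp: dist_real_def)
    next
      case False
      then show ?thesis by (intro exI[of _ 0] exI[of _ "t - 1"]) auto
    qed
    then obtain C2 q where q: "q < t" "\<And>s. q < s \<Longrightarrow> s < t \<Longrightarrow> s \<in> {a..b} \<Longrightarrow> \<bar>x s\<bar> \<le> C2"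
      by blast
    have "\<bar>x s\<bar> \<le> max \<bar>x t\<bar> (max C1 C2)" if "s \<in> {q<..<r} \<inter> {a..b}" for s
      using that r(2)[of s] q(2)[of s] by (cases s t rule: linorder_cases) auto
    then show ?thesis
      using r(1) q(1) by (intro exI[of _ "{q<..<r}"] exI[of _ "max \<bar>x t\<bar> (max C1 C2)"]) auto
  qed
  then obtain U C where UC: "\<And>t. t \<in> {a..b} \<Longrightarrow>
      open (U t) \<and> t \<in> U t \<and> (\<forall>s\<in>U t \<inter> {a..b}. \<bar>x s\<bar> \<le> C t)"
    by metis
  have "compact {a..b}" by simp
  then obtain F where F: "F \<subseteq> {a..b}" "finite F" "{a..b} \<subseteq> (\<Union>t\<in>F. U t)"
    by (rule compactE_image[where C = "{a..b}" and f = U]) (use UC in auto)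
  have "\<bar>x s\<bar> \<le> (\<Sum>t\<in>F. \<bar>C t\<bar>)" if s: "s \<in> {a..b}" for s
  proof -
    obtain t where t: "t \<in> F" "s \<in> U t" using F(3) s by auto
    then have "\<bar>x s\<bar> \<le> C t" using UC[of t] F(1) s by blast
    then have "\<bar>x s\<bar> \<le> \<bar>C t\<bar>" by linarith
    also have "\<dots> \<le> (\<Sum>t\<in>F. \<bar>C t\<bar>)"
      using t(1) F(2) by (intro member_le_sum) auto
    finally show ?thesis .
  qed
  then show ?thesis by blast
qed

lemma id_in_time_changes: "(\<lambda>t. t) \<in> time_changes a b"
  by (auto simp: time_changes_def strict_mono_on_def)

lemma time_changes_inverse:
  assumes "l \<in> time_changes a b"
  shows "\<exists>k\<in>time_changes a b. \<forall>t\<in>{a..b}. k t \<in> {a..b} \<and> l (k t) = t"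
proof (intro bexI ballI conjI)
  let ?k = "inv_into {a..b} l"
  have l: "strict_mono_on {a..b} l" "continuous_on {a..b} l" "l ` {a..b} = {a..b}"
    using assms by (auto simp: time_changes_def)
  have inj: "inj_on l {a..b}" using l(1) by (rule strict_mono_on_imp_inj_on)
  show k: "?k t \<in> {a..b}" and lk: "l (?k t) = t" if "t \<in> {a..b}" for t
    using that l(3) inv_into_into[of t l "{a..b}"] f_inv_into_f[of t l "{a..b}"] by simp_all
  have "strict_mono_on {a..b} ?k"
  proof (rule strict_mono_onI)
    fix s t assume st: "s \<in> {a..b}" "t \<in> {a..b}" "s < t"
    show "?k s < ?k t"
    proof (rule ccontr)
      assume "\<not> ?k s < ?k t"
      then have "l (?k t) \<le> l (?k s)"
        using strict_mono_on_leD[OF l(1)] k st by auto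
      then show False using st lk by auto
    qed
  qed
  moreover have "continuous_on {a..b} ?k"
    by (rule continuous_on_inv[OF l(2), unfolded l(3)]) (use inj in auto)
  moreover have "?k ` {a..b} = {a..b}"
    using inv_into_image_cancel[OF inj, of "{a..b}"] l(3) by simp
  ultimately show "?k \<in> time_changes a b" by (simp add: time_changes_def)
qed

lemma time_changes_compose:
  assumes "l \<in> time_changes a b" "k \<in> time_changes a b"
  shows "(\<lambda>t. k (l t)) \<in> time_changes a b"
proof -
  have l: "strict_mono_on {a..b} l" "continuous_on {a..b} l" "l ` {a..b} = {a..b}"
    and k: "strict_mono_on {a..b} k" "continuous_on {a..b} k" "k ` {a..b} = {a..b}"
    using assms by (auto simp: time_changes_def)
  have "strict_mono_on {a..b} (\<lambda>t. k (l t))"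
  proof (rule strict_mono_onI)
    fix s t assume st: "s \<in> {a..b}" "t \<in> {a..b}" "s < t"
    have "l s \<in> {a..b}" "l t \<in> {a..b}" using st(1,2) l(3) by auto
    moreover have "l s < l t" using strict_mono_onD[OF l(1) st] .
    ultimately show "k (l s) < k (l t)" by (rule strict_mono_onD[OF k(1)])
  qed
  moreover have "continuous_on {a..b} (\<lambda>t. k (l t))"
    using continuous_on_compose2[OF k(2) l(2)] l(3) by simp
  moreover have "(\<lambda>t. k (l t)) ` {a..b} = {a..b}"
    using l(3) k(3) by (metis image_image)
  ultimately show ?thesis by (simp add: time_changes_def)
qed

definition skorokhod_close where
  "skorokhod_close a b x y e \<longleftrightarrow> 0 \<le> e \<and>
     (\<exists>l\<in>time_changes a b. \<forall>t\<in>{a..b}. \<bar>l t - t\<bar> \<le> e \<and> \<bar>x t - y (l t)\<bar> \<le> e)"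

lemma skorokhod_dist_alt:
  assumes "x \<in> skorokhod_space a b" "y \<in> skorokhod_space a b"
  shows "skorokhod_dist a b x y = Inf {e. skorokhod_close a b x y e}"
  using assms by (simp add: skorokhod_dist_def skorokhod_close_def)

lemma skorokhod_close_exists:
  assumes "x \<in> skorokhod_space a b" "y \<in> skorokhod_space a b"
  shows "\<exists>e. skorokhod_close a b x y e"
proof -
  obtain C1 C2 where C: "\<forall>t\<in>{a..b}. \<bar>x t\<bar> \<le> C1" "\<forall>t\<in>{a..b}. \<bar>y t\<bar> \<le> C2"
    using assms cadlag_on_bounded unfolding skorokhod_space_def by blast
  have "\<bar>x t - y t\<bar> \<le> \<bar>C1\<bar> + \<bar>C2\<bar>" if "t \<in> {a..b}" for t
    using C(1)[rule_format, OF that] C(2)[rule_format, OF that] by linarith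
  then have "skorokhod_close a b x y (\<bar>C1\<bar> + \<bar>C2\<bar>)"
    unfolding skorokhod_close_def
    by (intro conjI bexI[of _ "\<lambda>t. t"] id_in_time_changes) auto
  then show ?thesis by blast
qed

lemma skorokhod_close_sym:
  assumes "skorokhod_close a b x y e"
  shows "skorokhod_close a b y x e"
proof -
  obtain l where l: "l \<in> time_changes a b"
    "\<forall>t\<in>{a..b}. \<bar>l t - t\<bar> \<le> e \<and> \<bar>x t - y (l t)\<bar> \<le> e" and e: "0 \<le> e"
    using assms by (auto simp: skorokhod_close_def)
  obtain k where k: "k \<in> time_changes a b" "\<forall>t\<in>{a..b}. k t \<in> {a..b} \<and> l (k t) = t"
    using time_changes_inverse[OF l(1)] by blast
  have "\<bar>k t - t\<bar> \<le> e \<and> \<bar>y t - x (k t)\<bar> \<le> e" if "t \<in> {a..b}" for t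
    using l(2)[rule_format, of "k t"] k(2)[rule_format, OF that]
    by (auto simp: abs_minus_commute)
  then show ?thesis using k(1) e unfolding skorokhod_close_def by blast
qed

lemma skorokhod_close_trans:
  assumes "skorokhod_close a b x y e" "skorokhod_close a b y z e'"
  shows "skorokhod_close a b x z (e + e')"
proof -
  obtain l where l: "l \<in> time_changes a b"
    "\<forall>t\<in>{a..b}. \<bar>l t - t\<bar> \<le> e \<and> \<bar>x t - y (l t)\<bar> \<le> e" and e: "0 \<le> e"
    using assms by (auto simp: skorokhod_close_def)
  obtain k where k: "k \<in> time_changes a b"
    "\<forall>t\<in>{a..b}. \<bar>k t - t\<bar> \<le> e' \<and> \<bar>y t - z (k t)\<bar> \<le> e'" and e': "0 \<le> e'"
    using assms by (auto simp: skorokhod_close_def)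
  have "\<bar>k (l t) - t\<bar> \<le> e + e' \<and> \<bar>x t - z (k (l t))\<bar> \<le> e + e'" if t: "t \<in> {a..b}" for t
  proof -
    have "l t \<in> {a..b}" using l(1) t by (auto simp: time_changes_def)
    then show ?thesis
      using l(2)[rule_format, OF t] k(2)[rule_format, of "l t"] by linarith
  qed
  then show ?thesis
    using time_changes_compose[OF l(1) k(1)] e e' unfolding skorokhod_close_def
    by (intro conjI bexI[of _ "\<lambda>t. k (l t)"]) auto
qed

lemma skorokhod_dist_less:
  assumes "x \<in> skorokhod_space a b" "y \<in> skorokhod_space a b" "skorokhod_dist a b x y < d"
  shows "\<exists>e<d. skorokhod_close a b x y e"
  using assms skorokhod_close_exists[OF assms(1,2)]
  by (metis cInf_lessD empty_iff mem_Collect_eq skorokhod_dist_alt ex_in_conv)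

lemma skorokhod_dist_le:
  assumes "x \<in> skorokhod_space a b" "y \<in> skorokhod_space a b" "skorokhod_close a b x y e"
  shows "skorokhod_dist a b x y \<le> e"
  unfolding skorokhod_dist_alt[OF assms(1,2)]
  by (rule cInf_lower) (use assms(3) in \<open>auto intro!: bdd_belowI[of _ 0] simp: skorokhod_close_def\<close>)

lemma skorokhod_dist_nonneg: "0 \<le> skorokhod_dist a b x y"
proof (cases "x \<in> skorokhod_space a b \<and> y \<in> skorokhod_space a b")
  case True
  then show ?thesis
    using skorokhod_close_exists[of x a b y]
    by (auto simp: skorokhod_dist_alt intro!: cInf_greatest) (auto simp: skorokhod_close_def)
next
  case False
  then show ?thesis by (auto simp: skorokhod_dist_def)
qed

lemma skorokhod_dist_eq_0:
  assumes x: "x \<in> skorokhod_space a b" and y: "y \<in> skorokhod_space a b"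
    and 0: "skorokhod_dist a b x y = 0"
  shows "x = y"
proof -
  have close: "\<exists>l\<in>time_changes a b. \<forall>t\<in>{a..b}. \<bar>l t - t\<bar> < d \<and> \<bar>x t - y (l t)\<bar> < d" if d: "d > 0" for d
    using skorokhod_dist_less[OF x y, of d] 0 d unfolding skorokhod_close_def
    by (metis order_le_less_trans)
  have "x t = y t" if t: "t \<in> {a..b}" for t
  proof (rule ccontr)
    assume ne: "x t \<noteq> y t"
    define c where "c = \<bar>x t - y t\<bar> / 3"
    have c: "c > 0" using ne by (simp add: c_def)
    show False
    proof (cases "t < b")
      case True
      then have "(x \<longlongrightarrow> x t) (at_right t)" "(y \<longlongrightarrow> y t) (at_right t)"
        using x y t by (auto simp: skorokhod_space_def cadlag_on_def)
      then have "eventually (\<lambda>s. dist (x s) (x t) < c \<and> dist (y s) (y t) < c) (at_right t)"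
        using c by (intro eventually_conj tendstoD)
      then obtain r where r: "r > t" "\<And>s. s > t \<Longrightarrow> s < r \<Longrightarrow> dist (x s) (x t) < c \<and> dist (y s) (y t) < c"
        by (auto simp: eventually_at_right_field)
      define r' where "r' = min r b"
      define s where "s = (t + r') / 2"
      have s: "t < s" "s < r'" "s \<in> {a..b}" using r(1) True t by (auto simp: s_def r'_def)
      define d where "d = min c (min (s - t) (r' - s))"
      have "d > 0" using c s by (simp add: d_def)
      then obtain l where l: "\<bar>l s - s\<bar> < d" "\<bar>x s - y (l s)\<bar> < d"
        using close s(3) by blast
      have "t < l s" "l s < r" "s < r" using l(1) s by (auto simp: d_def r'_def)
      then have "\<bar>x s - x t\<bar> < c" "\<bar>y (l s) - y t\<bar> < c" "\<bar>x s - y (l s)\<bar> < c"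
        using r(2)[of s] r(2)[of "l s"] s(1) l(2) by (auto simp: dist_real_def d_def)
      then have "\<bar>x t - y t\<bar> < c + c + c" by arith
      then show False by (simp add: c_def)
    next
      case False
      then have tb: "t = b" "a \<le> b" using t by auto
      obtain l where l: "l \<in> time_changes a b" "\<bar>x b - y (l b)\<bar> < c"
        using close[OF c] t tb by blast
      have "l b \<in> {a..b}" using l(1) tb by (auto simp: time_changes_def)
      moreover have "b \<in> l ` {a..b}" using l(1) tb by (auto simp: time_changes_def)
      then obtain s where "s \<in> {a..b}" "l s = b" by auto
      then have "b \<le> l b"
        using strict_mono_on_leD[of "{a..b}" l s b] l(1) tb by (auto simp: time_changes_def)
      ultimately have "l b = b" by auto
      then show False using l(2) c tb by (auto simp: c_def)
    qed
  qed
  then show ?thesis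
    using x y by (auto simp: skorokhod_space_def intro: extensionalityI)
qed

lemma Metric_space_skorokhod: "Metric_space (skorokhod_space a b) (skorokhod_dist a b)"
proof
  fix x y z
  show "0 \<le> skorokhod_dist a b x y" by (rule skorokhod_dist_nonneg)
  have "{e. skorokhod_close a b x y e} = {e. skorokhod_close a b y x e}"
    using skorokhod_close_sym by blast
  then show "skorokhod_dist a b x y = skorokhod_dist a b y x"
    by (cases "x \<in> skorokhod_space a b \<and> y \<in> skorokhod_space a b")
       (auto simp: skorokhod_dist_alt, auto simp: skorokhod_dist_def)
  assume x: "x \<in> skorokhod_space a b" and y: "y \<in> skorokhod_space a b"
  show "(skorokhod_dist a b x y = 0) = (x = y)"
  proof
    assume "x = y"
    then have "skorokhod_close a b x y 0"
      unfolding skorokhod_close_def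
      by (intro conjI bexI[of _ "\<lambda>t. t"] id_in_time_changes) auto
    then show "skorokhod_dist a b x y = 0"
      using skorokhod_dist_le[OF x y] skorokhod_dist_nonneg[of a b x y] by fastforce
  qed (rule skorokhod_dist_eq_0[OF x y])
  assume z: "z \<in> skorokhod_space a b"
  show "skorokhod_dist a b x z \<le> skorokhod_dist a b x y + skorokhod_dist a b y z"
  proof (rule field_le_epsilon)
    fix d :: real assume "0 < d"
    then obtain e e' where "e < skorokhod_dist a b x y + d / 2" "skorokhod_close a b x y e"
      "e' < skorokhod_dist a b y z + d / 2" "skorokhod_close a b y z e'"
      using skorokhod_dist_less[OF x y, of "skorokhod_dist a b x y + d / 2"]
        skorokhod_dist_less[OF y z, of "skorokhod_dist a b y z + d / 2"] by auto
    then show "skorokhod_dist a b x z \<le> skorokhod_dist a b x y + skorokhod_dist a b y z + d"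
      using skorokhod_dist_le[OF x z skorokhod_close_trans] by fastforce
  qed
qed

abbreviation skorokhod_topology :: "real \<Rightarrow> real \<Rightarrow> (real \<Rightarrow> real) topology" where
  "skorokhod_topology a b \<equiv> Metric_space.mtopology (skorokhod_space a b) (skorokhod_dist a b)"

definition skorokhod_borel :: "real \<Rightarrow> real \<Rightarrow> (real \<Rightarrow> real) measure" where
  "skorokhod_borel a b = sigma (skorokhod_space a b) {U. openin (skorokhod_topology a b) U}"

section \<open>Weak convergence of processes in \<open>D[a,b]\<close>\<close>

text \<open>A process on \<open>[a,b]\<close> whose paths are cadlag only almost surely is identified with any
  random element of \<open>D[a,b]\<close> that has almost surely the same path on \<open>[a,b]\<close>.\<close>

definition skorokhod_version ::
    "real \<Rightarrow> real \<Rightarrow> 'a measure \<Rightarrow> (real \<Rightarrow> 'a \<Rightarrow> real) \<Rightarrow> ('a \<Rightarrow> real \<Rightarrow> real) \<Rightarrow> bool" where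
  "skorokhod_version a b M X \<xi> \<longleftrightarrow>
     \<xi> \<in> M \<rightarrow>\<^sub>M skorokhod_borel a b \<and> (AE \<omega> in M. \<forall>t\<in>{a..b}. \<xi> \<omega> t = X t \<omega>)"

text \<open>The expectations below do not depend on the chosen versions. In particular the definition
  asserts that the \<open>X n\<close> and \<open>Z\<close> are random elements of \<open>D[a,b]\<close>.\<close>

definition weak_conv_skorokhod ::
    "real \<Rightarrow> real \<Rightarrow> 'a measure \<Rightarrow> (nat \<Rightarrow> real \<Rightarrow> 'a \<Rightarrow> real) \<Rightarrow>
     'b measure \<Rightarrow> (real \<Rightarrow> 'b \<Rightarrow> real) \<Rightarrow> bool" where
  "weak_conv_skorokhod a b M X N Z \<longleftrightarrow>
     (\<exists>\<xi> \<zeta>. (\<forall>n. skorokhod_version a b M (X n) (\<xi> n)) \<and> skorokhod_version a b N Z \<zeta> \<and>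
        (\<forall>f :: (real \<Rightarrow> real) \<Rightarrow> real.
           continuous_map (skorokhod_topology a b) euclideanreal f \<and>
           bounded (f ` skorokhod_space a b) \<longrightarrow>
           (\<lambda>n. \<integral>\<omega>. f (\<xi> n \<omega>) \<partial>M) \<longlonglongrightarrow> (\<integral>\<omega>. f (\<zeta> \<omega>) \<partial>N)))"

section \<open>Brownian motion on \<open>[0,1]\<close>\<close>

definition standard_brownian_motion :: "'a measure \<Rightarrow> (real \<Rightarrow> 'a \<Rightarrow> real) \<Rightarrow> bool" where
  "standard_brownian_motion N B \<longleftrightarrow>
     prob_space N \<and>
     (\<forall>t\<in>{0..1}. B t \<in> borel_measurable N) \<and>
     (AE \<omega> in N. B 0 \<omega> = 0) \<and>
     (\<forall>s t. 0 \<le> s \<and> s < t \<and> t \<le> 1 \<longrightarrow>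
        distributed N lborel (\<lambda>\<omega>. B t \<omega> - B s \<omega>) (normal_density 0 (sqrt (t - s)))) \<and>
     (\<forall>n (t :: nat \<Rightarrow> real). strict_mono_on {..n} t \<and> t ` {..n} \<subseteq> {0..1} \<longrightarrow>
        prob_space.indep_vars N (\<lambda>_. borel) (\<lambda>i \<omega>. B (t (Suc i)) \<omega> - B (t i) \<omega>) {..<n}) \<and>
     (AE \<omega> in N. continuous_on {0..1} (\<lambda>t. B t \<omega>))"

section \<open>Innovations\<close>

definition strictly_stationary :: "'a measure \<Rightarrow> (nat \<Rightarrow> 'a \<Rightarrow> real) \<Rightarrow> bool" where
  "strictly_stationary M \<epsilon> \<longleftrightarrow>
     (\<forall>t\<ge>1. \<epsilon> t \<in> borel_measurable M) \<and>
     (\<forall>J k. finite J \<and> J \<subseteq> {1..} \<longrightarrow>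
        distr M (\<Pi>\<^sub>M t\<in>J. borel) (\<lambda>\<omega>. \<lambda>t\<in>J. \<epsilon> (t + k) \<omega>) =
        distr M (\<Pi>\<^sub>M t\<in>J. borel) (\<lambda>\<omega>. \<lambda>t\<in>J. \<epsilon> t \<omega>))"

definition covariance :: "'a measure \<Rightarrow> ('a \<Rightarrow> real) \<Rightarrow> ('a \<Rightarrow> real) \<Rightarrow> real" where
  "covariance M X Y =
     (\<integral>\<omega>. (X \<omega> - (\<integral>\<omega>'. X \<omega>' \<partial>M)) * (Y \<omega> - (\<integral>\<omega>'. Y \<omega>' \<partial>M)) \<partial>M)"

definition innovation_sd :: "'a measure \<Rightarrow> (nat \<Rightarrow> 'a \<Rightarrow> real) \<Rightarrow> real" where
  "innovation_sd M \<epsilon> = sqrt (\<integral>\<omega>. (\<epsilon> 1 \<omega>)\<^sup>2 \<partial>M)"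

definition eta_sq :: "'a measure \<Rightarrow> (nat \<Rightarrow> 'a \<Rightarrow> real) \<Rightarrow> nat \<Rightarrow> real" where
  "eta_sq M \<epsilon> T = (innovation_sd M \<epsilon>)\<^sup>2 +
     2 * (\<Sum>t=1..T. (real T - real t) / real T * (\<integral>\<omega>. \<epsilon> 1 \<omega> * \<epsilon> (1 + t) \<omega> \<partial>M))"

text \<open>\<open>N\<^sub>1\<close> and \<open>N\<^sub>2\<close> carry the two limiting Brownian motions, about whose joint law
  nothing is assumed.\<close>

definition condition_E1 ::
    "'a measure \<Rightarrow> (nat \<Rightarrow> 'a \<Rightarrow> real) \<Rightarrow> real \<Rightarrow> real \<Rightarrow>
     'b measure \<Rightarrow> (real \<Rightarrow> 'b \<Rightarrow> real) \<Rightarrow> 'c measure \<Rightarrow> (real \<Rightarrow> 'c \<Rightarrow> real) \<Rightarrow> bool" where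
  "condition_E1 M \<epsilon> \<eta> \<eta>' N\<^sub>1 B\<^sub>1 N\<^sub>2 B\<^sub>2 \<longleftrightarrow>
     strictly_stationary M \<epsilon> \<and>
     (\<forall>t\<ge>1. (\<integral>\<omega>. \<epsilon> t \<omega> \<partial>M) = 0) \<and>
     integrable M (\<lambda>\<omega>. \<bar>\<epsilon> 1 \<omega>\<bar> ^ 4) \<and>
     summable (\<lambda>t. covariance M (\<lambda>\<omega>. (\<epsilon> 1 \<omega>)\<^sup>2) (\<lambda>\<omega>. (\<epsilon> (1 + Suc t) \<omega>)\<^sup>2)) \<and>
     0 < \<eta> \<and> 0 < \<eta>' \<and>
     standard_brownian_motion N\<^sub>1 B\<^sub>1 \<and> standard_brownian_motion N\<^sub>2 B\<^sub>2 \<and>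
     weak_conv_skorokhod 0 1
       M (\<lambda>T s \<omega>. (\<Sum>i=1..nat \<lfloor>real T * s\<rfloor>. \<epsilon> i \<omega>) / sqrt (real T))
       N\<^sub>1 (\<lambda>s \<omega>. \<eta> * B\<^sub>1 s \<omega>) \<and>
     weak_conv_skorokhod 0 1
       M (\<lambda>T s \<omega>. (\<Sum>i=1..nat \<lfloor>real T * s\<rfloor>. (\<epsilon> i \<omega>)\<^sup>2 - (\<integral>\<omega>'. (\<epsilon> i \<omega>')\<^sup>2 \<partial>M)) / sqrt (real T))
       N\<^sub>2 (\<lambda>s \<omega>. \<eta>' * B\<^sub>2 s \<omega>) \<and>
     eta_sq M \<epsilon> \<longlonglongrightarrow> \<eta>\<^sup>2"

section \<open>Kernels\<close>

definition kernel_K1 :: "(real \<Rightarrow> real) \<Rightarrow> bool" where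
  "kernel_K1 K \<longleftrightarrow> bounded (range K) \<and>
     integrable lborel K \<and> (\<integral>z. K z \<partial>lborel) = 1 \<and>
     integrable lborel (\<lambda>z. z * K z) \<and> (\<integral>z. z * K z \<partial>lborel) = 0"

definition kernel_K2 :: "(real \<Rightarrow> real) \<Rightarrow> bool" where
  "kernel_K2 K \<longleftrightarrow>
     (\<forall>z. K differentiable at z) \<and> (\<forall>z. deriv K differentiable at z) \<and>
     continuous_on UNIV (deriv (deriv K)) \<and> bounded (range (deriv K))"

definition kernel_K3 :: "(real \<Rightarrow> real) \<Rightarrow> bool" where
  "kernel_K3 K \<longleftrightarrow>
     (\<exists>V. \<forall>n (t :: nat \<Rightarrow> real). strict_mono_on {..n} t \<longrightarrow>
        (\<Sum>i<n. \<bar>K (t (Suc i)) - K (t i)\<bar>) \<le> V)"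

section \<open>The weighted Dickey-Fuller process and its limit\<close>

text \<open>Division by 0 yields 0 in HOL, which covers both the convention \<open>0/0 = 0\<close> and the
  case \<open>\<lfloor>Ts\<rfloor> = 0\<close>.\<close>

definition dickey_fuller ::
    "(real \<Rightarrow> real) \<Rightarrow> (nat \<Rightarrow> real) \<Rightarrow> (nat \<Rightarrow> 'a \<Rightarrow> real) \<Rightarrow> nat \<Rightarrow> real \<Rightarrow> 'a \<Rightarrow> real" where
  "dickey_fuller K h Y T s \<omega> =
     (let m = nat \<lfloor>real T * s\<rfloor> in
        (1 / real m * (\<Sum>t=1..m. Y (t - 1) \<omega> * (Y t \<omega> - Y (t - 1) \<omega>) * K ((real m - real t) / h T))) /
        (1 / (real m)\<^sup>2 * (\<Sum>t=1..m. (Y (t - 1) \<omega>)\<^sup>2)))"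

definition dickey_fuller_limit ::
    "(real \<Rightarrow> real) \<Rightarrow> real \<Rightarrow> real \<Rightarrow> (real \<Rightarrow> 'a \<Rightarrow> real) \<Rightarrow> real \<Rightarrow> 'a \<Rightarrow> real" where
  "dickey_fuller_limit K \<zeta> \<theta> B s \<omega> =
     (if s = 0 then 0 else
        s / 2 * (K 0 * (B s \<omega>)\<^sup>2
                 + \<zeta> * (LINT r:{0..s}|lborel. (B r \<omega>)\<^sup>2 * deriv K (\<zeta> * (s - r)))
                 - 1 / \<theta>\<^sup>2 * (LINT r:{0..s}|lborel. K (\<zeta> * (s - r)))) /
        (LINT r:{0..s}|lborel. (B r \<omega>)\<^sup>2))"

end

theory Submission
  imports Defs
begin

text \<open>Abel summation and \<open>2 Y\<^sub>t\<^sub>-\<^sub>1 \<Delta>Y\<^sub>t = \<Delta>(Y\<^sub>t\<^sup>2) - \<epsilon>\<^sub>t\<^sup>2\<close> turn the weighted Dickey-Fuller process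
  into an explicit integral functional of the scaled partial sum path \<open>u(r) = Y(\<lfloor>Tr\<rfloor>) / \<surd>T\<close>, up to a
  term controlled by \<open>max |\<Sum>(\<epsilon>\<^sub>t\<^sup>2 - \<sigma>\<^sup>2)| / T\<close>. That term vanishes in probability by the second
  invariance principle. Along any paths that converge uniformly to a continuous path with
  nonvanishing quadratic integral, dominated convergence yields the limit functional uniformly on
  \<open>[\<kappa>,1]\<close>, and Skorokhod convergence to a continuous path is uniform.

  Passing to expectations needs a mapping theorem for a functional that depends on \<open>T\<close>, is perturbed
  by a negligible remainder and converges only at almost every limit path. It is obtained directly
  from Lipschitz majorants and minorants, so that neither a representation theorem nor the
  separability of the Skorokhod space is used.\<close>

section \<open>An extended continuous mapping theorem\<close>

text \<open>The obstacle is the squared increments. Closeness of the partial sum path to its limit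
  in the Skorokhod distance says nothing about them, and (E1) gives no joint law for its two limits.
  The second limit therefore enters only as convergence in probability to 0 of a scalar
  \<open>R\<close> carried beside the path, and the mapping theorem has to accept such a companion.

  (E1) also brings its own Brownian motion, on a space other than that of the conclusion. The two
  limits are identified through the joint law of finitely many increments, for continuous bounded
  functionals of the path.

  Measurability refers to the Borel sets of the Skorokhod topology and is not checked coordinate by
  coordinate: each random path is a step path, which reads finitely many numbers, or a uniform limit
  of step paths.

  The scale \<eta> / \<sigma> makes sense because \<sigma> > 0, which is derived from \<eta>_T^2 ->
  \<eta>^2 > 0. The left end \<kappa> > 0 keeps limiting times away from 0, where the quadratic
  integral vanishes.\<close>

context Metric_space
begin

section \<open>Borel maps into a metric space\<close>

abbreviation mborel :: "'a measure" where
  "mborel \<equiv> sigma M {U. openin mtopology U}"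

lemma openin_subset_Pow: "{U. openin mtopology U} \<subseteq> Pow M"
  using openin_subset[of mtopology] by auto

lemma space_mborel: "space mborel = M"
  by (rule space_measure_of[OF openin_subset_Pow])

lemma openin_imp_sets_mborel: "openin mtopology U \<Longrightarrow> U \<in> sets mborel"
  by (subst sets_measure_of[OF openin_subset_Pow]) auto

lemma measurable_mborelI:
  assumes "\<And>\<omega>. \<omega> \<in> space P \<Longrightarrow> f \<omega> \<in> M"
    and "\<And>U. openin mtopology U \<Longrightarrow> f -` U \<inter> space P \<in> sets P"
  shows "f \<in> P \<rightarrow>\<^sub>M mborel"
  by (rule measurable_measure_of[OF openin_subset_Pow]) (use assms in auto)

lemma continuous_map_real_measurable:
  assumes "continuous_map mtopology euclideanreal f"
  shows "f \<in> borel_measurable mborel"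
proof (rule borel_measurableI)
  fix S :: "real set" assume "open S"
  then have "openin mtopology {x \<in> topspace mtopology. f x \<in> S}"
    using assms by (intro openin_continuous_map_preimage[where Y = euclideanreal]) auto
  then show "f -` S \<inter> space mborel \<in> sets mborel"
    by (intro openin_imp_sets_mborel) (simp add: space_mborel vimage_def Int_def conj_commute)
qed

text \<open>A one-sided inequality suffices, since exchanging x and y gives the other side.\<close>

lemma Lipschitz_continuous_map_real:
  assumes "\<And>x y. x \<in> M \<Longrightarrow> y \<in> M \<Longrightarrow> f x \<le> f y + L * d x y"
  shows "continuous_map mtopology euclideanreal f"
proof -
  have "\<exists>\<delta>>0. \<forall>y. y \<in> M \<and> d x y < \<delta> \<longrightarrow> dist (f x) (f y) < e" if x: "x \<in> M" and e: "e > 0" for x e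
  proof (intro exI[of _ "e / (\<bar>L\<bar> + 1)"] conjI allI impI)
    show "0 < e / (\<bar>L\<bar> + 1)" using e by simp
    fix y assume y: "y \<in> M \<and> d x y < e / (\<bar>L\<bar> + 1)"
    have "(\<bar>L\<bar> + 1) * d x y < e" using y by (simp add: field_simps)
    moreover have "L * d x y \<le> (\<bar>L\<bar> + 1) * d x y" by (intro mult_right_mono) auto
    ultimately have "L * d x y < e" by linarith
    then show "dist (f x) (f y) < e"
      using assms[of x y] assms[of y x] x y commute[of x y] by (simp add: dist_real_def abs_less_iff)
  qed
  then show ?thesis
    using metric_continuous_map[OF Met_TC.Metric_space_axioms, of f] by (simp add: mtopology_is_euclidean)
qed

text \<open>Open sets are recovered from the continuous functions \<open>x \<mapsto> dist (x, M - U)\<close>.\<close>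

lemma measurable_mborel_limit:
  assumes f: "\<And>n. f n \<in> P \<rightarrow>\<^sub>M mborel"
    and g: "\<And>\<omega>. \<omega> \<in> space P \<Longrightarrow> g \<omega> \<in> M"
    and lim: "\<And>\<omega>. \<omega> \<in> space P \<Longrightarrow> (\<lambda>n. d (f n \<omega>) (g \<omega>)) \<longlonglongrightarrow> 0"
  shows "g \<in> P \<rightarrow>\<^sub>M mborel"
proof (rule measurable_mborelI[OF g])
  fix U assume U: "openin mtopology U"
  have fM: "f n \<omega> \<in> M" if "\<omega> \<in> space P" for n \<omega>
    using measurable_space[OF f that] by (simp add: space_mborel)
  show "g -` U \<inter> space P \<in> sets P"
  proof (cases "M - U = {}")
    case True
    then have "g -` U \<inter> space P = space P" using g by auto
    then show ?thesis by simp
  next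
    case False
    \<comment> \<open>The case U = M is split off because an infimum over an empty complement
      carries no information.\<close>
    define \<phi> where "\<phi> x = (INF y\<in>M - U. d x y)" for x
    have bdd: "bdd_below (d x ` (M - U))" for x by (intro bdd_belowI[of _ 0]) auto
    have lip: "\<phi> x \<le> \<phi> y + 1 * d x y" if "x \<in> M" "y \<in> M" for x y
    proof -
      have "\<phi> x - d x y \<le> d y z" if z: "z \<in> M - U" for z
        using cINF_lower[OF bdd[of x] z] triangle[of x y z] z \<open>x \<in> M\<close> \<open>y \<in> M\<close> by (simp add: \<phi>_def)
      then have "\<phi> x - d x y \<le> \<phi> y"
        unfolding \<phi>_def[of y] using False by (intro cINF_greatest)
      then show ?thesis by simp
    qed
    have "(\<lambda>n. \<phi> (f n \<omega>)) \<longlonglongrightarrow> \<phi> (g \<omega>)" if w: "\<omega> \<in> space P" for \<omega>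
    proof (rule Lim_transform2[OF tendsto_const], rule Lim_null_comparison[OF _ lim[OF w]])
      show "\<forall>\<^sub>F n in sequentially. norm (\<phi> (g \<omega>) - \<phi> (f n \<omega>)) \<le> d (f n \<omega>) (g \<omega>)"
        using lip[OF fM[OF w] g[OF w]] lip[OF g[OF w] fM[OF w]] commute
        by (auto simp: abs_le_iff algebra_simps)
    qed
    moreover have "(\<lambda>\<omega>. \<phi> (f n \<omega>)) \<in> borel_measurable P" for n
      using measurable_compose[OF f continuous_map_real_measurable[OF Lipschitz_continuous_map_real[OF lip]]] .
    ultimately have [measurable]: "(\<lambda>\<omega>. \<phi> (g \<omega>)) \<in> borel_measurable P"
      by (rule borel_measurable_LIMSEQ_real)
    \<comment> \<open>Openness enters in the forward direction: a ball of radius r inside U keeps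
      all of M - U at distance at least r.\<close>
    have "x \<in> U \<longleftrightarrow> 0 < \<phi> x" if x: "x \<in> M" for x
    proof
      assume "x \<in> U"
      then obtain r where r: "r > 0" "mball x r \<subseteq> U" using U by (auto simp: openin_mtopology)
      have "r \<le> d x z" if "z \<in> M - U" for z
        using r(2) that x by (auto simp: subset_iff not_less[symmetric])
      then have "r \<le> \<phi> x" unfolding \<phi>_def using False by (intro cINF_greatest)
      then show "0 < \<phi> x" using r(1) by simp
    next
      assume *: "0 < \<phi> x"
      show "x \<in> U"
      proof (rule ccontr)
        assume "x \<notin> U"
        then have "\<phi> x \<le> d x x" unfolding \<phi>_def using x by (intro cINF_lower[OF bdd]) auto
        then show False using * x by simp
      qed
    qed
    then have "g -` U \<inter> space P = {\<omega>\<in>space P. 0 < \<phi> (g \<omega>)}"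
      using g by auto
    then show ?thesis by simp
  qed
qed

text \<open>The functions \<open>G k\<close> below are bounded and \<open>k\<close>-Lipschitz, hence continuous test functions. They
  dominate \<open>U n\<close> for \<open>n \<ge> k\<close> off the event \<open>R n \<ge> 1 / (k + 1)\<close>, and the assumption \<open>key\<close> says that
  their upper limit along \<open>\<zeta>\<close> is at most \<open>V\<close>.\<close>

lemma extended_mapping_upper:
  fixes \<xi> :: "nat \<Rightarrow> 'p \<Rightarrow> 'a" and \<zeta> :: "'q \<Rightarrow> 'a" and U R :: "nat \<Rightarrow> 'p \<Rightarrow> real"
  assumes P: "prob_space P" and Q: "prob_space Q"
    and \<xi>: "\<And>n. \<xi> n \<in> P \<rightarrow>\<^sub>M mborel" and \<zeta>: "\<zeta> \<in> Q \<rightarrow>\<^sub>M mborel"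
    and conv: "\<And>f. continuous_map mtopology euclideanreal f \<Longrightarrow> bounded (f ` M) \<Longrightarrow>
        (\<lambda>n. \<integral>\<omega>. f (\<xi> n \<omega>) \<partial>P) \<longlonglongrightarrow> (\<integral>\<omega>. f (\<zeta> \<omega>) \<partial>Q)"
    and U[measurable]: "\<And>n. U n \<in> borel_measurable P"
    and U_bd: "\<And>n \<omega>. \<omega> \<in> space P \<Longrightarrow> \<bar>U n \<omega>\<bar> \<le> C"
    and V[measurable]: "V \<in> borel_measurable Q"
    and V_bd: "\<And>\<omega>. \<omega> \<in> space Q \<Longrightarrow> \<bar>V \<omega>\<bar> \<le> C"
    and R[measurable]: "\<And>n. R n \<in> borel_measurable P"
    and R0: "\<And>e. e > 0 \<Longrightarrow> (\<lambda>n. measure P {\<omega>\<in>space P. e \<le> R n \<omega>}) \<longlonglongrightarrow> 0"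
    and key: "AE \<omega>' in Q. \<forall>e>0. \<exists>r>0. \<forall>\<^sub>F n in sequentially. \<forall>\<omega>\<in>space P.
        d (\<xi> n \<omega>) (\<zeta> \<omega>') < r \<longrightarrow> R n \<omega> < r \<longrightarrow> U n \<omega> < V \<omega>' + e"
    and e: "e > 0"
  shows "\<forall>\<^sub>F n in sequentially. (\<integral>\<omega>. U n \<omega> \<partial>P) < (\<integral>\<omega>. V \<omega> \<partial>Q) + e"
proof -
  interpret P: prob_space P by fact
  interpret Q: prob_space Q by fact
  have \<xi>M: "\<xi> n \<omega> \<in> M" if "\<omega> \<in> space P" for n \<omega>
    using measurable_space[OF \<xi> that] by (simp add: space_mborel)
  have \<zeta>M: "\<zeta> \<omega> \<in> M" if "\<omega> \<in> space Q" for \<omega>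
    using measurable_space[OF \<zeta> that] by (simp add: space_mborel)
  have C: "0 \<le> C" using P.not_empty U_bd by fastforce
  \<comment> \<open>The element \<open>-C\<close> keeps the set nonempty and bounds
    \<open>G k\<close> below. The supremum runs over all later n and all outcomes at once, so
    \<open>G k\<close> is a deterministic function of the path.\<close>
  define A where "A k x = insert (-C) {U n \<omega> - real k * d (\<xi> n \<omega>) x | n \<omega>.
      k \<le> n \<and> \<omega> \<in> space P \<and> R n \<omega> < 1 / real (Suc k)}" for k x
  define G where "G k x = Sup (A k x)" for k x
  have A_le: "a \<le> C" if "a \<in> A k x" for a k x
  proof (cases "a = - C")
    case False
    then obtain n \<omega> where a: "a = U n \<omega> - real k * d (\<xi> n \<omega>) x" "\<omega> \<in> space P"
      using \<open>a \<in> A k x\<close> by (auto simp: A_def)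
    have "0 \<le> real k * d (\<xi> n \<omega>) x" by simp
    then show ?thesis using U_bd[OF a(2), of n] a(1) by linarith
  qed (use C in simp)
  have bdd: "bdd_above (A k x)" for k x using A_le by (meson bdd_aboveI)
  have ne: "A k x \<noteq> {}" for k x by (simp add: A_def)
  have G_bd: "\<bar>G k x\<bar> \<le> C" for k x
  proof -
    have "- C \<le> G k x" unfolding G_def by (rule cSup_upper[OF _ bdd]) (simp add: A_def)
    moreover have "G k x \<le> C" unfolding G_def by (rule cSup_least[OF ne A_le])
    ultimately show ?thesis by simp
  qed
  have G_lip: "G k x \<le> G k y + real k * d x y" if xy: "x \<in> M" "y \<in> M" for k x y
  proof -
    have "a \<le> G k y + real k * d x y" if a: "a \<in> A k x" for a
    proof (cases "a = - C")
      case True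
      moreover have "0 \<le> real k * d x y" by simp
      ultimately show ?thesis using G_bd[of k y] by linarith
    next
      case False
      then obtain n \<omega> where w: "a = U n \<omega> - real k * d (\<xi> n \<omega>) x" "\<omega> \<in> space P"
          "k \<le> n" "R n \<omega> < 1 / real (Suc k)"
        using a by (auto simp: A_def)
      have "U n \<omega> - real k * d (\<xi> n \<omega>) y \<le> G k y"
        unfolding G_def by (rule cSup_upper[OF _ bdd]) (use w in \<open>auto simp: A_def\<close>)
      moreover have "real k * d (\<xi> n \<omega>) y \<le> real k * (d (\<xi> n \<omega>) x + d x y)"
        by (intro mult_left_mono triangle \<xi>M w xy) auto
      ultimately show ?thesis using w(1) by (simp add: algebra_simps)
    qed
    then show ?thesis unfolding G_def[of k x] by (intro cSup_least[OF ne])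
  qed
  have G_cont: "continuous_map mtopology euclideanreal (G k)" for k
    by (rule Lipschitz_continuous_map_real[OF G_lip])
  note G_meas[measurable] = continuous_map_real_measurable[OF G_cont]
  have [measurable]: "(\<lambda>\<omega>. G k (\<xi> n \<omega>)) \<in> borel_measurable P" for k n
    by (rule measurable_compose[OF \<xi> G_meas])
  have [measurable]: "(\<lambda>\<omega>. G k (\<zeta> \<omega>)) \<in> borel_measurable Q" for k
    by (rule measurable_compose[OF \<zeta> G_meas])
  have G_conv: "(\<lambda>n. \<integral>\<omega>. G k (\<xi> n \<omega>) \<partial>P) \<longlonglongrightarrow> (\<integral>\<omega>. G k (\<zeta> \<omega>) \<partial>Q)" for k
    by (rule conv[OF G_cont]) (use G_bd in \<open>auto simp: bounded_iff\<close>)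
  \<comment> \<open>At x = \<open>\<xi> n \<omega>\<close> the term of this same n and \<omega>
    carries no penalty. On the excluded event both functions lie in [-C, C], which costs 2 *
    C.\<close>
  have upper: "(\<integral>\<omega>. U n \<omega> \<partial>P) \<le> (\<integral>\<omega>. G k (\<xi> n \<omega>) \<partial>P)
      + 2 * C * measure P {\<omega>\<in>space P. 1 / real (Suc k) \<le> R n \<omega>}" if n: "k \<le> n" for k n
  proof -
    let ?I = "indicator {\<omega>\<in>space P. 1 / real (Suc k) \<le> R n \<omega>} :: _ \<Rightarrow> real"
    have int: "integrable P (\<lambda>\<omega>. G k (\<xi> n \<omega>))"
      by (rule P.integrable_const_bound[of _ C]) (use G_bd in auto)
    have int2: "integrable P (\<lambda>\<omega>. 2 * C * ?I \<omega>)"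
      by (rule P.integrable_const_bound[of _ "2 * C"]) (use C in \<open>auto split: split_indicator\<close>)
    have "(\<integral>\<omega>. U n \<omega> \<partial>P) \<le> (\<integral>\<omega>. G k (\<xi> n \<omega>) + 2 * C * ?I \<omega> \<partial>P)"
    proof (rule integral_mono)
      show "integrable P (U n)"
        by (rule P.integrable_const_bound[of _ C]) (use U_bd in auto)
      show "integrable P (\<lambda>\<omega>. G k (\<xi> n \<omega>) + 2 * C * ?I \<omega>)"
        using int int2 by simp
      fix \<omega> assume w: "\<omega> \<in> space P"
      show "U n \<omega> \<le> G k (\<xi> n \<omega>) + 2 * C * ?I \<omega>"
      proof (cases "1 / real (Suc k) \<le> R n \<omega>")
        case True
        then show ?thesis using U_bd[OF w, of n] G_bd[of k "\<xi> n \<omega>"] w by (auto simp: abs_le_iff)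
      next
        case False
        have "U n \<omega> - real k * d (\<xi> n \<omega>) (\<xi> n \<omega>) \<le> G k (\<xi> n \<omega>)"
          unfolding G_def by (rule cSup_upper[OF _ bdd]) (use False w n in \<open>auto simp: A_def not_le\<close>)
        then show ?thesis using False \<xi>M[OF w] by simp
      qed
    qed
    also have "\<dots> = (\<integral>\<omega>. G k (\<xi> n \<omega>) \<partial>P)
        + 2 * C * measure P {\<omega>\<in>space P. 1 / real (Suc k) \<le> R n \<omega>}"
      by (subst Bochner_Integration.integral_add[OF int int2]) simp
    finally show ?thesis .
  qed
  \<comment> \<open>\<open>key\<close> controls \<open>G k\<close> only from above. Taking the
    maximum with V turns the upper bound into convergence, to which dominated convergence
    applies.\<close>
  have "AE \<omega>' in Q. (\<lambda>k. max (G k (\<zeta> \<omega>')) (V \<omega>')) \<longlonglongrightarrow> V \<omega>'"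
    using key AE_space
  proof eventually_elim
    case (elim \<omega>')
    show ?case
    proof (rule LIMSEQ_I)
      fix c :: real assume c: "0 < c"
      then have "c / 2 > 0" by simp
      then obtain r where r: "r > 0" and ev: "\<forall>\<^sub>F n in sequentially. \<forall>\<omega>\<in>space P.
        d (\<xi> n \<omega>) (\<zeta> \<omega>') < r \<longrightarrow> R n \<omega> < r \<longrightarrow> U n \<omega> < V \<omega>' + c / 2"
        using elim(1) by meson
      obtain n0 where n0: "\<And>n \<omega>. n \<ge> n0 \<Longrightarrow> \<omega>\<in>space P \<Longrightarrow>
        d (\<xi> n \<omega>) (\<zeta> \<omega>') < r \<Longrightarrow> R n \<omega> < r \<Longrightarrow> U n \<omega> < V \<omega>' + c / 2"
        using ev by (auto simp: eventually_sequentially)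
      obtain n1 where n1: "max (1 / r) (2 * C / r) < real n1" using reals_Archimedean2 by blast
      have "norm (max (G k (\<zeta> \<omega>')) (V \<omega>') - V \<omega>') < c" if k: "k \<ge> max n0 n1" for k
      proof -
        have "real n1 \<le> real k" using k by simp
        then have kr: "1 < real k * r" "2 * C < real k * r" 
          using n1 r by (auto simp: field_simps intro: less_le_trans)
        have "a \<le> V \<omega>' + c / 2" if a: "a \<in> A k (\<zeta> \<omega>')" for a
        proof (cases "a = - C")
          case True
          then show ?thesis using V_bd[OF elim(2)] c by linarith
        next
          case False
          then obtain n \<omega> where w: "a = U n \<omega> - real k * d (\<xi> n \<omega>) (\<zeta> \<omega>')" "\<omega> \<in> space P"
              "k \<le> n" "R n \<omega> < 1 / real (Suc k)"
            using a by (auto simp: A_def)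
          show ?thesis
          proof (cases "d (\<xi> n \<omega>) (\<zeta> \<omega>') < r")
            case True
            have "1 / real (Suc k) < r" using kr(1) r by (simp add: field_simps)
            then have "U n \<omega> < V \<omega>' + c / 2"
              using True w k by (intro n0) auto
            moreover have "0 \<le> real k * d (\<xi> n \<omega>) (\<zeta> \<omega>')" by simp
            ultimately show ?thesis using w(1) by linarith
          next
            case False
            then have "real k * r \<le> real k * d (\<xi> n \<omega>) (\<zeta> \<omega>')" by (intro mult_left_mono) auto
            then show ?thesis using w(1) kr(2) U_bd[OF w(2), of n] V_bd[OF elim(2)] c by linarith
          qed
        qed
        then have "G k (\<zeta> \<omega>') \<le> V \<omega>' + c / 2" unfolding G_def by (intro cSup_least[OF ne])
        then show ?thesis using c by (auto simp: max_def)
      qed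
      then show "\<exists>no. \<forall>k\<ge>no. norm (max (G k (\<zeta> \<omega>')) (V \<omega>') - V \<omega>') < c" by blast
    qed
  qed
  then have "(\<lambda>k. \<integral>\<omega>. max (G k (\<zeta> \<omega>)) (V \<omega>) \<partial>Q) \<longlonglongrightarrow> (\<integral>\<omega>. V \<omega> \<partial>Q)"
    by (intro integral_dominated_convergence[where w = "\<lambda>_. C"])
       (use G_bd V_bd in \<open>auto simp: max_def\<close>)
  then have "\<forall>\<^sub>F k in sequentially. (\<integral>\<omega>. max (G k (\<zeta> \<omega>)) (V \<omega>) \<partial>Q) < (\<integral>\<omega>. V \<omega> \<partial>Q) + e"
    using e by (intro order_tendstoD) auto
  then obtain k where k: "(\<integral>\<omega>. max (G k (\<zeta> \<omega>)) (V \<omega>) \<partial>Q) < (\<integral>\<omega>. V \<omega> \<partial>Q) + e"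
    by (auto simp: eventually_sequentially)
  have "(\<integral>\<omega>. G k (\<zeta> \<omega>) \<partial>Q) \<le> (\<integral>\<omega>. max (G k (\<zeta> \<omega>)) (V \<omega>) \<partial>Q)"
    by (intro integral_mono Q.integrable_const_bound[of _ C])
       (use G_bd V_bd in \<open>auto simp: max_def\<close>)
  moreover have "(\<lambda>n. (\<integral>\<omega>. G k (\<xi> n \<omega>) \<partial>P)
      + 2 * C * measure P {\<omega>\<in>space P. 1 / real (Suc k) \<le> R n \<omega>}) \<longlonglongrightarrow> (\<integral>\<omega>. G k (\<zeta> \<omega>) \<partial>Q) + 2 * C * 0"
    by (intro tendsto_intros G_conv R0) auto
  ultimately have "\<forall>\<^sub>F n in sequentially. (\<integral>\<omega>. G k (\<xi> n \<omega>) \<partial>P)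
      + 2 * C * measure P {\<omega>\<in>space P. 1 / real (Suc k) \<le> R n \<omega>} < (\<integral>\<omega>. V \<omega> \<partial>Q) + e"
    using k by (elim order_tendstoD(2)) auto
  then show ?thesis
    using eventually_ge_at_top[of k]
  proof eventually_elim
    case (elim n)
    then show ?case using upper[of k n] by linarith
  qed
qed

text \<open>The upper estimate for -U and -V is the lower estimate for U and V. \<open>R\<close>
  stands for whatever closeness of the paths does not control.\<close>

lemma extended_mapping:
  fixes \<xi> :: "nat \<Rightarrow> 'p \<Rightarrow> 'a" and \<zeta> :: "'q \<Rightarrow> 'a" and U R :: "nat \<Rightarrow> 'p \<Rightarrow> real"
  assumes P: "prob_space P" and Q: "prob_space Q"
    and \<xi>: "\<And>n. \<xi> n \<in> P \<rightarrow>\<^sub>M mborel" and \<zeta>: "\<zeta> \<in> Q \<rightarrow>\<^sub>M mborel"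
    and conv: "\<And>f. continuous_map mtopology euclideanreal f \<Longrightarrow> bounded (f ` M) \<Longrightarrow>
        (\<lambda>n. \<integral>\<omega>. f (\<xi> n \<omega>) \<partial>P) \<longlonglongrightarrow> (\<integral>\<omega>. f (\<zeta> \<omega>) \<partial>Q)"
    and U: "\<And>n. U n \<in> borel_measurable P"
    and U_bd: "\<And>n \<omega>. \<omega> \<in> space P \<Longrightarrow> \<bar>U n \<omega>\<bar> \<le> C"
    and V: "V \<in> borel_measurable Q"
    and V_bd: "\<And>\<omega>. \<omega> \<in> space Q \<Longrightarrow> \<bar>V \<omega>\<bar> \<le> C"
    and R: "\<And>n. R n \<in> borel_measurable P"
    and R0: "\<And>e. e > 0 \<Longrightarrow> (\<lambda>n. measure P {\<omega>\<in>space P. e \<le> R n \<omega>}) \<longlonglongrightarrow> 0"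
    and key: "AE \<omega>' in Q. \<forall>e>0. \<exists>r>0. \<forall>\<^sub>F n in sequentially. \<forall>\<omega>\<in>space P.
        d (\<xi> n \<omega>) (\<zeta> \<omega>') < r \<longrightarrow> R n \<omega> < r \<longrightarrow> \<bar>U n \<omega> - V \<omega>'\<bar> < e"
  shows "(\<lambda>n. \<integral>\<omega>. U n \<omega> \<partial>P) \<longlonglongrightarrow> (\<integral>\<omega>. V \<omega> \<partial>Q)"
proof (rule order_tendstoI)
  have key1: "AE \<omega>' in Q. \<forall>e>0. \<exists>r>0. \<forall>\<^sub>F n in sequentially. \<forall>\<omega>\<in>space P.
        d (\<xi> n \<omega>) (\<zeta> \<omega>') < r \<longrightarrow> R n \<omega> < r \<longrightarrow> U n \<omega> < V \<omega>' + e"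
    using key
  proof eventually_elim
    case (elim \<omega>')
    show ?case
    proof (intro allI impI)
      fix e :: real assume "e > 0"
      then obtain r where "r > 0" "\<forall>\<^sub>F n in sequentially. \<forall>\<omega>\<in>space P.
        d (\<xi> n \<omega>) (\<zeta> \<omega>') < r \<longrightarrow> R n \<omega> < r \<longrightarrow> \<bar>U n \<omega> - V \<omega>'\<bar> < e"
        using elim by blast
      then show "\<exists>r>0. \<forall>\<^sub>F n in sequentially. \<forall>\<omega>\<in>space P.
        d (\<xi> n \<omega>) (\<zeta> \<omega>') < r \<longrightarrow> R n \<omega> < r \<longrightarrow> U n \<omega> < V \<omega>' + e"
        by (intro exI[of _ r]) (auto elim!: eventually_mono simp: abs_less_iff)
    qed
  qed
  have key2: "AE \<omega>' in Q. \<forall>e>0. \<exists>r>0. \<forall>\<^sub>F n in sequentially. \<forall>\<omega>\<in>space P.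
        d (\<xi> n \<omega>) (\<zeta> \<omega>') < r \<longrightarrow> R n \<omega> < r \<longrightarrow> - U n \<omega> < - V \<omega>' + e"
    using key
  proof eventually_elim
    case (elim \<omega>')
    show ?case
    proof (intro allI impI)
      fix e :: real assume "e > 0"
      then obtain r where "r > 0" "\<forall>\<^sub>F n in sequentially. \<forall>\<omega>\<in>space P.
        d (\<xi> n \<omega>) (\<zeta> \<omega>') < r \<longrightarrow> R n \<omega> < r \<longrightarrow> \<bar>U n \<omega> - V \<omega>'\<bar> < e"
        using elim by blast
      then show "\<exists>r>0. \<forall>\<^sub>F n in sequentially. \<forall>\<omega>\<in>space P.
        d (\<xi> n \<omega>) (\<zeta> \<omega>') < r \<longrightarrow> R n \<omega> < r \<longrightarrow> - U n \<omega> < - V \<omega>' + e"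
        by (intro exI[of _ r]) (auto elim!: eventually_mono simp: abs_less_iff)
    qed
  qed
  fix a
  { assume "a > (\<integral>\<omega>. V \<omega> \<partial>Q)"
    then show "\<forall>\<^sub>F n in sequentially. (\<integral>\<omega>. U n \<omega> \<partial>P) < a"
      using extended_mapping_upper[OF P Q \<xi> \<zeta> conv U U_bd V V_bd R R0 key1, of "a - (\<integral>\<omega>. V \<omega> \<partial>Q)"]
      by simp }
  { assume "a < (\<integral>\<omega>. V \<omega> \<partial>Q)"
    then show "\<forall>\<^sub>F n in sequentially. (\<integral>\<omega>. U n \<omega> \<partial>P) > a"
      using extended_mapping_upper[OF P Q \<xi> \<zeta> conv _ _ _ _ R R0 key2, of C "(\<integral>\<omega>. V \<omega> \<partial>Q) - a"]
        U U_bd V V_bd by simp }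
qed

end

section \<open>Random elements of the Skorokhod space\<close>

lemma skorokhod_space_restrict:
  assumes "cadlag_on a b x"
  shows "restrict x {a..b} \<in> skorokhod_space a b"
proof -
  have R: "(restrict x {a..b} \<longlongrightarrow> l) (at_right t)" if "(x \<longlongrightarrow> l) (at_right t)" "a \<le> t" "t < b" for t l
    using that(1) by (rule Lim_transform_eventually)
      (use that in \<open>auto simp: eventually_at_right[OF \<open>t < b\<close>] intro!: exI[of _ b]\<close>)
  have L: "(restrict x {a..b} \<longlongrightarrow> l) (at_left t)" if "(x \<longlongrightarrow> l) (at_left t)" "a < t" "t \<le> b" for t l
    using that(1) by (rule Lim_transform_eventually)
      (use that in \<open>auto simp: eventually_at_left[OF \<open>a < t\<close>] intro!: exI[of _ a]\<close>)
  show ?thesis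
    using assms R L unfolding skorokhod_space_def cadlag_on_def by simp blast
qed

lemma cadlag_on_continuous:
  assumes "continuous_on {a..b} x"
  shows "cadlag_on a b x"
proof -
  have lim: "(x \<longlongrightarrow> x t) (at t within {a..b})" if "t \<in> {a..b}" for t
    using assms that by (auto simp: continuous_on_def)
  have "(x \<longlongrightarrow> x t) (at_right t)" if "a \<le> t" "t < b" for t
    using tendsto_within_subset[OF lim, of t "{t..b}"] that by (simp add: at_within_Icc_at_right)
  moreover have "(x \<longlongrightarrow> x t) (at_left t)" if "a < t" "t \<le> b" for t
    using tendsto_within_subset[OF lim, of t "{a..t}"] that by (simp add: at_within_Icc_at_left)
  ultimately show ?thesis by (auto simp: cadlag_on_def)
qed

lemma cadlag_on_step:
  assumes "T \<ge> 0"
  shows "cadlag_on a b (\<lambda>s. c (nat \<lfloor>T * s\<rfloor>))"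
\<comment> \<open>Horizons start at 0, where the path is constant.\<close>
proof (cases "T = 0")
  case True
  then show ?thesis by (simp add: cadlag_on_def) blast
next
  case False
  then have T: "T > 0" using assms by simp
  have "((\<lambda>s. c (nat \<lfloor>T * s\<rfloor>)) \<longlongrightarrow> c (nat \<lfloor>T * t\<rfloor>)) (at_right t)" for t
  proof (rule tendsto_eventually)
    have "t < (real_of_int \<lfloor>T * t\<rfloor> + 1) / T" using T by (simp add: field_simps) linarith
    then show "\<forall>\<^sub>F s in at_right t. c (nat \<lfloor>T * s\<rfloor>) = c (nat \<lfloor>T * t\<rfloor>)"
    proof (rule eventually_at_rightI[rotated])
      fix s assume s: "s \<in> {t<..<(real_of_int \<lfloor>T * t\<rfloor> + 1) / T}"
      then have "T * s < real_of_int \<lfloor>T * t\<rfloor> + 1" "T * t < T * s"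
        using T by (auto simp: field_simps)
      then have "\<lfloor>T * s\<rfloor> = \<lfloor>T * t\<rfloor>" by linarith
      then show "c (nat \<lfloor>T * s\<rfloor>) = c (nat \<lfloor>T * t\<rfloor>)" by simp
    qed
  qed
  \<comment> \<open>Just left of t the floor of T * s is \<lceil>T * t\<rceil> - 1, whether or not T
    * t is an integer.\<close>
  moreover have "((\<lambda>s. c (nat \<lfloor>T * s\<rfloor>)) \<longlongrightarrow> c (nat (\<lceil>T * t\<rceil> - 1))) (at_left t)" for t
  proof (rule tendsto_eventually)
    have "(real_of_int \<lceil>T * t\<rceil> - 1) / T < t" using T by (simp add: field_simps) linarith
    then show "\<forall>\<^sub>F s in at_left t. c (nat \<lfloor>T * s\<rfloor>) = c (nat (\<lceil>T * t\<rceil> - 1))"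
    proof (rule eventually_at_leftI[rotated])
      fix s assume s: "s \<in> {(real_of_int \<lceil>T * t\<rceil> - 1) / T<..<t}"
      then have "real_of_int \<lceil>T * t\<rceil> - 1 < T * s" "T * s < T * t"
        using T by (auto simp: field_simps)
      then have "\<lfloor>T * s\<rfloor> = \<lceil>T * t\<rceil> - 1" by linarith
      then show "c (nat \<lfloor>T * s\<rfloor>) = c (nat (\<lceil>T * t\<rceil> - 1))" by simp
    qed
  qed
  ultimately show ?thesis by (auto simp: cadlag_on_def)
qed

lemma skorokhod_dist_le_uniform:
  assumes "x \<in> skorokhod_space a b" "y \<in> skorokhod_space a b" "0 \<le> e"
    and "\<And>t. t \<in> {a..b} \<Longrightarrow> \<bar>x t - y t\<bar> \<le> e"
  shows "skorokhod_dist a b x y \<le> e"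
  by (rule skorokhod_dist_le[OF assms(1,2)])
     (use assms(3,4) in \<open>auto simp: skorokhod_close_def intro!: bexI[OF _ id_in_time_changes]\<close>)

lemma skorokhod_dist_uniform_limit:
  assumes x: "\<And>n. x n \<in> skorokhod_space a b" and y: "y \<in> skorokhod_space a b"
    and lim: "uniform_limit {a..b} x y sequentially"
  shows "(\<lambda>n. skorokhod_dist a b (x n) y) \<longlonglongrightarrow> 0"
proof (rule LIMSEQ_I)
  fix e :: real assume e: "0 < e"
  then have "\<forall>\<^sub>F n in sequentially. \<forall>t\<in>{a..b}. dist (x n t) (y t) < e / 2"
    by (intro uniform_limitD[OF lim]) auto
  then obtain N where N: "\<And>n t. n \<ge> N \<Longrightarrow> t \<in> {a..b} \<Longrightarrow> dist (x n t) (y t) < e / 2"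
    unfolding eventually_sequentially by blast
  have "norm (skorokhod_dist a b (x n) y - 0) < e" if n: "n \<ge> N" for n
  proof -
    have "skorokhod_dist a b (x n) y \<le> e / 2"
      by (rule skorokhod_dist_le_uniform[OF x y])
         (use e N[OF n] in \<open>auto simp: dist_real_def intro: less_imp_le\<close>)
    then show ?thesis using skorokhod_dist_nonneg[of a b "x n" y] e by simp
  qed
  then show "\<exists>N. \<forall>n\<ge>N. norm (skorokhod_dist a b (x n) y - 0) < e" by blast
qed

text \<open>The converse holds at continuous limits, where a small time change hardly moves \<open>y\<close>.\<close>

lemma uniform_limit_skorokhod_dist:
  assumes x: "\<And>n. x n \<in> skorokhod_space a b" and y: "y \<in> skorokhod_space a b"
    and cont: "continuous_on {a..b} y"
    and lim: "(\<lambda>n. skorokhod_dist a b (x n) y) \<longlonglongrightarrow> 0"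
  shows "uniform_limit {a..b} x y sequentially"
proof (rule uniform_limitI)
  fix e :: real assume e: "0 < e"
  have "uniformly_continuous_on {a..b} y"
    using compact_uniformly_continuous[OF cont] by simp
  then obtain r where r: "r > 0" "\<And>s t. s \<in> {a..b} \<Longrightarrow> t \<in> {a..b} \<Longrightarrow> dist s t < r \<Longrightarrow> dist (y s) (y t) < e / 2"
    using e unfolding uniformly_continuous_on_def by (metis half_gt_zero)
  have "\<forall>\<^sub>F n in sequentially. skorokhod_dist a b (x n) y < min r (e / 2)"
    using lim e r(1) by (intro order_tendstoD) auto
  then show "\<forall>\<^sub>F n in sequentially. \<forall>t\<in>{a..b}. dist (x n t) (y t) < e"
  proof eventually_elim
    case (elim n)
    then obtain c where c: "c < min r (e / 2)" "skorokhod_close a b (x n) y c"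
      using skorokhod_dist_less[OF x y] by blast
    then obtain l where l: "l \<in> time_changes a b"
      "\<And>t. t \<in> {a..b} \<Longrightarrow> \<bar>l t - t\<bar> \<le> c \<and> \<bar>x n t - y (l t)\<bar> \<le> c"
      by (auto simp: skorokhod_close_def)
    show ?case
    proof
      fix t assume t: "t \<in> {a..b}"
      then have "l t \<in> {a..b}" using l(1) by (auto simp: time_changes_def)
      then have "dist (y (l t)) (y t) < e / 2"
        using l(2)[OF t] c(1) t by (intro r(2)) (auto simp: dist_real_def)
      then show "dist (x n t) (y t) < e"
        using l(2)[OF t] c(1) unfolding dist_real_def by linarith
    qed
  qed
qed

section \<open>Measurability of step paths\<close>

lemma skorokhod_borel_eq:
  "skorokhod_borel a b = Metric_space.mborel (skorokhod_space a b) (skorokhod_dist a b)"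
  by (simp add: skorokhod_borel_def)

text \<open>At a fixed horizon both the scaled partial sums and the Dickey-Fuller process have this
  form. Taking c as a whole sequence lets one type serve all horizons, although a path on [a, b]
  reads finitely many entries.\<close>

definition step_path :: "real \<Rightarrow> real \<Rightarrow> real \<Rightarrow> (nat \<Rightarrow> real) \<Rightarrow> real \<Rightarrow> real" where
  "step_path a b T c = (\<lambda>s\<in>{a..b}. c (nat \<lfloor>T * s\<rfloor>))"

lemma step_path_in_skorokhod_space:
  "T \<ge> 0 \<Longrightarrow> step_path a b T c \<in> skorokhod_space a b"
  unfolding step_path_def by (rule skorokhod_space_restrict[OF cadlag_on_step])

text \<open>Preimages of open sets are open in the product topology: the path reads only the entries
  up to m, and moving each of them by less than r / 2 moves the path by at most r / 2 uniformly,
  hence also in the Skorokhod distance.\<close>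

lemma step_path_measurable:
  assumes T: "T \<ge> 0"
  shows "step_path a b T \<in> borel \<rightarrow>\<^sub>M skorokhod_borel a b"
proof -
  interpret Metric_space "skorokhod_space a b" "skorokhod_dist a b"
    by (rule Metric_space_skorokhod)
  define m where "m = nat \<lfloor>T * b\<rfloor>"
  show ?thesis unfolding skorokhod_borel_eq
  proof (rule measurable_mborelI)
    show "step_path a b T c \<in> skorokhod_space a b" for c
      by (rule step_path_in_skorokhod_space[OF T])
    fix U assume U: "openin mtopology U"
    have "open (step_path a b T -` U)"
    proof (subst open_subopen, intro ballI)
      fix c assume c: "c \<in> step_path a b T -` U"
      then obtain r where r: "r > 0" "mball (step_path a b T c) r \<subseteq> U"
        using U by (auto simp: openin_mtopology)
      define W where "W = {c' :: nat \<Rightarrow> real. \<forall>j\<in>{..m}. c' j \<in> {c j - r / 2<..<c j + r / 2}}"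
      have "W = (\<Pi>\<^sub>E j\<in>UNIV. if j \<le> m then {c j - r / 2<..<c j + r / 2} else UNIV)"
        by (auto simp: W_def PiE_def Pi_def split: if_splits)
      moreover have "open \<dots>"
      proof (rule open_PiE)
        show "finite {i. (if i \<le> m then {c i - r / 2<..<c i + r / 2} else UNIV) \<noteq> UNIV}"
          by (rule finite_subset[of _ "{..m}"]) (auto split: if_splits)
      qed auto
      ultimately have "open W" by simp
      moreover have "c \<in> W" using r by (simp add: W_def)
      moreover have "W \<subseteq> step_path a b T -` U"
      proof
        fix c' assume c': "c' \<in> W"
        have "skorokhod_dist a b (step_path a b T c) (step_path a b T c') \<le> r / 2"
        proof (rule skorokhod_dist_le_uniform[OF step_path_in_skorokhod_space step_path_in_skorokhod_space])
          fix t assume t: "t \<in> {a..b}"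
          then have "nat \<lfloor>T * t\<rfloor> \<le> m"
            using T by (auto simp: m_def intro!: nat_mono floor_mono mult_left_mono)
          then have "c' (nat \<lfloor>T * t\<rfloor>) \<in> {c (nat \<lfloor>T * t\<rfloor>) - r / 2<..<c (nat \<lfloor>T * t\<rfloor>) + r / 2}"
            using c' unfolding W_def by blast
          then have "\<bar>c (nat \<lfloor>T * t\<rfloor>) - c' (nat \<lfloor>T * t\<rfloor>)\<bar> < r / 2"
            unfolding greaterThanLessThan_iff abs_less_iff by linarith
          then show "\<bar>step_path a b T c t - step_path a b T c' t\<bar> \<le> r / 2"
            using t by (simp add: step_path_def)
        qed (use r T in auto)
        then have "step_path a b T c' \<in> mball (step_path a b T c) r"
          using r by (simp add: step_path_in_skorokhod_space T)
        then show "c' \<in> step_path a b T -` U" using r by auto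
      qed
      ultimately show "\<exists>W. open W \<and> c \<in> W \<and> W \<subseteq> step_path a b T -` U" by blast
    qed
    then show "step_path a b T -` U \<inter> space borel \<in> sets borel" by simp
  qed
qed

text \<open>With countably many real coordinates the product \<sigma>-algebra is the Borel
  one.\<close>

lemma borel_measurable_sequence:
  fixes c :: "nat \<Rightarrow> 'a \<Rightarrow> real"
  assumes "\<And>j. c j \<in> borel_measurable P"
  shows "(\<lambda>\<omega> j. c j \<omega>) \<in> borel_measurable P"
proof -
  have eq: "sets (\<Pi>\<^sub>M j\<in>UNIV. borel) = sets (borel :: (nat \<Rightarrow> real) measure)"
    by (rule sets_PiM_equal_borel)
  have "(\<lambda>\<omega>. \<lambda>j\<in>UNIV. c j \<omega>) \<in> P \<rightarrow>\<^sub>M (\<Pi>\<^sub>M j\<in>UNIV. borel)"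
    by (rule measurable_restrict) (rule assms)
  then show ?thesis
    unfolding measurable_cong_sets[OF refl eq] restrict_UNIV .
qed

lemma step_path_process_measurable:
  assumes "T \<ge> 0" "\<And>j. c j \<in> borel_measurable P"
  shows "(\<lambda>\<omega>. step_path a b T (\<lambda>j. c j \<omega>)) \<in> P \<rightarrow>\<^sub>M skorokhod_borel a b"
  by (rule measurable_compose[OF borel_measurable_sequence step_path_measurable]) (use assms in auto)

text \<open>\<open>nat\<close> truncates at 0, hence the limit \<open>max 0 t\<close>. Allowing
  every real t spares a restriction of the time variable in the joint measurability below.\<close>

lemma grid_approximation:
  fixes t :: real
  shows "(\<lambda>n. real (nat \<lfloor>real n * t\<rfloor>) / real n) \<longlonglongrightarrow> max 0 t"
proof (cases "t \<ge> 0")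
  case True
  show ?thesis
  proof (rule tendsto_sandwich[of "\<lambda>n. t - 1 / real n" _ _ "\<lambda>n. t"])
    show "\<forall>\<^sub>F n in sequentially. t - 1 / real n \<le> real (nat \<lfloor>real n * t\<rfloor>) / real n"
      using eventually_gt_at_top[of 0]
    proof eventually_elim
      case (elim n)
      have "real n * t - 1 \<le> real_of_int \<lfloor>real n * t\<rfloor>" by linarith
      also have "\<dots> \<le> real (nat \<lfloor>real n * t\<rfloor>)" using True by simp
      finally have "(real n * t - 1) / real n \<le> real (nat \<lfloor>real n * t\<rfloor>) / real n"
        by (intro divide_right_mono) auto
      then show ?case using elim by (simp add: diff_divide_distrib)
    qed
    show "\<forall>\<^sub>F n in sequentially. real (nat \<lfloor>real n * t\<rfloor>) / real n \<le> t"
      using eventually_gt_at_top[of 0]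
    proof eventually_elim
      case (elim n)
      have "real (nat \<lfloor>real n * t\<rfloor>) \<le> real n * t" using True by (simp add: of_nat_floor)
      then show ?case using elim by (simp add: field_simps)
    qed
    show "(\<lambda>n. t - 1 / real n) \<longlonglongrightarrow> max 0 t"
      using tendsto_diff[OF tendsto_const[of t] lim_1_over_n] True by simp
    show "(\<lambda>n. t) \<longlonglongrightarrow> max 0 t" using True by simp
  qed
next
  case False
  then have "real n * t < 1" for n using mult_nonneg_nonpos[of "real n" t] by simp
  then have "nat \<lfloor>real n * t\<rfloor> = 0" for n by simp
  then show ?thesis using False by (simp add: max_def)
qed

text \<open>Uniform continuity, since the step path reads x less than 1 / n to the left of t. That
  point can fall below a, where nothing is known about x; hence the clamp to [a, b].\<close>

lemma step_path_uniform_limit: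
  fixes x :: "real \<Rightarrow> real"
  assumes a: "0 \<le> a" and x: "continuous_on {a..b} x"
  shows "uniform_limit {a..b} (\<lambda>n. step_path a b (real n) (\<lambda>j. x (min b (max a (real j / real n))))) x sequentially"
proof (rule uniform_limitI)
  fix e :: real assume e: "0 < e"
  have "uniformly_continuous_on {a..b} x"
    using compact_uniformly_continuous[OF x] by simp
  then obtain r where r: "r > 0" "\<And>s t. s \<in> {a..b} \<Longrightarrow> t \<in> {a..b} \<Longrightarrow> dist s t < r \<Longrightarrow> dist (x s) (x t) < e"
    using e unfolding uniformly_continuous_on_def by metis
  obtain N where N: "1 / r < real N" using reals_Archimedean2 by blast
  show "\<forall>\<^sub>F n in sequentially. \<forall>t\<in>{a..b}. dist (step_path a b (real n) (\<lambda>j. x (min b (max a (real j / real n)))) t) (x t) < e"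
    using eventually_ge_at_top[of "max 1 N"]
  proof eventually_elim
    case (elim n)
    show ?case
    proof
      fix t assume t: "t \<in> {a..b}"
      define q where "q = real (nat \<lfloor>real n * t\<rfloor>) / real n"
      have n: "real n > 0" "real N \<le> real n" using elim by auto
      have "real n * t \<ge> 0" using t a by auto
      then have "real n * t - 1 < real (nat \<lfloor>real n * t\<rfloor>)" "real (nat \<lfloor>real n * t\<rfloor>) \<le> real n * t"
        by linarith+
      then have "(real n * t - 1) / real n < q" "q \<le> (real n * t) / real n"
        unfolding q_def using n by (intro divide_strict_right_mono divide_right_mono; simp)+
      then have q: "t - 1 / real n < q" "q \<le> t" using n by (auto simp: diff_divide_distrib)
      have "1 / r < real n" using N n by linarith
      then have "1 / real n < r" using n r(1) by (simp add: field_simps)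
      then have "dist (min b (max a q)) t < r" using q t by (auto simp: dist_real_def)
      then have "dist (x (min b (max a q))) (x t) < e" using t by (intro r(2)) auto
      then show "dist (step_path a b (real n) (\<lambda>j. x (min b (max a (real j / real n)))) t) (x t) < e"
        using t by (simp add: step_path_def q_def)
    qed
  qed
qed

text \<open>Uniform limits of step paths, whose entries are values of the process at grid
  times.\<close>

lemma continuous_process_measurable:
  fixes X :: "real \<Rightarrow> 'a \<Rightarrow> real"
  assumes "0 \<le> a" "a \<le> b" and X: "\<And>t. t \<in> {a..b} \<Longrightarrow> X t \<in> borel_measurable P"
    and cont: "\<And>\<omega>. \<omega> \<in> space P \<Longrightarrow> continuous_on {a..b} (\<lambda>t. X t \<omega>)"
  shows "(\<lambda>\<omega>. \<lambda>t\<in>{a..b}. X t \<omega>) \<in> P \<rightarrow>\<^sub>M skorokhod_borel a b"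
proof -
  interpret Metric_space "skorokhod_space a b" "skorokhod_dist a b"
    by (rule Metric_space_skorokhod)
  show ?thesis unfolding skorokhod_borel_eq
  proof (rule measurable_mborel_limit)
    show "(\<lambda>\<omega>. step_path a b (real n) (\<lambda>j. X (min b (max a (real j / real n))) \<omega>)) \<in> P \<rightarrow>\<^sub>M mborel" for n
      unfolding skorokhod_borel_eq[symmetric]
      by (rule step_path_process_measurable) (use assms in auto)
    fix \<omega> assume w: "\<omega> \<in> space P"
    show S: "(\<lambda>t\<in>{a..b}. X t \<omega>) \<in> skorokhod_space a b"
      by (rule skorokhod_space_restrict[OF cadlag_on_continuous[OF cont[OF w]]])
    have "uniform_limit {a..b} (\<lambda>n. step_path a b (real n) (\<lambda>j. X (min b (max a (real j / real n))) \<omega>))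
       (\<lambda>t\<in>{a..b}. X t \<omega>) sequentially"
      using step_path_uniform_limit[OF \<open>0 \<le> a\<close> cont[OF w]]
      by (rule uniform_limit_cong'[THEN iffD1, rotated 2]) auto
    then show "(\<lambda>n. skorokhod_dist a b (step_path a b (real n) (\<lambda>j. X (min b (max a (real j / real n))) \<omega>))
         (\<lambda>t\<in>{a..b}. X t \<omega>)) \<longlonglongrightarrow> 0"
      by (intro skorokhod_dist_uniform_limit S step_path_in_skorokhod_space) auto
  qed
qed

text \<open>Serves to make time integrals of the process measurable in the outcome. The clamp
  extends the process to all real times without reading it outside [a, b].\<close>

lemma continuous_process_jointly_measurable:
  fixes X :: "real \<Rightarrow> 'a \<Rightarrow> real"
  assumes "0 \<le> a" "a \<le> b" and X: "\<And>t. t \<in> {a..b} \<Longrightarrow> X t \<in> borel_measurable P"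
    and cont: "\<And>\<omega>. \<omega> \<in> space P \<Longrightarrow> continuous_on {a..b} (\<lambda>t. X t \<omega>)"
  shows "(\<lambda>(\<omega>, t). X (min b (max a t)) \<omega>) \<in> borel_measurable (P \<Otimes>\<^sub>M borel)"
proof -
  define Z where "Z j n \<omega> = X (min b (max a (real j / real n))) \<omega>" for j n :: nat and \<omega>
  have [measurable]: "Z j n \<in> borel_measurable P" for j n
    unfolding Z_def using assms(2) by (intro X) auto
  have "(\<lambda>(\<omega>, t). Z (nat \<lfloor>real n * t\<rfloor>) n \<omega>) \<in> borel_measurable (P \<Otimes>\<^sub>M borel)" for n
  proof -
    \<comment> \<open>The index depends on the time but takes countably many values, so each fixed
      index may be treated separately.\<close>
    have "(\<lambda>p. Z (nat \<lfloor>real n * snd p\<rfloor>) n (fst p)) \<in> borel_measurable (P \<Otimes>\<^sub>M borel)"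
      by (rule measurable_compose_countable[where f = "\<lambda>j p. Z j n (fst p)"]) auto
    then show ?thesis by (simp add: case_prod_beta')
  qed
  then show ?thesis
  proof (rule borel_measurable_LIMSEQ_real[rotated])
    fix p assume "p \<in> space (P \<Otimes>\<^sub>M (borel :: real measure))"
    then obtain \<omega> t where p: "p = (\<omega>, t)" "\<omega> \<in> space P" by (auto simp: space_pair_measure)
    have "(\<lambda>n. min b (max a (real (nat \<lfloor>real n * t\<rfloor>) / real n))) \<longlonglongrightarrow> min b (max a (max 0 t))"
      by (intro tendsto_intros grid_approximation)
    moreover have "max a (max 0 t) = max a t" using assms(1) by auto
    ultimately have "(\<lambda>n. min b (max a (real (nat \<lfloor>real n * t\<rfloor>) / real n))) \<longlonglongrightarrow> min b (max a t)" by simp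
    then have "(\<lambda>n. X (min b (max a (real (nat \<lfloor>real n * t\<rfloor>) / real n))) \<omega>) \<longlonglongrightarrow> X (min b (max a t)) \<omega>"
      using assms(2) by (intro continuous_on_tendsto_compose[OF cont[OF p(2)]]) auto
    then show "(\<lambda>n. case p of (\<omega>, t) \<Rightarrow> Z (nat \<lfloor>real n * t\<rfloor>) n \<omega>)
        \<longlonglongrightarrow> (case p of (\<omega>, t) \<Rightarrow> X (min b (max a t)) \<omega>)"
      using p by (simp add: Z_def)
  qed
qed

section \<open>Versions and test integrals\<close>

lemma skorokhod_version_in_space:
  assumes "skorokhod_version a b P X \<xi>" "\<omega> \<in> space P"
  shows "\<xi> \<omega> \<in> skorokhod_space a b"
proof -
  interpret Metric_space "skorokhod_space a b" "skorokhod_dist a b"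
    by (rule Metric_space_skorokhod)
  show ?thesis
    using assms measurable_space[of \<xi> P mborel \<omega>]
    by (simp add: skorokhod_version_def skorokhod_borel_eq space_mborel)
qed

text \<open>Elements of the space are \<open>undefined\<close> off [a, b], so agreement on [a, b] is
  equality.\<close>

lemma skorokhod_version_AE_eq:
  assumes "skorokhod_version a b P X \<xi>" "skorokhod_version a b P X \<xi>'"
  shows "AE \<omega> in P. \<xi> \<omega> = \<xi>' \<omega>"
proof -
  have "AE \<omega> in P. \<forall>t\<in>{a..b}. \<xi> \<omega> t = X t \<omega>" "AE \<omega> in P. \<forall>t\<in>{a..b}. \<xi>' \<omega> t = X t \<omega>"
    using assms by (auto simp: skorokhod_version_def)
  then show ?thesis using AE_space
  proof eventually_elim
    case (elim \<omega>)
    then show ?case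
      using skorokhod_version_in_space[OF assms(1)] skorokhod_version_in_space[OF assms(2)]
      by (intro extensionalityI[of _ "{a..b}"]) (auto simp: skorokhod_space_def)
  qed
qed

lemma continuous_map_skorokhod_version_measurable:
  assumes "skorokhod_version a b P X \<xi>"
    and "continuous_map (skorokhod_topology a b) euclideanreal f"
  shows "(\<lambda>\<omega>. f (\<xi> \<omega>)) \<in> borel_measurable P"
proof -
  interpret Metric_space "skorokhod_space a b" "skorokhod_dist a b"
    by (rule Metric_space_skorokhod)
  show ?thesis
    by (rule measurable_compose[OF _ continuous_map_real_measurable[OF assms(2)]])
       (use assms(1) in \<open>simp add: skorokhod_version_def skorokhod_borel_eq\<close>)
qed

lemma skorokhod_version_integral_eq:
  assumes "skorokhod_version a b P X \<xi>" "skorokhod_version a b P X \<xi>'"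
    and "continuous_map (skorokhod_topology a b) euclideanreal f"
  shows "(\<integral>\<omega>. f (\<xi> \<omega>) \<partial>P) = (\<integral>\<omega>. f (\<xi>' \<omega>) \<partial>P)"
  by (intro integral_cong_AE continuous_map_skorokhod_version_measurable[OF assms(1,3)]
        continuous_map_skorokhod_version_measurable[OF assms(2,3)])
     (use skorokhod_version_AE_eq[OF assms(1,2)] in auto)

text \<open>Weak convergence is defined through the existence of some versions. This makes it
  available for versions chosen at will, such as explicit step paths.\<close>

lemma weak_conv_skorokhodD:
  assumes "weak_conv_skorokhod a b P X Q Z"
    and "\<And>n. skorokhod_version a b P (X n) (\<xi> n)" "skorokhod_version a b Q Z \<zeta>"
    and "continuous_map (skorokhod_topology a b) euclideanreal f" "bounded (f ` skorokhod_space a b)"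
  shows "(\<lambda>n. \<integral>\<omega>. f (\<xi> n \<omega>) \<partial>P) \<longlonglongrightarrow> (\<integral>\<omega>. f (\<zeta> \<omega>) \<partial>Q)"
proof -
  obtain \<xi>' \<zeta>' where *: "\<And>n. skorokhod_version a b P (X n) (\<xi>' n)" "skorokhod_version a b Q Z \<zeta>'"
    and "(\<lambda>n. \<integral>\<omega>. f (\<xi>' n \<omega>) \<partial>P) \<longlonglongrightarrow> (\<integral>\<omega>. f (\<zeta>' \<omega>) \<partial>Q)"
    using assms(1,4,5) unfolding weak_conv_skorokhod_def by blast
  then show ?thesis
    using skorokhod_version_integral_eq[OF assms(2) *(1) assms(4)]
      skorokhod_version_integral_eq[OF assms(3) *(2) assms(4)] by simp
qed

section \<open>Functionals of Brownian motion\<close>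

lemma (in Metric_space) continuous_map_real_dist:
  assumes "continuous_map mtopology euclideanreal f" "x \<in> M" "e > 0"
  shows "\<exists>r>0. \<forall>y\<in>M. d y x < r \<longrightarrow> \<bar>f y - f x\<bar> < e"
proof -
  have "\<forall>a\<in>M. \<forall>e>0. \<exists>r>0. \<forall>y. y \<in> M \<and> d a y < r \<longrightarrow> dist (f a) (f y) < e"
    using assms(1) metric_continuous_map[OF Met_TC.Metric_space_axioms, of f]
    by (simp add: mtopology_is_euclidean)
  then obtain r where r: "r > 0" "\<And>y. y \<in> M \<Longrightarrow> d x y < r \<Longrightarrow> dist (f x) (f y) < e"
    using assms(2,3) by meson
  have "\<bar>f y - f x\<bar> < e" if "y \<in> M" "d y x < r" for y
    using r(2)[of y] that by (simp add: commute[of x y] dist_real_def abs_minus_commute)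
  then show ?thesis using r(1) by blast
qed

lemma (in Metric_space) continuous_map_real_LIMSEQ:
  assumes f: "continuous_map mtopology euclideanreal f" and y: "\<And>n. y n \<in> M" and x: "x \<in> M"
    and lim: "(\<lambda>n. d (y n) x) \<longlonglongrightarrow> 0"
  shows "(\<lambda>n. f (y n)) \<longlonglongrightarrow> f x"
proof (rule tendstoI)
  fix e :: real assume "e > 0"
  then obtain r where r: "r > 0" "\<And>z. z \<in> M \<Longrightarrow> d z x < r \<Longrightarrow> \<bar>f z - f x\<bar> < e"
    using continuous_map_real_dist[OF f x] by blast
  have "\<forall>\<^sub>F n in sequentially. d (y n) x < r" by (rule order_tendstoD(2)[OF lim r(1)])
  then show "\<forall>\<^sub>F n in sequentially. dist (f (y n)) (f x) < e"
    by eventually_elim (use r(2) y in \<open>simp add: dist_real_def\<close>)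
qed

lemma continuous_process_version:
  fixes X :: "real \<Rightarrow> 'a \<Rightarrow> real"
  assumes ab: "0 \<le> a" "a \<le> b" and X: "\<And>t. t \<in> {a..b} \<Longrightarrow> X t \<in> borel_measurable P"
    and cont: "AE \<omega> in P. continuous_on {a..b} (\<lambda>t. X t \<omega>)"
  shows "\<exists>\<xi>. skorokhod_version a b P X \<xi>"
proof -
  \<comment> \<open>The set of bad outcomes need not be measurable. It is covered by a measurable
    null set, on which the path is replaced by 0.\<close>
  obtain E where E: "{\<omega>\<in>space P. \<not> continuous_on {a..b} (\<lambda>t. X t \<omega>)} \<subseteq> E" "E \<in> null_sets P"
    using cont by (auto simp: eventually_ae_filter)
  have [measurable]: "E \<in> sets P" using E(2) by auto
  have "(\<lambda>\<omega>. \<lambda>t\<in>{a..b}. if \<omega> \<in> E then 0 else X t \<omega>) \<in> P \<rightarrow>\<^sub>M skorokhod_borel a b"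
  proof (rule continuous_process_measurable[OF ab])
    show "(\<lambda>\<omega>. if \<omega> \<in> E then 0 else X t \<omega>) \<in> borel_measurable P" if "t \<in> {a..b}" for t
      using X[OF that] by measurable
    show "continuous_on {a..b} (\<lambda>t. if \<omega> \<in> E then 0 else X t \<omega>)" if "\<omega> \<in> space P" for \<omega>
      using E(1) that by (cases "\<omega> \<in> E") auto
  qed
  moreover have "AE \<omega> in P. \<forall>t\<in>{a..b}. (\<lambda>t\<in>{a..b}. if \<omega> \<in> E then 0 else X t \<omega>) t = X t \<omega>"
    using AE_not_in[OF E(2)] by eventually_elim simp
  ultimately show ?thesis unfolding skorokhod_version_def by blast
qed

lemma step_path_version:
  assumes "T \<ge> 0" "\<And>j. c j \<in> borel_measurable P" and "\<And>s \<omega>. s \<in> {a..b} \<Longrightarrow> \<omega> \<in> space P \<Longrightarrow> X s \<omega> = c (nat \<lfloor>T * s\<rfloor>) \<omega>"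
  shows "skorokhod_version a b P X (\<lambda>\<omega>. step_path a b T (\<lambda>j. c j \<omega>))"
  unfolding skorokhod_version_def
  by (intro conjI step_path_process_measurable AE_I2) (use assms in \<open>auto simp: step_path_def\<close>)

section \<open>Laws of Brownian path functionals\<close>

lemma brownian_increments_distr:
  assumes B: "standard_brownian_motion Q B" and n: "n > 0"
  shows "distr Q (\<Pi>\<^sub>M i\<in>{..<n}. borel)
      (\<lambda>\<omega>. \<lambda>i\<in>{..<n}. B (real (Suc i) / real n) \<omega> - B (real i / real n) \<omega>) =
    (\<Pi>\<^sub>M i\<in>{..<n}. density lborel (normal_density 0 (sqrt (1 / real n))))"
proof -
  interpret prob_space Q using B by (simp add: standard_brownian_motion_def)
  let ?X = "\<lambda>i \<omega>. B (real (Suc i) / real n) \<omega> - B (real i / real n) \<omega>"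
  have t: "strict_mono_on {..n} (\<lambda>i. real i / real n)" "(\<lambda>i. real i / real n) ` {..n} \<subseteq> {0..1}"
    using n by (auto simp: strict_mono_on_def divide_strict_right_mono)
  have indep: "indep_vars (\<lambda>_. borel) ?X {..<n}"
    using B t unfolding standard_brownian_motion_def by blast
  have rv: "?X i \<in> borel_measurable Q" if "i \<in> {..<n}" for i
    using indep that by (auto simp: indep_vars_def)
  have "distr Q borel (?X i) = density lborel (normal_density 0 (sqrt (1 / real n)))" if i: "i \<in> {..<n}" for i
  proof -
    have "0 \<le> real i / real n" "real i / real n < real (Suc i) / real n" "real (Suc i) / real n \<le> 1"
      using i n by (auto simp: field_simps)
    then have "distributed Q lborel (?X i) (normal_density 0 (sqrt (real (Suc i) / real n - real i / real n)))"
      using B unfolding standard_brownian_motion_def by blast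
    moreover have "real (Suc i) / real n - real i / real n = 1 / real n"
      by (simp add: diff_divide_distrib[symmetric])
    ultimately have "distr Q lborel (?X i) = density lborel (normal_density 0 (sqrt (1 / real n)))"
      by (metis distributed_distr_eq_density)
    moreover have "distr Q lborel (?X i) = distr Q borel (?X i)"
      by (rule distr_cong) auto
    ultimately show ?thesis by simp
  qed
  then have "(\<Pi>\<^sub>M i\<in>{..<n}. distr Q borel (?X i)) = (\<Pi>\<^sub>M i\<in>{..<n}. density lborel (normal_density 0 (sqrt (1 / real n))))"
    by (intro PiM_cong) auto
  moreover have "{..<n} \<noteq> {}" using n by auto
  ultimately show ?thesis
    using indep_vars_iff_distr_eq_PiM'[OF _ rv, of "{..<n}"] indep by simp
qed

text \<open>A continuous functional of the path is a limit of functionals of finitely many increments,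
  whose joint law does not depend on the realisation of the Brownian motion.\<close>

lemma brownian_functional_LIMSEQ:
  fixes c :: real
  assumes B: "standard_brownian_motion Q B" and \<zeta>: "skorokhod_version 0 1 Q (\<lambda>s \<omega>. c * B s \<omega>) \<zeta>"
    and f: "continuous_map (skorokhod_topology 0 1) euclideanreal f" and f_bd: "bounded (f ` skorokhod_space 0 1)"
  shows "(\<lambda>n. \<integral>v. f (step_path 0 1 (Suc n) (\<lambda>j. c * (\<Sum>i<j. if i < Suc n then v i else 0)))
        \<partial>(\<Pi>\<^sub>M i\<in>{..<Suc n}. density lborel (normal_density 0 (sqrt (1 / real (Suc n))))))
     \<longlonglongrightarrow> (\<integral>\<omega>. f (\<zeta> \<omega>) \<partial>Q)"
proof -
  interpret S: Metric_space "skorokhod_space 0 1" "skorokhod_dist 0 1"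
    by (rule Metric_space_skorokhod)
  interpret prob_space Q using B by (simp add: standard_brownian_motion_def)
  obtain C where C: "\<And>x. x \<in> skorokhod_space 0 1 \<Longrightarrow> \<bar>f x\<bar> \<le> C"
    using f_bd by (auto simp: bounded_iff)
  define inc where "inc n \<omega> = (\<lambda>i\<in>{..<n}. B (real (Suc i) / real n) \<omega> - B (real i / real n) \<omega>)" for n \<omega>
  \<comment> \<open>The path rebuilt from its n increments. Past index n the sum stays constant,
    which matches the clamp at time 1 in \<open>sum_inc\<close> and keeps v from being read outside
    its index set.\<close>
  define \<psi> where "\<psi> n v = step_path 0 1 (real n) (\<lambda>j. c * (\<Sum>i<j. if i < n then v i else 0))" for n v
  have Bm: "B t \<in> borel_measurable Q" if "t \<in> {0..1}" for t
    using B that by (simp add: standard_brownian_motion_def)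
  have inc_meas[measurable]: "inc n \<in> Q \<rightarrow>\<^sub>M (\<Pi>\<^sub>M i\<in>{..<n}. borel)" for n
    unfolding inc_def by (intro measurable_restrict borel_measurable_diff Bm) auto
  have [measurable]: "(\<lambda>v. f (\<psi> n v)) \<in> borel_measurable (\<Pi>\<^sub>M i\<in>{..<n}. borel)" for n
  proof (rule measurable_compose[OF _ S.continuous_map_real_measurable[OF f]])
    show "\<psi> n \<in> (\<Pi>\<^sub>M i\<in>{..<n}. borel) \<rightarrow>\<^sub>M S.mborel"
      unfolding \<psi>_def skorokhod_borel_eq[symmetric]
    proof (rule step_path_process_measurable)
      have "(\<lambda>v. if i < n then v i else 0) \<in> borel_measurable (\<Pi>\<^sub>M i\<in>{..<n}. borel)" for i
        by (cases "i < n") auto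
      then show "(\<lambda>v. c * (\<Sum>i<j. if i < n then v i else 0)) \<in> borel_measurable (\<Pi>\<^sub>M i\<in>{..<n}. borel)" for j
        by (intro borel_measurable_times borel_measurable_sum) auto
    qed simp
  qed
  have \<psi>_space: "\<psi> n v \<in> skorokhod_space 0 1" for n v
    unfolding \<psi>_def by (rule step_path_in_skorokhod_space) simp
  have sum_inc: "(\<Sum>i<j. if i < n then inc n \<omega> i else 0) = B (min 1 (real j / real n)) \<omega> - B 0 \<omega>"
    if n: "n > 0" for n j \<omega>
  proof (induction j)
    case 0
    then show ?case by (simp add: min_def)
  next
    case (Suc j)
    show ?case
    proof (cases "j < n")
      case True
      then have "min 1 (real j / real n) = real j / real n" "min 1 (real (Suc j) / real n) = real (Suc j) / real n"
        using n by (auto simp: min_def field_simps)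
      then show ?thesis using Suc True by (simp add: inc_def)
    next
      case False
      then have "min 1 (real j / real n) = 1" "min 1 (real (Suc j) / real n) = 1"
        using n by (auto simp: min_def field_simps)
      then show ?thesis using Suc False by simp
    qed
  qed
  have "AE \<omega> in Q. (\<lambda>n. f (\<psi> (Suc n) (inc (Suc n) \<omega>))) \<longlonglongrightarrow> f (\<zeta> \<omega>)"
  proof -
    have "AE \<omega> in Q. B 0 \<omega> = 0" "AE \<omega> in Q. continuous_on {0..1} (\<lambda>t. B t \<omega>)"
      "AE \<omega> in Q. \<forall>t\<in>{0..1}. \<zeta> \<omega> t = c * B t \<omega>"
      using B \<zeta> by (auto simp: standard_brownian_motion_def skorokhod_version_def)
    then show ?thesis using AE_space
    proof eventually_elim
      case (elim \<omega>)
      have "continuous_on {0..1} (\<lambda>t. c * B t \<omega>)" by (intro continuous_intros elim)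
      then have lim: "uniform_limit {0..1} (\<lambda>n. step_path 0 1 (real n)
          (\<lambda>j. c * B (min 1 (max 0 (real j / real n))) \<omega>)) (\<lambda>t. c * B t \<omega>) sequentially"
        by (intro step_path_uniform_limit) auto
      \<comment> \<open>The increments determine the path up to its starting value, which is 0 for
        these outcomes. \<open>Suc n\<close> avoids the degenerate grid with n = 0.\<close>
      have "uniform_limit {0..1} (\<lambda>n. \<psi> (Suc n) (inc (Suc n) \<omega>)) (\<zeta> \<omega>) sequentially"
      proof (rule uniform_limitI)
        fix e :: real assume "e > 0"
        then have "\<forall>\<^sub>F n in sequentially. \<forall>t\<in>{0..1}. dist (step_path 0 1 (real n)
          (\<lambda>j. c * B (min 1 (max 0 (real j / real n))) \<omega>) t) (c * B t \<omega>) < e"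
          by (rule uniform_limitD[OF lim])
        then have "\<forall>\<^sub>F n in sequentially. \<forall>t\<in>{0..1}. dist (step_path 0 1 (real (Suc n))
          (\<lambda>j. c * B (min 1 (max 0 (real j / real (Suc n)))) \<omega>) t) (c * B t \<omega>) < e"
          by (rule eventually_compose_filterlim[OF _ filterlim_Suc])
        then show "\<forall>\<^sub>F n in sequentially. \<forall>t\<in>{0..1}. dist (\<psi> (Suc n) (inc (Suc n) \<omega>) t) (\<zeta> \<omega> t) < e"
        proof eventually_elim
          case (elim n)
          then show ?case
            using \<open>\<forall>t\<in>{0..1}. \<zeta> \<omega> t = c * B t \<omega>\<close> \<open>B 0 \<omega> = 0\<close>
            by (simp only: \<psi>_def sum_inc[OF zero_less_Suc]) simp
        qed
      qed
      then have "(\<lambda>n. skorokhod_dist 0 1 (\<psi> (Suc n) (inc (Suc n) \<omega>)) (\<zeta> \<omega>)) \<longlonglongrightarrow> 0"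
        by (intro skorokhod_dist_uniform_limit skorokhod_version_in_space[OF \<zeta>] \<psi>_space elim)
      then show ?case
        by (intro S.continuous_map_real_LIMSEQ[OF f] skorokhod_version_in_space[OF \<zeta>] \<psi>_space elim)
    qed
  qed
  then have "(\<lambda>n. \<integral>\<omega>. f (\<psi> (Suc n) (inc (Suc n) \<omega>)) \<partial>Q) \<longlonglongrightarrow> (\<integral>\<omega>. f (\<zeta> \<omega>) \<partial>Q)"
    by (intro integral_dominated_convergence[where w = "\<lambda>_. C"]
          continuous_map_skorokhod_version_measurable[OF \<zeta> f])
       (auto intro!: C \<psi>_space)
  moreover have "(\<integral>\<omega>. f (\<psi> (Suc n) (inc (Suc n) \<omega>)) \<partial>Q) =
     (\<integral>v. f (\<psi> (Suc n) v) \<partial>(\<Pi>\<^sub>M i\<in>{..<Suc n}. density lborel (normal_density 0 (sqrt (1 / real (Suc n))))))" for n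
  proof -
    have "(\<integral>\<omega>. f (\<psi> (Suc n) (inc (Suc n) \<omega>)) \<partial>Q) =
        (\<integral>v. f (\<psi> (Suc n) v) \<partial>distr Q (\<Pi>\<^sub>M i\<in>{..<Suc n}. borel) (inc (Suc n)))"
      by (rule integral_distr[symmetric]) measurable
    also have "distr Q (\<Pi>\<^sub>M i\<in>{..<Suc n}. borel) (inc (Suc n)) =
        (\<Pi>\<^sub>M i\<in>{..<Suc n}. density lborel (normal_density 0 (sqrt (1 / real (Suc n)))))"
      unfolding inc_def by (rule brownian_increments_distr[OF B zero_less_Suc])
    finally show ?thesis .
  qed
  ultimately show ?thesis unfolding \<psi>_def by simp
qed

text \<open>Allows the Brownian motion supplied by (E1) to be exchanged for the one in the
  conclusion.\<close>

corollary brownian_functional_eq: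
  assumes "standard_brownian_motion Q B" "skorokhod_version 0 1 Q (\<lambda>s \<omega>. c * B s \<omega>) \<zeta>"
    and "standard_brownian_motion Q' B'" "skorokhod_version 0 1 Q' (\<lambda>s \<omega>. c * B' s \<omega>) \<zeta>'"
    and "continuous_map (skorokhod_topology 0 1) euclideanreal f" "bounded (f ` skorokhod_space 0 1)"
  shows "(\<integral>\<omega>. f (\<zeta> \<omega>) \<partial>Q) = (\<integral>\<omega>. f (\<zeta>' \<omega>) \<partial>Q')"
  using brownian_functional_LIMSEQ[OF assms(1,2,5,6)] brownian_functional_LIMSEQ[OF assms(3,4,5,6)]
  by (rule LIMSEQ_unique)

text \<open>The normal law has no atom at 0, so almost surely B is nonzero at all the times 1 / (n +
  1) simultaneously. One of these lies below s, whereas a continuous nonnegative integrand with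
  integral 0 over [0, s] would vanish there.\<close>

lemma brownian_integral_pos:
  assumes B: "standard_brownian_motion Q B"
  shows "AE \<omega> in Q. \<forall>s\<in>{0<..1}. 0 < (LINT r:{0..s}|lborel. (B r \<omega>)\<^sup>2)"
proof -
  interpret prob_space Q using B by (simp add: standard_brownian_motion_def)
  have "AE \<omega> in Q. B (1 / real (Suc n)) \<omega> - B 0 \<omega> \<noteq> 0" for n
  proof -
    have "0 < 1 / real (Suc n)" "1 / real (Suc n) \<le> 1" by auto
    then have "distributed Q lborel (\<lambda>\<omega>. B (1 / real (Suc n)) \<omega> - B 0 \<omega>) (normal_density 0 (sqrt (1 / real (Suc n) - 0)))"
      using B unfolding standard_brownian_motion_def by blast
    from distributed_AE2[OF this, of "\<lambda>x. x \<noteq> 0"] show ?thesis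
      using AE_lborel_singleton[of "0::real"] by (auto elim!: eventually_mono)
  qed
  then have "AE \<omega> in Q. \<forall>n. B (1 / real (Suc n)) \<omega> - B 0 \<omega> \<noteq> 0" by (simp add: AE_all_countable)
  moreover have "AE \<omega> in Q. B 0 \<omega> = 0" "AE \<omega> in Q. continuous_on {0..1} (\<lambda>t. B t \<omega>)"
    using B by (auto simp: standard_brownian_motion_def)
  ultimately show ?thesis
  proof eventually_elim
    case (elim \<omega>)
    show ?case
    proof
      fix s :: real assume s: "s \<in> {0<..1}"
      obtain n where n: "1 / real (Suc n) < s" using s nat_approx_posE[of s] by auto
      have cont: "continuous_on {0..s} (\<lambda>r. (B r \<omega>)\<^sup>2)"
        using s by (intro continuous_intros continuous_on_subset[OF elim(3)]) auto
      have eq: "(LINT r:{0..s}|lborel. (B r \<omega>)\<^sup>2) = integral {0..s} (\<lambda>r. (B r \<omega>)\<^sup>2)"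
        by (rule set_borel_integral_eq_integral) (rule borel_integrable_atLeastAtMost', rule cont)
      have "integral {0..s} (\<lambda>r. (B r \<omega>)\<^sup>2) \<noteq> 0"
      proof
        assume "integral {0..s} (\<lambda>r. (B r \<omega>)\<^sup>2) = 0"
        then have "\<forall>r\<in>{0..s}. (B r \<omega>)\<^sup>2 = 0"
          using s by (subst (asm) integral_eq_0_iff[OF cont]) auto
        then show False using elim(1)[rule_format, of n] elim(2) n by auto
      qed
      moreover have "0 \<le> integral {0..s} (\<lambda>r. (B r \<omega>)\<^sup>2)"
        by (rule integral_nonneg[OF integrable_continuous_interval[OF cont]]) simp
      ultimately show "0 < (LINT r:{0..s}|lborel. (B r \<omega>)\<^sup>2)" using eq by simp
    qed
  qed
qed

section \<open>The pathwise limit\<close>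

text \<open>Dominated convergence on [0, 1], with the moving endpoint absorbed into the indicator.
  The indicators converge except possibly at r = s0, a null set.\<close>

lemma set_integral_moving_endpoint_LIMSEQ:
  fixes F :: "nat \<Rightarrow> real \<Rightarrow> real"
  assumes s: "s \<longlonglongrightarrow> s0" and s01: "\<And>j. s j \<in> {0..1}" and s0: "s0 \<in> {0..1}"
    and meas: "\<And>j. (\<lambda>r. indicator {0..1} r * F j r) \<in> borel_measurable borel"
    and bd: "\<forall>\<^sub>F j in sequentially. \<forall>r\<in>{0..1}. \<bar>F j r\<bar> \<le> C"
    and lim: "\<And>r. r \<in> {0..1} \<Longrightarrow> (\<lambda>j. F j r) \<longlonglongrightarrow> F0 r"
  shows "(\<lambda>j. LINT r:{0..s j}|lborel. F j r) \<longlonglongrightarrow> (LINT r:{0..s0}|lborel. F0 r)"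
proof -
  \<comment> \<open>The bound holds only from some index on; the sequence is shifted by k and the
    shift is undone at the end.\<close>
  obtain k where k: "\<And>j r. j \<ge> k \<Longrightarrow> r \<in> {0..1} \<Longrightarrow> \<bar>F j r\<bar> \<le> C"
    using bd unfolding eventually_sequentially by blast
  have C: "0 \<le> C" using k[of k 0] by simp
  have eq: "indicator {0..u} r *\<^sub>R g r = indicator {0..u} r * (indicator {0..1} r * g r)"
    if "u \<in> {0..1}" for u r and g :: "real \<Rightarrow> real"
    using that by (auto split: split_indicator)
  note meas[measurable]
  have [measurable]: "(\<lambda>r. indicator {0..1} r * F0 r) \<in> borel_measurable borel"
    by (rule borel_measurable_LIMSEQ_real[OF _ meas]) (auto split: split_indicator intro: lim)
  have "(\<lambda>j. LINT r:{0..s (j + k)}|lborel. F (j + k) r) \<longlonglongrightarrow> (LINT r:{0..s0}|lborel. F0 r)"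
    unfolding set_lebesgue_integral_def
  proof (rule integral_dominated_convergence[where w = "\<lambda>r. indicator {0..1} r * C"])
    show "(\<lambda>r. indicator {0..s0} r *\<^sub>R F0 r) \<in> borel_measurable lborel"
      unfolding eq[OF s0] by measurable
    show "(\<lambda>r. indicator {0..s (j + k)} r *\<^sub>R F (j + k) r) \<in> borel_measurable lborel" for j
      unfolding eq[OF s01] by measurable
    show "integrable lborel (\<lambda>r::real. indicator {0..1} r * C)"
      by (intro integrable_mult_left integrable_real_indicator) auto
    show "AE r in lborel. norm (indicator {0..s (j + k)} r *\<^sub>R F (j + k) r) \<le> indicator {0..1} r * C" for j
      using k s01[of "j + k"] C by (intro AE_I2) (auto split: split_indicator)
    show "AE r in lborel. (\<lambda>j. indicator {0..s (j + k)} r *\<^sub>R F (j + k) r) \<longlonglongrightarrow> indicator {0..s0} r *\<^sub>R F0 r"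
      using AE_lborel_singleton[of s0]
    proof eventually_elim
      case (elim r)
      have sk: "(\<lambda>j. s (j + k)) \<longlonglongrightarrow> s0" by (rule LIMSEQ_ignore_initial_segment[OF s])
      consider "r < 0" | "0 \<le> r" "r < s0" | "s0 < r" using elim by linarith
      then show ?case
      proof cases
        case 2
        have "\<forall>\<^sub>F j in sequentially. r < s (j + k)" by (rule order_tendstoD(1)[OF sk 2(2)])
        then have "\<forall>\<^sub>F j in sequentially. F (j + k) r = indicator {0..s (j + k)} r *\<^sub>R F (j + k) r"
          by eventually_elim (use 2 in auto)
        moreover have "(\<lambda>j. F (j + k) r) \<longlonglongrightarrow> F0 r"
          using 2 s0 by (intro LIMSEQ_ignore_initial_segment lim) auto
        ultimately show ?thesis using 2 by (auto intro: Lim_transform_eventually)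
      next
        case 3
        have "\<forall>\<^sub>F j in sequentially. s (j + k) < r" by (rule order_tendstoD(2)[OF sk 3])
        then have "\<forall>\<^sub>F j in sequentially. 0 = indicator {0..s (j + k)} r *\<^sub>R F (j + k) r"
          by eventually_elim auto
        then show ?thesis using 3 by (auto intro: Lim_transform_eventually[OF tendsto_const])
      qed simp
    qed
  qed
  then show ?thesis by (rule LIMSEQ_offset)
qed

section \<open>Kernel sums as integrals of step functions\<close>

lemma sum_by_parts:
  fixes a k :: "nat \<Rightarrow> real"
  shows "(\<Sum>t=1..m. (a t - a (t - 1)) * k t) = a m * k m - a 0 * k 0 - (\<Sum>t<m. a t * (k (Suc t) - k t))"
  by (induction m) (simp_all add: algebra_simps)

text \<open>Induction over the grid cells: on [m / T, (m + 1) / T] the step function is constant up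
  to the right endpoint, and the fundamental theorem of calculus applies to \<phi>.\<close>

lemma set_integral_step_derivative:
  fixes \<phi> \<phi>' :: "real \<Rightarrow> real" and c :: "nat \<Rightarrow> real"
  assumes T: "T > 0" and \<phi>: "\<And>r. (\<phi> has_real_derivative \<phi>' r) (at r)" and cont: "continuous_on UNIV \<phi>'"
  shows "(LINT r:{0..real m / T}|lborel. c (nat \<lfloor>T * r\<rfloor>) * \<phi>' r) =
    (\<Sum>t<m. c t * (\<phi> (real (Suc t) / T) - \<phi> (real t / T)))"
proof (induction m)
  case 0
  have "(LINT r:{0..0}|lborel. c (nat \<lfloor>T * r\<rfloor>) * \<phi>' r) = 0"
    unfolding set_lebesgue_integral_def
  proof (rule integral_eq_zero_AE)
    show "AE r in lborel. indicator {0..0} r *\<^sub>R (c (nat \<lfloor>T * r\<rfloor>) * \<phi>' r) = 0"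
      using AE_lborel_singleton[of "0::real"] by eventually_elim auto
  qed
  then show ?case by simp
next
  case (Suc m)
  have [measurable]: "\<phi>' \<in> borel_measurable borel" by (rule borel_measurable_continuous_onI[OF cont])
  let ?f = "\<lambda>r. c (nat \<lfloor>T * r\<rfloor>) * \<phi>' r"
  let ?I = "{real m / T..real (Suc m) / T}"
  have le: "real m / T \<le> real (Suc m) / T" using T by (simp add: divide_right_mono)
  have int_c: "integrable lborel (\<lambda>r. indicator ?I r *\<^sub>R (c m * \<phi>' r))"
  proof -
    have "continuous_on ?I (\<lambda>r. c m * \<phi>' r)"
      by (rule continuous_on_mult[OF continuous_on_const continuous_on_subset[OF cont subset_UNIV]])
    from borel_integrable_atLeastAtMost'[OF this] show ?thesis
      unfolding set_integrable_def .
  qed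
  have ae: "AE r in lborel. indicator ?I r *\<^sub>R (c m * \<phi>' r) = indicator ?I r *\<^sub>R ?f r"
    using AE_lborel_singleton[of "real (Suc m) / T"]
  proof eventually_elim
    case (elim r)
    have "nat \<lfloor>T * r\<rfloor> = m" if "r \<in> ?I"
    proof -
      have "real m \<le> T * r" "T * r < real m + 1" using that elim T by (auto simp: field_simps)
      then have "\<lfloor>T * r\<rfloor> = int m" by (intro floor_unique) auto
      then show ?thesis by simp
    qed
    then show ?case by (auto split: split_indicator)
  qed
  have int1: "set_integrable lborel ?I ?f"
    unfolding set_integrable_def using int_c ae by (subst integrable_cong_AE[symmetric]) auto
  have eq1: "(LINT r:?I|lborel. ?f r) = c m * (\<phi> (real (Suc m) / T) - \<phi> (real m / T))"
  proof -
    have "(LINT r:?I|lborel. ?f r) = (LINT r:?I|lborel. c m * \<phi>' r)"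
      unfolding set_lebesgue_integral_def using ae by (intro integral_cong_AE) auto
    also have "\<dots> = c m * (LINT r:?I|lborel. \<phi>' r)" by simp
    also have "(LINT r:?I|lborel. \<phi>' r) = \<phi> (real (Suc m) / T) - \<phi> (real m / T)"
      unfolding set_lebesgue_integral_def
      by (rule integral_FTC_atLeastAtMost[OF le
            has_vector_derivative_at_within[OF \<phi>[unfolded has_real_derivative_iff_has_vector_derivative]]
            continuous_on_subset[OF cont subset_UNIV]])
    finally show ?thesis .
  qed
  have int0: "set_integrable lborel {0..real m / T} ?f"
  proof -
    have "bounded (\<phi>' ` {0..real m / T})"
      by (intro compact_imp_bounded compact_continuous_image continuous_on_subset[OF cont]) auto
    then obtain C where C: "\<And>r. r \<in> {0..real m / T} \<Longrightarrow> \<bar>\<phi>' r\<bar> \<le> C"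
      unfolding bounded_iff real_norm_def by blast
    \<comment> \<open>At the right endpoint m / T the index is already m, which is why the sum of
      absolute values runs through m.\<close>
    have "norm (indicator {0..real m / T} r *\<^sub>R ?f r) \<le> indicator {0..real m / T} r * ((\<Sum>i\<le>m. \<bar>c i\<bar>) * C)" for r
    proof (cases "r \<in> {0..real m / T}")
      case True
      then have "nat \<lfloor>T * r\<rfloor> \<le> m" using T by (simp add: field_simps) linarith
      then have "\<bar>c (nat \<lfloor>T * r\<rfloor>)\<bar> \<le> (\<Sum>i\<le>m. \<bar>c i\<bar>)" by (intro member_le_sum) auto
      then have "\<bar>c (nat \<lfloor>T * r\<rfloor>)\<bar> * \<bar>\<phi>' r\<bar> \<le> (\<Sum>i\<le>m. \<bar>c i\<bar>) * C"
        using C[OF True] by (intro mult_mono sum_nonneg) simp_all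
      then show ?thesis using True by (simp add: abs_mult)
    qed simp
    note bound = this
    show ?thesis unfolding set_integrable_def
    proof (rule Bochner_Integration.integrable_bound)
      show "integrable lborel (\<lambda>r. indicator {0..real m / T} r * ((\<Sum>i\<le>m. \<bar>c i\<bar>) * C))"
        by (intro integrable_mult_left integrable_real_indicator) (simp_all add: emeasure_lborel_Icc_eq)
      show "(\<lambda>r. indicator {0..real m / T} r *\<^sub>R ?f r) \<in> borel_measurable lborel" by measurable
      show "AE r in lborel. norm (indicator {0..real m / T} r *\<^sub>R ?f r) \<le>
          norm (indicator {0..real m / T} r * ((\<Sum>i\<le>m. \<bar>c i\<bar>) * C))"
        by (intro AE_I2 order_trans[OF bound]) simp
    qed
  qed
  have "(LINT r:{0..real (Suc m) / T}|lborel. ?f r) = (LINT r:{0..real m / T}|lborel. ?f r) + (LINT r:?I|lborel. ?f r)"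
  proof -
    have "(LINT r:{0..real (Suc m) / T}|lborel. ?f r) = (\<integral>r. indicator {0..real m / T} r *\<^sub>R ?f r + indicator ?I r *\<^sub>R ?f r \<partial>lborel)"
      unfolding set_lebesgue_integral_def
    proof (intro integral_cong_AE)
      \<comment> \<open>The two closed intervals overlap in the single point m / T.\<close>
      show "AE r in lborel. indicator {0..real (Suc m) / T} r *\<^sub>R ?f r
          = indicator {0..real m / T} r *\<^sub>R ?f r + indicator ?I r *\<^sub>R ?f r"
        using AE_lborel_singleton[of "real m / T"]
      proof eventually_elim
        case (elim r)
        have "0 \<le> real m / T" using T by simp
        then show ?case using elim le by (auto split: split_indicator)
      qed
    qed auto
    also have "\<dots> = (LINT r:{0..real m / T}|lborel. ?f r) + (LINT r:?I|lborel. ?f r)"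
      using int0 int1 unfolding set_lebesgue_integral_def set_integrable_def
      by (rule Bochner_Integration.integral_add)
    finally show ?thesis .
  qed
  then show ?case using Suc eq1 by simp
qed

corollary set_integral_step:
  fixes c :: "nat \<Rightarrow> real"
  assumes T: "T > 0"
  shows "(LINT r:{0..real m / T}|lborel. c (nat \<lfloor>T * r\<rfloor>)) = (\<Sum>t<m. c t) / T"
proof -
  have diff: "real (Suc t) / T - real t / T = 1 / T" for t
    unfolding diff_divide_distrib[symmetric] by simp
  have "(LINT r:{0..real m / T}|lborel. c (nat \<lfloor>T * r\<rfloor>) * 1) = (\<Sum>t<m. c t * (real (Suc t) / T - real t / T))"
    by (rule set_integral_step_derivative[OF T DERIV_ident continuous_on_const])
  also have "\<dots> = (\<Sum>t<m. c t) / T"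
    unfolding diff sum_divide_distrib by simp
  finally show ?thesis by simp
qed

text \<open>The identity is exact, without Riemann sum error: differences of K along the grid are
  integrals of its derivative over the cells. Centring by \<sigma>2 isolates the fluctuation of the
  squared increments in the last sum. The \<open>Suc\<close> in the third term matches cells
  numbered from 0 with summands numbered from 1.\<close>

lemma weighted_sum_eq_integral:
  fixes y :: "nat \<Rightarrow> real" and K :: "real \<Rightarrow> real"
  assumes T: "T > 0" and hh: "hh > 0" and y0: "y 0 = 0"
    and K': "\<And>z. (K has_real_derivative deriv K z) (at z)" and cont: "continuous_on UNIV (deriv K)"
  shows "(\<Sum>t=1..m. y (t - 1) * (y t - y (t - 1)) * K ((real m - real t) / hh)) / T =
    (K 0 * (y m / sqrt T)\<^sup>2
     + T / hh * (LINT r:{0..real m / T}|lborel. (y (nat \<lfloor>T * r\<rfloor>) / sqrt T)\<^sup>2 * deriv K (T / hh * (real m / T - r)))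
     - \<sigma>2 * (LINT r:{0..real m / T}|lborel. K ((real m - real (Suc (nat \<lfloor>T * r\<rfloor>))) / hh))
     - (\<Sum>t=1..m. ((y t - y (t - 1))\<^sup>2 - \<sigma>2) * K ((real m - real t) / hh)) / T) / 2"
proof -
  define k where "k t = K ((real m - real t) / hh)" for t
  have sq: "(c / sqrt T)\<^sup>2 = c\<^sup>2 / T" for c using T by (simp add: power_divide)
  \<comment> \<open>The argument of K decreases in r, hence the minus sign.\<close>
  have D: "((\<lambda>r. - K ((real m - T * r) / hh)) has_real_derivative deriv K ((real m - T * r) / hh) * (T / hh)) (at r)" for r
  proof -
    have "((\<lambda>r. (real m - T * r) / hh) has_real_derivative - (T / hh)) (at r)"
      using hh by (auto intro!: derivative_eq_intros)
    from DERIV_minus[OF DERIV_chain2[OF K' this]] show ?thesis by simp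
  qed
  have "(LINT r:{0..real m / T}|lborel. (y (nat \<lfloor>T * r\<rfloor>))\<^sup>2 * (deriv K ((real m - T * r) / hh) * (T / hh)))
      = (\<Sum>t<m. (y t)\<^sup>2 * (- K ((real m - T * (real (Suc t) / T)) / hh) - - K ((real m - T * (real t / T)) / hh)))"
  proof (rule set_integral_step_derivative[OF T D])
    have "continuous_on UNIV (\<lambda>r. (real m - T * r) / hh)" using hh by (intro continuous_intros) auto
    then show "continuous_on UNIV (\<lambda>r. deriv K ((real m - T * r) / hh) * (T / hh))"
      by (intro continuous_on_mult_right continuous_on_compose2[OF cont]) auto
  qed
  then have I1: "(LINT r:{0..real m / T}|lborel. (y (nat \<lfloor>T * r\<rfloor>))\<^sup>2 * (deriv K ((real m - T * r) / hh) * (T / hh)))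
      = (\<Sum>t<m. (y t)\<^sup>2 * (k t - k (Suc t)))"
    using T by (simp add: k_def)
  have "T / hh * (LINT r:{0..real m / T}|lborel. (y (nat \<lfloor>T * r\<rfloor>) / sqrt T)\<^sup>2 * deriv K (T / hh * (real m / T - r)))
     = (LINT r:{0..real m / T}|lborel. (y (nat \<lfloor>T * r\<rfloor>))\<^sup>2 * (deriv K ((real m - T * r) / hh) * (T / hh))) / T"
  proof -
    have eq: "T / hh * (real m / T - r) = (real m - T * r) / hh" for r using T hh by (simp add: field_simps)
    have pt: "T / hh * ((y (nat \<lfloor>T * r\<rfloor>) / sqrt T)\<^sup>2 * deriv K (T / hh * (real m / T - r))) =
        1 / T * ((y (nat \<lfloor>T * r\<rfloor>))\<^sup>2 * (deriv K ((real m - T * r) / hh) * (T / hh)))" for r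
      unfolding eq sq by simp
    have "T / hh * (LINT r:{0..real m / T}|lborel. (y (nat \<lfloor>T * r\<rfloor>) / sqrt T)\<^sup>2 * deriv K (T / hh * (real m / T - r)))
      = (LINT r:{0..real m / T}|lborel. T / hh * ((y (nat \<lfloor>T * r\<rfloor>) / sqrt T)\<^sup>2 * deriv K (T / hh * (real m / T - r))))"
      by (rule set_integral_mult_right[symmetric])
    also have "\<dots> = (LINT r:{0..real m / T}|lborel. 1 / T * ((y (nat \<lfloor>T * r\<rfloor>))\<^sup>2 * (deriv K ((real m - T * r) / hh) * (T / hh))))"
      unfolding pt ..
    also have "\<dots> = 1 / T * (LINT r:{0..real m / T}|lborel. (y (nat \<lfloor>T * r\<rfloor>))\<^sup>2 * (deriv K ((real m - T * r) / hh) * (T / hh)))"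
      by (rule set_integral_mult_right)
    finally show ?thesis by (simp only: times_divide_eq_left mult_1)
  qed
  with I1 have A: "T / hh * (LINT r:{0..real m / T}|lborel. (y (nat \<lfloor>T * r\<rfloor>) / sqrt T)\<^sup>2 * deriv K (T / hh * (real m / T - r)))
     = (\<Sum>t<m. (y t)\<^sup>2 * (k t - k (Suc t))) / T" by simp
  have "(\<Sum>t<m. k (Suc t)) = (\<Sum>t=1..m. k t)"
    by (rule sum.reindex_bij_witness[of _ "\<lambda>t. t - 1" Suc]) auto
  then have B: "(LINT r:{0..real m / T}|lborel. K ((real m - real (Suc (nat \<lfloor>T * r\<rfloor>))) / hh)) = (\<Sum>t=1..m. k t) / T"
    using set_integral_step[OF T, of m "\<lambda>t. k (Suc t)"] by (simp add: k_def)
  have half: "x = (a - b - c) / 2" if "2 * x = a - (b + c)" for x a b c :: real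
    using that by simp
  have km: "k m = K 0" by (simp add: k_def)
  have neg: "(\<Sum>t<m. (y t)\<^sup>2 * (k t - k (Suc t))) = - (\<Sum>t<m. (y t)\<^sup>2 * (k (Suc t) - k t))"
    unfolding sum_negf[symmetric] by (intro sum.cong refl) (simp add: algebra_simps)
  have "2 * (\<Sum>t=1..m. y (t - 1) * (y t - y (t - 1)) * k t)
     = (\<Sum>t=1..m. ((y t)\<^sup>2 - (y (t - 1))\<^sup>2) * k t) - (\<Sum>t=1..m. (y t - y (t - 1))\<^sup>2 * k t)"
    unfolding sum_distrib_left sum_subtractf[symmetric]
    by (intro sum.cong refl) (simp add: power2_eq_square algebra_simps)
  also have "(\<Sum>t=1..m. ((y t)\<^sup>2 - (y (t - 1))\<^sup>2) * k t) = (y m)\<^sup>2 * K 0 + (\<Sum>t<m. (y t)\<^sup>2 * (k t - k (Suc t)))"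
    unfolding neg sum_by_parts[of "\<lambda>t. (y t)\<^sup>2" k m] km y0 by simp
  also have "(\<Sum>t=1..m. (y t - y (t - 1))\<^sup>2 * k t) = (\<Sum>t=1..m. ((y t - y (t - 1))\<^sup>2 - \<sigma>2) * k t) + \<sigma>2 * (\<Sum>t=1..m. k t)"
    unfolding sum_distrib_left sum.distrib[symmetric]
    by (intro sum.cong refl) (simp add: algebra_simps)
  finally have fin: "(\<Sum>t=1..m. y (t - 1) * (y t - y (t - 1)) * k t) =
     ((y m)\<^sup>2 * K 0 + (\<Sum>t<m. (y t)\<^sup>2 * (k t - k (Suc t)))
       - (\<Sum>t=1..m. ((y t - y (t - 1))\<^sup>2 - \<sigma>2) * k t) - \<sigma>2 * (\<Sum>t=1..m. k t)) / 2"
    by (rule half)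
  have alg: "(p * c + a - b - v * w) / 2 / T = (c * (p / T) + a / T - v * (w / T) - b / T) / 2" for p c a b v w :: real
    using T by (simp add: field_simps)
  show ?thesis
    unfolding A B
    unfolding sq[of "y m"] k_def[symmetric] fin
    by (rule alg)
qed

text \<open>Abel summation moves the differences onto the weights: the boundary term contributes
  \<open>\<bar>K 0\<bar>\<close>, and each of the m weight differences is at most C1 / hh by the
  mean value inequality.\<close>

lemma weighted_sum_bound:
  fixes a :: "nat \<Rightarrow> real" and K :: "real \<Rightarrow> real"
  assumes hh: "hh > 0" and K': "\<And>z. (K has_real_derivative deriv K z) (at z)"
    and C1: "\<And>z. \<bar>deriv K z\<bar> \<le> C1"
    and b: "\<And>t. t \<le> m \<Longrightarrow> \<bar>\<Sum>i=1..t. a i\<bar> \<le> b"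
  shows "\<bar>\<Sum>t=1..m. a t * K ((real m - real t) / hh)\<bar> \<le> b * (\<bar>K 0\<bar> + C1 * (real m / hh))"
proof -
  define k where "k t = K ((real m - real t) / hh)" for t
  define Q where "Q t = (\<Sum>i=1..t. a i)" for t
  have C1_0: "0 \<le> C1" using C1[of 0] by simp
  have b0: "0 \<le> b" using b[of 0] by simp
  have lip: "\<bar>K u - K v\<bar> \<le> C1 * \<bar>u - v\<bar>" for u v
    using field_differentiable_bound[of UNIV K "deriv K" C1 u v] K' C1
    by (simp add: real_norm_def)
  have "(real m - real (Suc t)) / hh - (real m - real t) / hh = - (1 / hh)" for t
    by (simp add: diff_divide_distrib add_divide_distrib)
  then have kd: "\<bar>k (Suc t) - k t\<bar> \<le> C1 * (1 / hh)" for t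
    using lip[of "(real m - real (Suc t)) / hh" "(real m - real t) / hh"] hh by (simp add: k_def)
  have "(\<Sum>t=1..m. a t * k t) = (\<Sum>t=1..m. (Q t - Q (t - 1)) * k t)"
  proof (intro sum.cong refl)
    fix t assume "t \<in> {1..m}"
    then obtain u where "t = Suc u" by (cases t) auto
    then show "a t * k t = (Q t - Q (t - 1)) * k t" by (simp add: Q_def)
  qed
  also have "\<dots> = Q m * K 0 - (\<Sum>t<m. Q t * (k (Suc t) - k t))"
    using sum_by_parts[of Q k m] by (simp add: k_def Q_def)
  finally have "\<bar>\<Sum>t=1..m. a t * k t\<bar> \<le> \<bar>Q m * K 0\<bar> + \<bar>\<Sum>t<m. Q t * (k (Suc t) - k t)\<bar>" by simp
  also have "\<dots> \<le> b * \<bar>K 0\<bar> + (\<Sum>t<m. b * (C1 * (1 / hh)))"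
  proof (intro add_mono order_trans[OF sum_abs] sum_mono)
    show "\<bar>Q m * K 0\<bar> \<le> b * \<bar>K 0\<bar>" using b[of m] by (auto simp: abs_mult Q_def intro!: mult_right_mono)
    fix t assume "t \<in> {..<m}"
    then show "\<bar>Q t * (k (Suc t) - k t)\<bar> \<le> b * (C1 * (1 / hh))"
      using b[of t] kd[of t] b0 unfolding abs_mult by (intro mult_mono) (auto simp: Q_def)
  qed
  also have "\<dots> = b * (\<bar>K 0\<bar> + C1 * (real m / hh))" by (simp add: algebra_simps)
  finally show ?thesis by (simp add: k_def)
qed

text \<open>Deterministic: horizon, outcome and time all vary with j, and only the limit path x is
  fixed. Closeness that is uniform over outcomes and times reduces to convergence along all such
  sequences.\<close>

lemma dickey_fuller_pathwise:
  fixes K :: "real \<Rightarrow> real" and \<tau> :: "nat \<Rightarrow> nat" and \<omega> :: "nat \<Rightarrow> 'a"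
  assumes K: "bounded (range K)" "\<And>z. (K has_real_derivative deriv K z) (at z)"
      "continuous_on UNIV (deriv K)" "bounded (range (deriv K))"
    and h: "\<And>T. 0 < h T" and \<zeta>: "(\<lambda>T. real T / h T) \<longlonglongrightarrow> \<zeta>"
    and \<tau>: "filterlim \<tau> at_top sequentially"
    and Y0: "\<And>j. Y 0 (\<omega> j) = 0"
    and x: "continuous_on {0..1} x"
    and unif: "uniform_limit {0..1} (\<lambda>j r. Y (nat \<lfloor>real (\<tau> j) * r\<rfloor>) (\<omega> j) / sqrt (real (\<tau> j))) x sequentially"
    and Q: "\<And>e. e > 0 \<Longrightarrow> \<forall>\<^sub>F j in sequentially. \<forall>m\<le>\<tau> j.
        \<bar>\<Sum>t=1..m. (Y t (\<omega> j) - Y (t - 1) (\<omega> j))\<^sup>2 - \<sigma>2\<bar> \<le> e * real (\<tau> j)"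
    and s: "s \<longlonglongrightarrow> s0" "\<And>j. s j \<in> {0..1}" "s0 \<in> {0<..1}"
    and pos: "0 < (LINT r:{0..s0}|lborel. (x r)\<^sup>2)"
  shows "(\<lambda>j. dickey_fuller K h Y (\<tau> j) (s j) (\<omega> j)) \<longlonglongrightarrow>
    s0 / 2 * (K 0 * (x s0)\<^sup>2 + \<zeta> * (LINT r:{0..s0}|lborel. (x r)\<^sup>2 * deriv K (\<zeta> * (s0 - r)))
      - \<sigma>2 * (LINT r:{0..s0}|lborel. K (\<zeta> * (s0 - r)))) / (LINT r:{0..s0}|lborel. (x r)\<^sup>2)"
proof -
  define u where "u j r = Y (nat \<lfloor>real (\<tau> j) * r\<rfloor>) (\<omega> j) / sqrt (real (\<tau> j))" for j r
  define m where "m j = nat \<lfloor>real (\<tau> j) * s j\<rfloor>" for j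
  \<comment> \<open>The grid point to which s j is rounded down. The exact integral identity holds
    with such endpoints, and rounding costs at most 1 / \<tau> j.\<close>
  define q where "q j = real (m j) / real (\<tau> j)" for j
  define z where "z j = real (\<tau> j) / h (\<tau> j)" for j
  define E where "E j = (\<Sum>t=1..m j. ((Y t (\<omega> j) - Y (t - 1) (\<omega> j))\<^sup>2 - \<sigma>2) *
      K ((real (m j) - real t) / h (\<tau> j))) / real (\<tau> j)" for j
  obtain C0 where C0: "\<And>z. \<bar>K z\<bar> \<le> C0" using K(1) by (auto simp: bounded_iff)
  obtain C1 where C1: "\<And>z. \<bar>deriv K z\<bar> \<le> C1" using K(4) by (auto simp: bounded_iff)
  have C1_0: "0 \<le> C1" using C1[of 0] by simp
  have Kcont: "continuous_on UNIV K"
    using K(2) by (intro DERIV_continuous_on) (auto intro: has_field_derivative_at_within)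
  note [measurable] = borel_measurable_continuous_onI[OF Kcont] borel_measurable_continuous_onI[OF K(3)]
  have "bounded (x ` {0..1})" by (intro compact_imp_bounded compact_continuous_image x) auto
  then obtain Cx where Cx: "\<And>r. r \<in> {0..1} \<Longrightarrow> \<bar>x r\<bar> \<le> Cx"
    unfolding bounded_iff real_norm_def by blast
  have z: "z \<longlonglongrightarrow> \<zeta>" unfolding z_def by (rule filterlim_compose[OF \<zeta> \<tau>])
  have \<tau>_pos: "\<forall>\<^sub>F j in sequentially. 0 < \<tau> j" 
    using \<tau> eventually_gt_at_top[of 0] by (auto simp: filterlim_iff)
  have inv_\<tau>: "(\<lambda>j. 1 / real (\<tau> j)) \<longlonglongrightarrow> 0" by (rule filterlim_compose[OF lim_1_over_n \<tau>])
  have grid: "(\<lambda>j. real (nat \<lfloor>real (\<tau> j) * r\<rfloor>) / real (\<tau> j)) \<longlonglongrightarrow> r" if "r \<in> {0..1}" for r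
    using filterlim_compose[OF grid_approximation[of r] \<tau>] that by simp
  have q01: "q j \<in> {0..1}" for j
  proof -
    have "real (m j) \<le> real (\<tau> j) * s j" using s(2)[of j] by (simp add: m_def of_nat_floor)
    also have "\<dots> \<le> real (\<tau> j)" using s(2)[of j] by (intro mult_left_le) auto
    finally show ?thesis by (auto simp: q_def divide_le_eq_1)
  qed
  have m_le: "m j \<le> \<tau> j" for j
  proof -
    have "real (m j) \<le> real (\<tau> j) * s j" using s(2)[of j] by (simp add: m_def of_nat_floor)
    also have "\<dots> \<le> real (\<tau> j)" using s(2)[of j] by (intro mult_left_le) auto
    finally show ?thesis by simp
  qed
  have q: "q \<longlonglongrightarrow> s0"
  proof (rule Lim_transform2[OF s(1)], rule Lim_null_comparison[OF _ inv_\<tau>])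
    show "\<forall>\<^sub>F j in sequentially. norm (s j - q j) \<le> 1 / real (\<tau> j)"
      using \<tau>_pos
    proof eventually_elim
      case (elim j)
      have "0 \<le> real (\<tau> j) * s j" using s(2)[of j] by simp
      then have "\<bar>real (\<tau> j) * s j - real (m j)\<bar> \<le> 1" unfolding m_def by linarith
      then have "\<bar>real (\<tau> j) * s j - real (m j)\<bar> / real (\<tau> j) \<le> 1 / real (\<tau> j)"
        by (intro divide_right_mono) auto
      moreover have "s j - q j = (real (\<tau> j) * s j - real (m j)) / real (\<tau> j)"
        using elim by (simp add: q_def field_simps)
      ultimately show ?case by simp
    qed
  qed
  have u_lim: "(\<lambda>j. u j r) \<longlonglongrightarrow> x r" if "r \<in> {0..1}" for r
    using tendsto_uniform_limitI[OF unif that] by (simp add: u_def)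
  have u_bd: "\<forall>\<^sub>F j in sequentially. \<forall>r\<in>{0..1}. (u j r)\<^sup>2 \<le> (Cx + 1)\<^sup>2"
    using uniform_limitD[OF unif zero_less_one]
  proof eventually_elim
    case (elim j)
    have "\<bar>u j r\<bar> \<le> \<bar>Cx + 1\<bar>" if "r \<in> {0..1}" for r
      using bspec[OF elim that] Cx[OF that] unfolding u_def dist_real_def by linarith
    then show ?case by (auto simp: abs_le_square_iff[symmetric])
  qed
  have [measurable]: "u j \<in> borel_measurable borel" for j unfolding u_def by measurable
  \<comment> \<open>Uniform convergence together with continuity of x permits evaluation at the
    moving times.\<close>
  have us: "(\<lambda>j. u j (s j)) \<longlonglongrightarrow> x s0"
  proof (rule Lim_transform2)
    show "(\<lambda>j. x (s j)) \<longlonglongrightarrow> x s0"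
      using s by (intro continuous_on_tendsto_compose[OF x]) auto
    show "(\<lambda>j. x (s j) - u j (s j)) \<longlonglongrightarrow> 0"
    proof (rule tendstoI)
      fix e :: real assume "0 < e"
      from uniform_limitD[OF unif this]
      show "\<forall>\<^sub>F j in sequentially. dist (x (s j) - u j (s j)) 0 < e"
        by eventually_elim (use s(2) in \<open>auto simp: u_def dist_real_def abs_minus_commute\<close>)
    qed
  qed
  have s0': "s0 \<in> {0..1}" using s(3) by auto
  have den: "(\<lambda>j. LINT r:{0..q j}|lborel. (u j r)\<^sup>2) \<longlonglongrightarrow> (LINT r:{0..s0}|lborel. (x r)\<^sup>2)"
    by (rule set_integral_moving_endpoint_LIMSEQ[OF q q01 s0' _ _ tendsto_power[OF u_lim], where C = "(Cx + 1)\<^sup>2"])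
       (use u_bd in auto)
  have der: "(\<lambda>j. LINT r:{0..q j}|lborel. (u j r)\<^sup>2 * deriv K (z j * (q j - r))) \<longlonglongrightarrow>
      (LINT r:{0..s0}|lborel. (x r)\<^sup>2 * deriv K (\<zeta> * (s0 - r)))"
  proof (rule set_integral_moving_endpoint_LIMSEQ[OF q q01 s0', where C = "(Cx + 1)\<^sup>2 * C1"])
    show "\<forall>\<^sub>F j in sequentially. \<forall>r\<in>{0..1}. \<bar>(u j r)\<^sup>2 * deriv K (z j * (q j - r))\<bar> \<le> (Cx + 1)\<^sup>2 * C1"
      using u_bd by eventually_elim (auto simp: abs_mult intro!: mult_mono C1)
    fix r :: real assume r: "r \<in> {0..1}"
    show "(\<lambda>j. (u j r)\<^sup>2 * deriv K (z j * (q j - r))) \<longlonglongrightarrow> (x r)\<^sup>2 * deriv K (\<zeta> * (s0 - r))"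
      by (intro tendsto_intros u_lim[OF r] continuous_on_tendsto_compose[OF K(3)] z q) auto
  qed measurable
  have ker: "(\<lambda>j. LINT r:{0..q j}|lborel. K ((real (m j) - real (Suc (nat \<lfloor>real (\<tau> j) * r\<rfloor>))) / h (\<tau> j))) \<longlonglongrightarrow>
      (LINT r:{0..s0}|lborel. K (\<zeta> * (s0 - r)))"
  proof (rule set_integral_moving_endpoint_LIMSEQ[OF q q01 s0', where C = C0])
    fix r :: real assume r: "r \<in> {0..1}"
    \<comment> \<open>The argument of K is expressed through z, q and the grid point below r. The
      \<open>Suc\<close> contributes 1 / \<tau> j, which vanishes in the limit.\<close>
    have "(\<lambda>j. z j * (q j - (real (nat \<lfloor>real (\<tau> j) * r\<rfloor>) / real (\<tau> j) + 1 / real (\<tau> j)))) \<longlonglongrightarrow> \<zeta> * (s0 - (r + 0))"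
      by (intro tendsto_intros z q grid[OF r] inv_\<tau>)
    moreover have "\<forall>\<^sub>F j in sequentially. z j * (q j - (real (nat \<lfloor>real (\<tau> j) * r\<rfloor>) / real (\<tau> j) + 1 / real (\<tau> j)))
        = (real (m j) - real (Suc (nat \<lfloor>real (\<tau> j) * r\<rfloor>))) / h (\<tau> j)"
      using \<tau>_pos
    proof eventually_elim
      case (elim j)
      then show ?case using h[of "\<tau> j"] by (simp add: z_def q_def field_simps)
    qed
    ultimately have "(\<lambda>j. (real (m j) - real (Suc (nat \<lfloor>real (\<tau> j) * r\<rfloor>))) / h (\<tau> j)) \<longlonglongrightarrow> \<zeta> * (s0 - r)"
      by (auto intro: Lim_transform_eventually)
    then show "(\<lambda>j. K ((real (m j) - real (Suc (nat \<lfloor>real (\<tau> j) * r\<rfloor>))) / h (\<tau> j))) \<longlonglongrightarrow> K (\<zeta> * (s0 - r))"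
      by (intro continuous_on_tendsto_compose[OF Kcont]) auto
  qed (use C0 in \<open>auto simp del: of_nat_Suc\<close>)
  have err: "E \<longlonglongrightarrow> 0"
  proof (rule tendstoI)
    fix e :: real assume e: "0 < e"
    \<comment> \<open>Eventually m / h \<le> T / h < \<bar>\<zeta>\<bar> + 1, so b exceeds the
      factor in \<open>weighted_sum_bound\<close>; the last summand 1 makes b positive. The partial
      sums are then required to stay below e / b times the horizon.\<close>
    define b where "b = \<bar>K 0\<bar> + C1 * (\<bar>\<zeta>\<bar> + 1) + 1"
    have "0 \<le> C1 * (\<bar>\<zeta>\<bar> + 1)" using C1_0 by simp
    then have b: "b > 0" "\<bar>K 0\<bar> + C1 * (\<bar>\<zeta>\<bar> + 1) < b" unfolding b_def by linarith+
    have eb: "e / b > 0" using e b by simp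
    have "\<forall>\<^sub>F j in sequentially. z j < \<bar>\<zeta>\<bar> + 1" by (rule order_tendstoD(2)[OF z]) simp
    then show "\<forall>\<^sub>F j in sequentially. dist (E j) 0 < e"
      using Q[OF eb] \<tau>_pos
    proof eventually_elim
      case (elim j)
      have "real (m j) / h (\<tau> j) \<le> z j"
        using m_le[of j] h[of "\<tau> j"] by (simp add: z_def divide_right_mono)
      then have "real (m j) / h (\<tau> j) \<le> \<bar>\<zeta>\<bar> + 1" using elim by linarith
      then have "C1 * (real (m j) / h (\<tau> j)) \<le> C1 * (\<bar>\<zeta>\<bar> + 1)" using C1_0 by (intro mult_left_mono)
      then have lt: "\<bar>K 0\<bar> + C1 * (real (m j) / h (\<tau> j)) < b" using b(2) by linarith
      have wb: "\<bar>\<Sum>t=1..m j. ((Y t (\<omega> j) - Y (t - 1) (\<omega> j))\<^sup>2 - \<sigma>2) * K ((real (m j) - real t) / h (\<tau> j))\<bar>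
          \<le> (e / b * real (\<tau> j)) * (\<bar>K 0\<bar> + C1 * (real (m j) / h (\<tau> j)))"
        by (rule weighted_sum_bound[OF h K(2) C1]) (use elim(2) m_le[of j] order_trans in blast)
      have "\<bar>E j\<bar> \<le> (e / b * real (\<tau> j)) * (\<bar>K 0\<bar> + C1 * (real (m j) / h (\<tau> j))) / real (\<tau> j)"
        unfolding E_def abs_divide abs_of_nat by (rule divide_right_mono[OF wb]) simp
      also have "\<dots> = e / b * (\<bar>K 0\<bar> + C1 * (real (m j) / h (\<tau> j)))" using elim by simp
      also have "\<dots> < e / b * b" using lt e b by (intro mult_strict_left_mono) auto
      also have "\<dots> = e" using b by simp
      finally show ?case by simp
    qed
  qed
  have "(\<lambda>j. q j * ((K 0 * (u j (s j))\<^sup>2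
      + z j * (LINT r:{0..q j}|lborel. (u j r)\<^sup>2 * deriv K (z j * (q j - r)))
      - \<sigma>2 * (LINT r:{0..q j}|lborel. K ((real (m j) - real (Suc (nat \<lfloor>real (\<tau> j) * r\<rfloor>))) / h (\<tau> j)))
      - E j) / 2) / (LINT r:{0..q j}|lborel. (u j r)\<^sup>2)) \<longlonglongrightarrow>
    s0 * ((K 0 * (x s0)\<^sup>2 + \<zeta> * (LINT r:{0..s0}|lborel. (x r)\<^sup>2 * deriv K (\<zeta> * (s0 - r)))
      - \<sigma>2 * (LINT r:{0..s0}|lborel. K (\<zeta> * (s0 - r))) - 0) / 2) / (LINT r:{0..s0}|lborel. (x r)\<^sup>2)"
    using pos by (intro tendsto_intros q us z der ker err den) auto
  \<comment> \<open>Excludes m = 0, where 1 / m and 1 / m^2 are 0 by convention.\<close>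
  moreover have "\<forall>\<^sub>F j in sequentially. 0 < q j" by (rule order_tendstoD(1)[OF q]) (use s(3) in auto)
  then have "\<forall>\<^sub>F j in sequentially. q j * ((K 0 * (u j (s j))\<^sup>2
      + z j * (LINT r:{0..q j}|lborel. (u j r)\<^sup>2 * deriv K (z j * (q j - r)))
      - \<sigma>2 * (LINT r:{0..q j}|lborel. K ((real (m j) - real (Suc (nat \<lfloor>real (\<tau> j) * r\<rfloor>))) / h (\<tau> j)))
      - E j) / 2) / (LINT r:{0..q j}|lborel. (u j r)\<^sup>2) = dickey_fuller K h Y (\<tau> j) (s j) (\<omega> j)"
    using \<tau>_pos
  proof eventually_elim
    case (elim j)
    have T: "real (\<tau> j) > 0" and mpos: "real (m j) > 0" using elim by (auto simp: q_def zero_less_divide_iff)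
    define N where "N = (\<Sum>t=1..m j. Y (t - 1) (\<omega> j) * (Y t (\<omega> j) - Y (t - 1) (\<omega> j)) * K ((real (m j) - real t) / h (\<tau> j)))"
    define D where "D = (\<Sum>t=1..m j. (Y (t - 1) (\<omega> j))\<^sup>2)"
    have "D = (\<Sum>t<m j. (Y t (\<omega> j))\<^sup>2)"
      unfolding D_def by (rule sum.reindex_bij_witness[of _ Suc "\<lambda>t. t - 1"]) auto
    then have D: "(LINT r:{0..q j}|lborel. (u j r)\<^sup>2) = D / (real (\<tau> j))\<^sup>2"
      using set_integral_step[OF T, of "m j" "\<lambda>t. (Y t (\<omega> j) / sqrt (real (\<tau> j)))\<^sup>2"] T
      by (simp add: u_def q_def power_divide sum_divide_distrib[symmetric] power2_eq_square)
    have N: "(K 0 * (u j (s j))\<^sup>2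
      + z j * (LINT r:{0..q j}|lborel. (u j r)\<^sup>2 * deriv K (z j * (q j - r)))
      - \<sigma>2 * (LINT r:{0..q j}|lborel. K ((real (m j) - real (Suc (nat \<lfloor>real (\<tau> j) * r\<rfloor>))) / h (\<tau> j)))
      - E j) / 2 = N / real (\<tau> j)"
      using weighted_sum_eq_integral[OF T h[of "\<tau> j"], where y = "\<lambda>t. Y t (\<omega> j)", OF Y0 K(2,3), of "m j" \<sigma>2]
      by (simp add: N_def u_def q_def z_def E_def m_def)
    have "dickey_fuller K h Y (\<tau> j) (s j) (\<omega> j) = (1 / real (m j) * N) / (1 / (real (m j))\<^sup>2 * D)"
      by (simp add: dickey_fuller_def Let_def m_def N_def D_def)
    \<comment> \<open>Both sides are m * N / D. For D = 0 both are divisions by 0 and hence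
      0.\<close>
    also have "\<dots> = q j * (N / real (\<tau> j)) / (D / (real (\<tau> j))\<^sup>2)"
      using T mpos by (cases "D = 0") (auto simp: q_def field_simps power2_eq_square)
    finally show ?case unfolding N D by simp
  qed
  ultimately have "(\<lambda>j. dickey_fuller K h Y (\<tau> j) (s j) (\<omega> j)) \<longlonglongrightarrow>
    s0 * ((K 0 * (x s0)\<^sup>2 + \<zeta> * (LINT r:{0..s0}|lborel. (x r)\<^sup>2 * deriv K (\<zeta> * (s0 - r)))
      - \<sigma>2 * (LINT r:{0..s0}|lborel. K (\<zeta> * (s0 - r))) - 0) / 2) / (LINT r:{0..s0}|lborel. (x r)\<^sup>2)"
    by (rule Lim_transform_eventually)
  then show ?thesis by simp
qed

text \<open>The integrals vary continuously with s by the limit with moving endpoints, applied to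
  one fixed path, and the denominator is positive on (0, 1]; at 0 it vanishes.\<close>

lemma dickey_fuller_limit_continuous:
  assumes K: "bounded (range K)" "\<And>z. (K has_real_derivative deriv K z) (at z)"
      "continuous_on UNIV (deriv K)" "bounded (range (deriv K))"
    and B: "continuous_on {0..1} (\<lambda>s. B s \<omega>)"
    and pos: "\<And>s. s \<in> {0<..1} \<Longrightarrow> 0 < (LINT r:{0..s}|lborel. (B r \<omega>)\<^sup>2)"
  shows "continuous_on {0<..1} (\<lambda>s. dickey_fuller_limit K \<zeta> \<theta> B s \<omega>)"
  unfolding continuous_on_sequentially comp_def
proof (intro allI ballI impI)
  fix s :: "nat \<Rightarrow> real" and s0 :: real assume s0: "s0 \<in> {0<..1}" and "(\<forall>j. s j \<in> {0<..1}) \<and> s \<longlonglongrightarrow> s0"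
  then have s: "\<And>j. s j \<in> {0<..1}" "s \<longlonglongrightarrow> s0" by auto
  have s01: "s j \<in> {0..1}" for j using s(1)[of j] by auto
  have s0': "s0 \<in> {0..1}" using s0 by auto
  obtain C0 where C0: "\<And>z. \<bar>K z\<bar> \<le> C0" using K(1) by (auto simp: bounded_iff)
  obtain C1 where C1: "\<And>z. \<bar>deriv K z\<bar> \<le> C1" using K(4) by (auto simp: bounded_iff)
  have Kcont: "continuous_on UNIV K"
    using K(2) by (intro DERIV_continuous_on) (auto intro: has_field_derivative_at_within)
  note [measurable] = borel_measurable_continuous_onI[OF Kcont] borel_measurable_continuous_onI[OF K(3)]
  \<comment> \<open>Continuity of the path is known on [0, 1] alone, so the path cut off to [0, 1]
    is the measurable object.\<close>
  have [measurable]: "(\<lambda>r. indicator {0..1} r * B r \<omega>) \<in> borel_measurable borel"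
    using borel_measurable_continuous_on_indicator[OF _ B] by simp
  have ind2: "indicator {0..1} r * ((B r \<omega>)\<^sup>2 * v) = (indicator {0..1} r * B r \<omega>)\<^sup>2 * v" for r v :: real
    by (simp split: split_indicator)
  have "bounded ((\<lambda>r. B r \<omega>) ` {0..1})" by (intro compact_imp_bounded compact_continuous_image B) auto
  then obtain Cx where "\<And>r. r \<in> {0..1} \<Longrightarrow> \<bar>B r \<omega>\<bar> \<le> Cx"
    unfolding bounded_iff real_norm_def by blast
  then have Cx: "(B r \<omega>)\<^sup>2 \<le> Cx\<^sup>2" if "r \<in> {0..1}" for r
    using that by (simp add: abs_le_square_iff[symmetric]) (metis abs_ge_self order_trans)
  have der: "(\<lambda>j. LINT r:{0..s j}|lborel. (B r \<omega>)\<^sup>2 * deriv K (\<zeta> * (s j - r))) \<longlonglongrightarrow>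
      (LINT r:{0..s0}|lborel. (B r \<omega>)\<^sup>2 * deriv K (\<zeta> * (s0 - r)))"
  proof (rule set_integral_moving_endpoint_LIMSEQ[OF s(2) s01 s0', where C = "Cx\<^sup>2 * C1"])
    show "\<forall>\<^sub>F j in sequentially. \<forall>r\<in>{0..1}. \<bar>(B r \<omega>)\<^sup>2 * deriv K (\<zeta> * (s j - r))\<bar> \<le> Cx\<^sup>2 * C1"
      by (auto simp: abs_mult intro!: mult_mono C1 Cx always_eventually)
    show "(\<lambda>j. (B r \<omega>)\<^sup>2 * deriv K (\<zeta> * (s j - r))) \<longlonglongrightarrow> (B r \<omega>)\<^sup>2 * deriv K (\<zeta> * (s0 - r))" for r
      by (intro tendsto_intros continuous_on_tendsto_compose[OF K(3)] s) auto
    show "(\<lambda>r. indicator {0..1} r * ((B r \<omega>)\<^sup>2 * deriv K (\<zeta> * (s j - r)))) \<in> borel_measurable borel" for j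
      unfolding ind2 by measurable
  qed
  have ker: "(\<lambda>j. LINT r:{0..s j}|lborel. K (\<zeta> * (s j - r))) \<longlonglongrightarrow> (LINT r:{0..s0}|lborel. K (\<zeta> * (s0 - r)))"
  proof (rule set_integral_moving_endpoint_LIMSEQ[OF s(2) s01 s0', where C = C0])
    show "(\<lambda>j. K (\<zeta> * (s j - r))) \<longlonglongrightarrow> K (\<zeta> * (s0 - r))" for r
      by (intro tendsto_intros continuous_on_tendsto_compose[OF Kcont] s) auto
  qed (use C0 in auto)
  have den: "(\<lambda>j. LINT r:{0..s j}|lborel. (B r \<omega>)\<^sup>2) \<longlonglongrightarrow> (LINT r:{0..s0}|lborel. (B r \<omega>)\<^sup>2)"
  proof (rule set_integral_moving_endpoint_LIMSEQ[OF s(2) s01 s0', where C = "Cx\<^sup>2"])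
    show "(\<lambda>r. indicator {0..1} r * (B r \<omega>)\<^sup>2) \<in> borel_measurable borel"
      using ind2[of _ 1] by simp
  qed (use Cx in auto)
  have Bs: "(\<lambda>j. B (s j) \<omega>) \<longlonglongrightarrow> B s0 \<omega>"
    by (rule continuous_on_tendsto_compose[OF B s(2) s0']) (use s01 in auto)
  have "(\<lambda>j. s j / 2 * (K 0 * (B (s j) \<omega>)\<^sup>2
                 + \<zeta> * (LINT r:{0..s j}|lborel. (B r \<omega>)\<^sup>2 * deriv K (\<zeta> * (s j - r)))
                 - 1 / \<theta>\<^sup>2 * (LINT r:{0..s j}|lborel. K (\<zeta> * (s j - r)))) /
        (LINT r:{0..s j}|lborel. (B r \<omega>)\<^sup>2)) \<longlonglongrightarrow> 
       s0 / 2 * (K 0 * (B s0 \<omega>)\<^sup>2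
                 + \<zeta> * (LINT r:{0..s0}|lborel. (B r \<omega>)\<^sup>2 * deriv K (\<zeta> * (s0 - r)))
                 - 1 / \<theta>\<^sup>2 * (LINT r:{0..s0}|lborel. K (\<zeta> * (s0 - r)))) /
        (LINT r:{0..s0}|lborel. (B r \<omega>)\<^sup>2)"
    using pos[OF s0] by (intro tendsto_mult tendsto_divide tendsto_add tendsto_diff tendsto_power
        tendsto_const der ker den Bs s(2)) auto
  moreover have "s j \<noteq> 0" for j using s(1)[of j] by auto
  ultimately show "(\<lambda>j. dickey_fuller_limit K \<zeta> \<theta> B (s j) \<omega>) \<longlonglongrightarrow> dickey_fuller_limit K \<zeta> \<theta> B s0 \<omega>"
    using s0 by (simp add: dickey_fuller_limit_def)
qed

section \<open>Weak convergence\<close>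

text \<open>Dividing by T instead of sqrt T kills the limit. Within Skorokhod distance 1 of a limit
  path bounded by A, every \<bar>S m\<bar> / sqrt T is at most A + 1, which is eventually below e *
  sqrt T. The mapping theorem is applied to the indicator of the event, with limit 0.\<close>

lemma weak_conv_skorokhod_partial_sums_negligible:
  fixes S :: "nat \<Rightarrow> 'a \<Rightarrow> real"
  assumes P: "prob_space P" and Q: "prob_space Q"
    and S: "\<And>j. S j \<in> borel_measurable P"
    and conv: "weak_conv_skorokhod 0 1 P (\<lambda>T s \<omega>. S (nat \<lfloor>real T * s\<rfloor>) \<omega> / sqrt (real T)) Q Z"
    and e: "e > 0"
  shows "(\<lambda>T. measure P {\<omega>\<in>space P. e \<le> (MAX m\<in>{..T}. \<bar>S m \<omega>\<bar>) / real T}) \<longlonglongrightarrow> 0"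
proof -
  interpret P: prob_space P by fact
  interpret D: Metric_space "skorokhod_space 0 1" "skorokhod_dist 0 1"
    by (rule Metric_space_skorokhod)
  note [measurable] = S
  obtain \<zeta> where \<zeta>: "skorokhod_version 0 1 Q Z \<zeta>"
    using conv by (auto simp: weak_conv_skorokhod_def)
  define \<xi> where "\<xi> T \<omega> = step_path 0 1 (real T) (\<lambda>j. S j \<omega> / sqrt (real T))" for T \<omega>
  have \<xi>: "skorokhod_version 0 1 P (\<lambda>s \<omega>. S (nat \<lfloor>real T * s\<rfloor>) \<omega> / sqrt (real T)) (\<xi> T)" for T
    unfolding \<xi>_def by (rule step_path_version) auto
  define R where "R T \<omega> = (MAX m\<in>{..T}. \<bar>S m \<omega>\<bar>) / real T" for T \<omega>
  have [measurable]: "R T \<in> borel_measurable P" for T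
    unfolding R_def by (intro borel_measurable_divide borel_measurable_Max) auto
  define U where "U T = (indicator {\<omega>\<in>space P. e \<le> R T \<omega>} :: _ \<Rightarrow> real)" for T
  have "(\<lambda>T. \<integral>\<omega>. U T \<omega> \<partial>P) \<longlonglongrightarrow> (\<integral>\<omega>. 0 \<partial>Q)"
  proof (rule D.extended_mapping[OF P Q, where \<xi> = \<xi> and \<zeta> = \<zeta> and C = 1 and R = "\<lambda>_ _. 0"])
    show "\<xi> T \<in> P \<rightarrow>\<^sub>M D.mborel" for T
      using \<xi> unfolding skorokhod_version_def skorokhod_borel_eq by blast
    show "\<zeta> \<in> Q \<rightarrow>\<^sub>M D.mborel"
      using \<zeta> unfolding skorokhod_version_def skorokhod_borel_eq by blast
    show "(\<lambda>n. \<integral>\<omega>. f (\<xi> n \<omega>) \<partial>P) \<longlonglongrightarrow> (\<integral>\<omega>. f (\<zeta> \<omega>) \<partial>Q)"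
      if "continuous_map D.mtopology euclideanreal f" "bounded (f ` skorokhod_space 0 1)" for f
      using weak_conv_skorokhodD[OF conv \<xi> \<zeta> that] .
    show "AE \<omega>' in Q. \<forall>e>0. \<exists>r>0. \<forall>\<^sub>F T in sequentially. \<forall>\<omega>\<in>space P.
        skorokhod_dist 0 1 (\<xi> T \<omega>) (\<zeta> \<omega>') < r \<longrightarrow> 0 < r \<longrightarrow> \<bar>U T \<omega> - 0\<bar> < e"
    proof (intro AE_I2 allI impI)
      fix \<omega>' and c :: real assume w': "\<omega>' \<in> space Q" and c: "c > 0"
      have \<zeta>D: "\<zeta> \<omega>' \<in> skorokhod_space 0 1" by (rule skorokhod_version_in_space[OF \<zeta> w'])
      then obtain A where A: "\<And>t. t \<in> {0..1} \<Longrightarrow> \<bar>\<zeta> \<omega>' t\<bar> \<le> A"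
        using cadlag_on_bounded[of 0 1 "\<zeta> \<omega>'"] unfolding skorokhod_space_def by blast
      \<comment> \<open>T > ((A + 1) / e)^2 is what makes A + 1 < e * sqrt T.\<close>
      obtain n :: nat where n: "((A + 1) / e)\<^sup>2 < real n" using reals_Archimedean2 by blast
      have "\<forall>\<^sub>F T in sequentially. \<forall>\<omega>\<in>space P. skorokhod_dist 0 1 (\<xi> T \<omega>) (\<zeta> \<omega>') < 1 \<longrightarrow> 0 < (1::real) \<longrightarrow> \<bar>U T \<omega> - 0\<bar> < c"
        using eventually_ge_at_top[of "max n 1"]
      proof eventually_elim
        case (elim T)
        have T: "real T > 0" "real n \<le> real T" using elim by auto
        show ?case
        proof (intro ballI impI)
          fix \<omega> assume w: "\<omega> \<in> space P" and "skorokhod_dist 0 1 (\<xi> T \<omega>) (\<zeta> \<omega>') < 1"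
          then obtain b where b: "b < 1" "skorokhod_close 0 1 (\<xi> T \<omega>) (\<zeta> \<omega>') b"
            using skorokhod_dist_less[OF skorokhod_version_in_space[OF \<xi> w] \<zeta>D] by blast
          then obtain l where l: "l \<in> time_changes 0 1"
            "\<And>t. t \<in> {0..1} \<Longrightarrow> \<bar>\<xi> T \<omega> t - \<zeta> \<omega>' (l t)\<bar> \<le> b"
            by (auto simp: skorokhod_close_def)
          have "\<bar>S m \<omega>\<bar> / real T < e" if m: "m \<le> T" for m
          proof -
            \<comment> \<open>The time m / T is one at which the step path reads exactly
              \<open>S m\<close>.\<close>
            have t: "real m / real T \<in> {0..1}" using m T by (simp add: divide_le_eq_1)
            have "l (real m / real T) \<in> l ` {0..1}" using t by (rule imageI)
            then have "l (real m / real T) \<in> {0..1}" using l(1) by (simp add: time_changes_def)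
            then have "\<bar>\<xi> T \<omega> (real m / real T)\<bar> \<le> A + 1"
              using A l(2)[OF t] b(1) by fastforce
            then have "\<bar>S m \<omega>\<bar> / sqrt (real T) \<le> A + 1"
              using t T by (simp add: \<xi>_def step_path_def abs_divide)
            moreover have "((A + 1) / e)\<^sup>2 < real T" using n T by linarith
            then have "\<bar>(A + 1) / e\<bar> < sqrt (real T)" by (rule real_less_rsqrt[of "\<bar>(A + 1) / e\<bar>", unfolded power2_abs])
            then have "(A + 1) / e < sqrt (real T)" by linarith
            then have "A + 1 < e * sqrt (real T)" using e by (simp add: field_simps)
            ultimately have "\<bar>S m \<omega>\<bar> / sqrt (real T) < e * sqrt (real T)" by linarith
            then have "\<bar>S m \<omega>\<bar> < e * (sqrt (real T) * sqrt (real T))"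
              using T by (simp add: pos_divide_less_eq mult_ac)
            then show ?thesis using T by (simp add: field_simps)
          qed
          then have "\<And>m. m \<le> T \<Longrightarrow> \<bar>S m \<omega>\<bar> < e * real T" using T by (simp add: field_simps)
          then have "(MAX m\<in>{..T}. \<bar>S m \<omega>\<bar>) < e * real T" by (subst Max_less_iff) auto
          then have "R T \<omega> < e" using T by (simp add: R_def field_simps)
          then show "\<bar>U T \<omega> - 0\<bar> < c" using c by (simp add: U_def)
        qed
      qed
      then show "\<exists>r>0. \<forall>\<^sub>F T in sequentially. \<forall>\<omega>\<in>space P.
        skorokhod_dist 0 1 (\<xi> T \<omega>) (\<zeta> \<omega>') < r \<longrightarrow> 0 < r \<longrightarrow> \<bar>U T \<omega> - 0\<bar> < c"
        by (intro exI[of _ 1]) simp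
    qed
  qed (auto simp: U_def split: split_indicator)
  moreover have "(\<integral>\<omega>. U T \<omega> \<partial>P) = measure P {\<omega>\<in>space P. e \<le> R T \<omega>}" for T
    unfolding U_def by simp
  ultimately show ?thesis by (simp add: R_def)
qed

section \<open>Versions of the limits, and the scale constants\<close>

lemma scaled_brownian_version:
  assumes "standard_brownian_motion Q B"
  shows "\<exists>\<zeta>. skorokhod_version 0 1 Q (\<lambda>s \<omega>. c * B s \<omega>) \<zeta>"
proof (rule continuous_process_version)
  show "(\<lambda>\<omega>. c * B t \<omega>) \<in> borel_measurable Q" if "t \<in> {0..1}" for t
  proof -
    have [measurable]: "B t \<in> borel_measurable Q" using assms that unfolding standard_brownian_motion_def by blast
    show ?thesis by measurable
  qed
  have "AE \<omega> in Q. continuous_on {0..1} (\<lambda>t. B t \<omega>)" using assms by (simp add: standard_brownian_motion_def)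
  then show "AE \<omega> in Q. continuous_on {0..1} (\<lambda>t. c * B t \<omega>)"
    by eventually_elim (intro continuous_intros)
qed auto

lemma dickey_fuller_limit_version:
  fixes B :: "real \<Rightarrow> 'a \<Rightarrow> real"
  assumes K: "bounded (range K)" "\<And>z. (K has_real_derivative deriv K z) (at z)"
      "continuous_on UNIV (deriv K)" "bounded (range (deriv K))"
    and B: "standard_brownian_motion Q B" and \<kappa>: "0 < \<kappa>" "\<kappa> < 1"
  shows "\<exists>\<xi>. skorokhod_version \<kappa> 1 Q (dickey_fuller_limit K \<zeta> \<theta> B) \<xi>"
proof -
  have "AE \<omega> in Q. continuous_on {0..1} (\<lambda>t. B t \<omega>) \<and> (\<forall>s\<in>{0<..1}. 0 < (LINT r:{0..s}|lborel. (B r \<omega>)\<^sup>2))"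
    using B brownian_integral_pos[OF B] by (auto simp: standard_brownian_motion_def)
  then obtain E where E: "{\<omega>\<in>space Q. \<not> (continuous_on {0..1} (\<lambda>t. B t \<omega>) \<and>
      (\<forall>s\<in>{0<..1}. 0 < (LINT r:{0..s}|lborel. (B r \<omega>)\<^sup>2)))} \<subseteq> E" "E \<in> null_sets Q"
    unfolding eventually_ae_filter by blast
  have [measurable]: "E \<in> sets Q" using E(2) by auto
  \<comment> \<open>The value is 1 and not 0: on the null set, too, the quadratic integral has to be
    positive, so that the limit is continuous in s for every outcome.\<close>
  define B' where "B' t \<omega> = (if \<omega> \<in> E then 1 else B t \<omega>)" for t \<omega>
  have Bm: "B' t \<in> borel_measurable Q" if "t \<in> {0..1}" for t
  proof -
    have [measurable]: "B t \<in> borel_measurable Q" using B that by (simp add: standard_brownian_motion_def)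
    show ?thesis unfolding B'_def by measurable
  qed
  have Bc: "continuous_on {0..1} (\<lambda>t. B' t \<omega>)" if "\<omega> \<in> space Q" for \<omega>
    using E(1) that by (cases "\<omega> \<in> E") (auto simp: B'_def)
  have Bp: "0 < (LINT r:{0..s}|lborel. (B' r \<omega>)\<^sup>2)" if "\<omega> \<in> space Q" "s \<in> {0<..1}" for \<omega> s
  proof (cases "\<omega> \<in> E")
    case True
    then show ?thesis using that by (simp add: B'_def set_lebesgue_integral_def)
  next
    case False
    then have "0 < (LINT r:{0..s}|lborel. (B r \<omega>)\<^sup>2)" using E(1) that by blast
    then show ?thesis using False by (simp add: B'_def)
  qed
  have Kcont: "continuous_on UNIV K"
    using K(2) by (intro DERIV_continuous_on) (auto intro: has_field_derivative_at_within)
  note [measurable] = borel_measurable_continuous_onI[OF Kcont] borel_measurable_continuous_onI[OF K(3)]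
  have W: "(\<lambda>(\<omega>, t). B' (min 1 (max 0 t)) \<omega>) \<in> borel_measurable (Q \<Otimes>\<^sub>M borel)"
    by (rule continuous_process_jointly_measurable[OF order_refl zero_le_one Bm Bc])
  then have W'[measurable]: "(\<lambda>p. B' (min 1 (max 0 (snd p))) (fst p)) \<in> borel_measurable (Q \<Otimes>\<^sub>M lborel)"
    by (simp add: case_prod_beta')
  have int_meas: "(\<lambda>\<omega>. LINT r:{0..s}|lborel. (B' r \<omega>)\<^sup>2 * g r) \<in> borel_measurable Q"
    if s: "s \<in> {0..1}" and g[measurable]: "g \<in> borel_measurable borel" for s and g :: "real \<Rightarrow> real"
  proof -
    \<comment> \<open>On [0, s] the clamp does nothing, so the jointly measurable clamped process
      may replace \<open>B'\<close> under the integral.\<close>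
    have eq: "indicator {0..s} r *\<^sub>R ((B' r \<omega>)\<^sup>2 * g r) =
        indicator {0..s} r * ((B' (min 1 (max 0 r)) \<omega>)\<^sup>2 * g r)" for r \<omega>
    proof (cases "r \<in> {0..s}")
      case True
      then have "min 1 (max 0 r) = r" using s by auto
      then show ?thesis by simp
    qed simp
    have "(\<lambda>\<omega>. \<integral>r. indicator {0..s} r * ((B' (min 1 (max 0 r)) \<omega>)\<^sup>2 * g r) \<partial>lborel) \<in> borel_measurable Q"
      by (rule lborel.borel_measurable_lebesgue_integral) (unfold case_prod_beta', measurable)
    then show ?thesis unfolding set_lebesgue_integral_def eq .
  qed
  have "(\<lambda>\<omega>. \<lambda>s\<in>{\<kappa>..1}. dickey_fuller_limit K \<zeta> \<theta> B' s \<omega>) \<in> Q \<rightarrow>\<^sub>M skorokhod_borel \<kappa> 1"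
  proof (rule continuous_process_measurable)
    fix s assume s: "s \<in> {\<kappa>..1}"
    then have s01: "s \<in> {0..1}" using \<kappa> by auto
    have "(\<lambda>\<omega>. LINT r:{0..s}|lborel. (B' r \<omega>)\<^sup>2 * deriv K (\<zeta> * (s - r))) \<in> borel_measurable Q"
      by (rule int_meas[OF s01]) measurable
    moreover have "(\<lambda>\<omega>. LINT r:{0..s}|lborel. (B' r \<omega>)\<^sup>2) \<in> borel_measurable Q"
      using int_meas[OF s01, of "\<lambda>_. 1"] by simp
    ultimately show "dickey_fuller_limit K \<zeta> \<theta> B' s \<in> borel_measurable Q"
      using s \<kappa> Bm[OF s01] unfolding dickey_fuller_limit_def by simp
  next
    fix \<omega> assume w: "\<omega> \<in> space Q"
    show "continuous_on {\<kappa>..1} (\<lambda>s. dickey_fuller_limit K \<zeta> \<theta> B' s \<omega>)"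
      by (rule continuous_on_subset[OF dickey_fuller_limit_continuous[where B = B', OF K Bc[OF w] Bp[OF w]]])
         (use \<kappa> in auto)
  qed (use \<kappa> in auto)
  moreover have "AE \<omega> in Q. \<forall>s\<in>{\<kappa>..1}. (\<lambda>s\<in>{\<kappa>..1}. dickey_fuller_limit K \<zeta> \<theta> B' s \<omega>) s = dickey_fuller_limit K \<zeta> \<theta> B s \<omega>"
    using AE_not_in[OF E(2)]
    by eventually_elim (simp add: dickey_fuller_limit_def B'_def)
  ultimately show ?thesis unfolding skorokhod_version_def by blast
qed

text \<open>The pathwise limit sees the path \<eta> * B. The factor \<eta>^2 cancels except before
  the last kernel integral, where \<sigma>^2 / \<eta>^2 remains, the inverse square of \<eta> /
  \<sigma>.\<close>

lemma dickey_fuller_limit_scaled: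
  assumes \<eta>: "\<eta> \<noteq> 0" and \<sigma>: "\<sigma> \<noteq> 0" and s: "s \<noteq> 0"
  shows "s / 2 * (K 0 * (\<eta> * B s \<omega>)\<^sup>2 + \<zeta> * (LINT r:{0..s}|lborel. (\<eta> * B r \<omega>)\<^sup>2 * deriv K (\<zeta> * (s - r)))
      - \<sigma>\<^sup>2 * (LINT r:{0..s}|lborel. K (\<zeta> * (s - r)))) / (LINT r:{0..s}|lborel. (\<eta> * B r \<omega>)\<^sup>2)
    = dickey_fuller_limit K \<zeta> (\<eta> / \<sigma>) B s \<omega>"
proof -
  define I1 where "I1 = (LINT r:{0..s}|lborel. (B r \<omega>)\<^sup>2 * deriv K (\<zeta> * (s - r)))"
  define I2 where "I2 = (LINT r:{0..s}|lborel. K (\<zeta> * (s - r)))"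
  define I3 where "I3 = (LINT r:{0..s}|lborel. (B r \<omega>)\<^sup>2)"
  have 1: "(LINT r:{0..s}|lborel. (\<eta> * B r \<omega>)\<^sup>2 * deriv K (\<zeta> * (s - r))) = \<eta>\<^sup>2 * I1"
    unfolding I1_def power_mult_distrib mult.assoc by (rule set_integral_mult_right)
  have 2: "(LINT r:{0..s}|lborel. (\<eta> * B r \<omega>)\<^sup>2) = \<eta>\<^sup>2 * I3"
    unfolding I3_def power_mult_distrib by (rule set_integral_mult_right)
  have "s / 2 * (K 0 * (\<eta> * B s \<omega>)\<^sup>2 + \<zeta> * (\<eta>\<^sup>2 * I1) - \<sigma>\<^sup>2 * I2) / (\<eta>\<^sup>2 * I3)
     = \<eta>\<^sup>2 * (s / 2 * (K 0 * (B s \<omega>)\<^sup>2 + \<zeta> * I1 - 1 / (\<eta> / \<sigma>)\<^sup>2 * I2)) / (\<eta>\<^sup>2 * I3)"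
    using \<eta> \<sigma> by (simp add: power_mult_distrib power_divide algebra_simps)
  also have "\<dots> = s / 2 * (K 0 * (B s \<omega>)\<^sup>2 + \<zeta> * I1 - 1 / (\<eta> / \<sigma>)\<^sup>2 * I2) / I3"
    using \<eta> by (subst mult_divide_mult_cancel_left) auto
  finally show ?thesis
    using s unfolding 1 2 by (simp add: dickey_fuller_limit_def I1_def I2_def I3_def)
qed

text \<open>Stationarity for the index set {1} and the shift i - 1. It turns the centring of the
  i-th square in (E1) into the constant \<sigma>^2.\<close>

lemma strictly_stationary_integral_eq:
  fixes g :: "real \<Rightarrow> real"
  assumes st: "strictly_stationary P \<epsilon>" and i: "1 \<le> i" and g[measurable]: "g \<in> borel_measurable borel"
  shows "(\<integral>\<omega>. g (\<epsilon> i \<omega>) \<partial>P) = (\<integral>\<omega>. g (\<epsilon> 1 \<omega>) \<partial>P)"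
proof -
  have m: "\<epsilon> t \<in> borel_measurable P" if "t \<ge> 1" for t using st that by (simp add: strictly_stationary_def)
  have eq: "distr P (\<Pi>\<^sub>M t\<in>{1}. borel) (\<lambda>\<omega>. \<lambda>t\<in>{1}. \<epsilon> (t + (i - 1)) \<omega>) =
      distr P (\<Pi>\<^sub>M t\<in>{1}. borel) (\<lambda>\<omega>. \<lambda>t\<in>{1}. \<epsilon> t \<omega>)"
    using st unfolding strictly_stationary_def by (elim conjE allE[of _ "{1}"] allE[of _ "i - 1"]) simp
  have [measurable]: "(\<lambda>v. g (v 1)) \<in> borel_measurable (\<Pi>\<^sub>M t\<in>{1::nat}. borel)" by measurable
  have "(\<integral>v. g (v 1) \<partial>distr P (\<Pi>\<^sub>M t\<in>{1::nat}. borel) (\<lambda>\<omega>. \<lambda>t\<in>{1}. \<epsilon> (t + k) \<omega>)) = (\<integral>\<omega>. g (\<epsilon> (1 + k) \<omega>) \<partial>P)" for k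
    by (subst integral_distr) (auto intro!: measurable_restrict m)
  from this[of "i - 1"] this[of 0] show ?thesis using eq i by simp
qed

text \<open>With zero variance \<open>\<epsilon> 1\<close> would vanish almost surely, and so would
  its product moments with all later innovations. Then \<open>eta_sq\<close> would be constantly 0,
  although its limit \<eta>^2 is positive.\<close>

lemma innovation_sd_pos:
  assumes P: "prob_space P" and E1: "condition_E1 P \<epsilon> \<eta> \<eta>' N\<^sub>1 B\<^sub>1 N\<^sub>2 B\<^sub>2"
  shows "innovation_sd P \<epsilon> > 0"
proof (rule ccontr)
  interpret prob_space P by fact
  have m[measurable]: "\<epsilon> 1 \<in> borel_measurable P"
    using E1 by (simp add: condition_E1_def strictly_stationary_def)
  have int4: "integrable P (\<lambda>\<omega>. \<bar>\<epsilon> 1 \<omega>\<bar> ^ 4)" and \<eta>: "\<eta> > 0" "eta_sq P \<epsilon> \<longlonglongrightarrow> \<eta>\<^sup>2"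
    using E1 by (simp_all add: condition_E1_def)
  \<comment> \<open>Integrability comes first, because a nonintegrable function also has integral 0.
    The fourth moment dominates through x^2 \<le> 1 + x^4.\<close>
  have int2: "integrable P (\<lambda>\<omega>. (\<epsilon> 1 \<omega>)\<^sup>2)"
  proof (rule Bochner_Integration.integrable_bound)
    show "integrable P (\<lambda>\<omega>. 1 + \<bar>\<epsilon> 1 \<omega>\<bar> ^ 4)" using int4 by simp
    have "x\<^sup>2 \<le> 1 + \<bar>x\<bar> ^ 4" for x :: real
    proof -
      have "0 \<le> (x\<^sup>2 - 1)\<^sup>2 + x\<^sup>2" by simp
      also have "\<dots> = 1 + \<bar>x\<bar> ^ 4 - x\<^sup>2" by (simp add: power2_eq_square power4_eq_xxxx algebra_simps)
      finally show ?thesis by simp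
    qed
    then show "AE \<omega> in P. norm ((\<epsilon> 1 \<omega>)\<^sup>2) \<le> norm (1 + \<bar>\<epsilon> 1 \<omega>\<bar> ^ 4)" by simp
    show "(\<lambda>\<omega>. (\<epsilon> 1 \<omega>)\<^sup>2) \<in> borel_measurable P" by measurable
  qed
  assume "\<not> innovation_sd P \<epsilon> > 0"
  then have "(\<integral>\<omega>. (\<epsilon> 1 \<omega>)\<^sup>2 \<partial>P) \<le> 0" by (simp add: innovation_sd_def not_less)
  moreover have "0 \<le> (\<integral>\<omega>. (\<epsilon> 1 \<omega>)\<^sup>2 \<partial>P)" by simp
  ultimately have 0: "(\<integral>\<omega>. (\<epsilon> 1 \<omega>)\<^sup>2 \<partial>P) = 0" by linarith
  then have "AE \<omega> in P. \<epsilon> 1 \<omega> = 0"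
    using integral_nonneg_eq_0_iff_AE[OF int2] by simp
  then have "(\<integral>\<omega>. \<epsilon> 1 \<omega> * \<epsilon> (1 + t) \<omega> \<partial>P) = 0" for t
    by (intro integral_eq_zero_AE) (auto elim: eventually_mono)
  then have "eta_sq P \<epsilon> = (\<lambda>_. 0)" using 0 by (simp add: eta_sq_def fun_eq_iff innovation_sd_def)
  then have "\<eta>\<^sup>2 = 0" using \<eta>(2) LIMSEQ_unique[OF tendsto_const] by metis
  then show False using \<eta>(1) by simp
qed

text \<open>The failure of the asserted closeness yields sequences of horizons, outcomes and times, along
  which the pathwise limit can be taken.\<close>

lemma dickey_fuller_close:
  fixes K :: "real \<Rightarrow> real" and Y :: "nat \<Rightarrow> 'a \<Rightarrow> real"
  assumes K: "bounded (range K)" "\<And>z. (K has_real_derivative deriv K z) (at z)"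
      "continuous_on UNIV (deriv K)" "bounded (range (deriv K))"
    and h: "\<And>T. 0 < h T" and \<zeta>: "(\<lambda>T. real T / h T) \<longlonglongrightarrow> \<zeta>"
    and Y0: "\<And>\<omega>. \<omega> \<in> \<Omega> \<Longrightarrow> Y 0 \<omega> = 0"
    and \<xi>: "\<And>T \<omega>. \<xi> T \<omega> \<in> skorokhod_space 0 1"
      "\<And>T \<omega> r. \<omega> \<in> \<Omega> \<Longrightarrow> r \<in> {0..1} \<Longrightarrow> \<xi> T \<omega> r = Y (nat \<lfloor>real T * r\<rfloor>) \<omega> / sqrt (real T)"
    and R: "\<And>T \<omega> m. \<omega> \<in> \<Omega> \<Longrightarrow> m \<le> T \<Longrightarrow>
        \<bar>\<Sum>t=1..m. (Y t \<omega> - Y (t - 1) \<omega>)\<^sup>2 - \<sigma>\<^sup>2\<bar> \<le> R T \<omega> * real T"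
    and x: "x \<in> skorokhod_space 0 1" "\<And>r. r \<in> {0..1} \<Longrightarrow> x r = \<eta> * B r \<omega>'"
    and B: "continuous_on {0..1} (\<lambda>s. B s \<omega>')" "\<And>s. s \<in> {0<..1} \<Longrightarrow> 0 < (LINT r:{0..s}|lborel. (B r \<omega>')\<^sup>2)"
    and \<eta>: "\<eta> \<noteq> 0" and \<sigma>: "\<sigma> \<noteq> 0" and \<kappa>: "0 < \<kappa>" and e: "e > 0"
  shows "\<exists>r>0. \<forall>\<^sub>F T in sequentially. \<forall>\<omega>\<in>\<Omega>. skorokhod_dist 0 1 (\<xi> T \<omega>) x < r \<longrightarrow> R T \<omega> < r \<longrightarrow>
    (\<forall>s\<in>{\<kappa>..1}. \<bar>dickey_fuller K h Y T s \<omega> - dickey_fuller_limit K \<zeta> (\<eta> / \<sigma>) B s \<omega>'\<bar> < e)"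
proof (rule ccontr)
  assume neg: "\<not> ?thesis"
  have "\<exists>T \<omega> s. j \<le> T \<and> \<omega> \<in> \<Omega> \<and> s \<in> {\<kappa>..1} \<and> skorokhod_dist 0 1 (\<xi> T \<omega>) x < 1 / real (Suc j) \<and>
      R T \<omega> < 1 / real (Suc j) \<and>
      e \<le> \<bar>dickey_fuller K h Y T s \<omega> - dickey_fuller_limit K \<zeta> (\<eta> / \<sigma>) B s \<omega>'\<bar>" for j
  proof -
    have "0 < 1 / real (Suc j)" by simp
    with neg have "\<not> (\<forall>\<^sub>F T in sequentially. \<forall>\<omega>\<in>\<Omega>. skorokhod_dist 0 1 (\<xi> T \<omega>) x < 1 / real (Suc j) \<longrightarrow> R T \<omega> < 1 / real (Suc j) \<longrightarrow>
      (\<forall>s\<in>{\<kappa>..1}. \<bar>dickey_fuller K h Y T s \<omega> - dickey_fuller_limit K \<zeta> (\<eta> / \<sigma>) B s \<omega>'\<bar> < e))"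
      by blast
    then show ?thesis unfolding eventually_sequentially not_less[symmetric] by blast
  qed
  then obtain \<tau>0 \<omega>0 s0 where *: "\<And>j. j \<le> \<tau>0 j" "\<And>j. \<omega>0 j \<in> \<Omega>" "\<And>j. s0 j \<in> {\<kappa>..1}"
      "\<And>j. skorokhod_dist 0 1 (\<xi> (\<tau>0 j) (\<omega>0 j)) x < 1 / real (Suc j)"
      "\<And>j. R (\<tau>0 j) (\<omega>0 j) < 1 / real (Suc j)"
      "\<And>j. e \<le> \<bar>dickey_fuller K h Y (\<tau>0 j) (s0 j) (\<omega>0 j) - dickey_fuller_limit K \<zeta> (\<eta> / \<sigma>) B (s0 j) \<omega>'\<bar>"
    by metis
  \<comment> \<open>Compactness of [\<kappa>, 1] yields a limiting time a that is positive.\<close>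
  obtain a \<phi> where a: "a \<in> {\<kappa>..1}" and \<phi>: "strict_mono \<phi>" and lim: "(s0 \<circ> \<phi>) \<longlonglongrightarrow> a"
    using compact_Icc[of \<kappa> "1::real"] *(3) unfolding compact_def by metis
  have a01: "a \<in> {0<..1}" using a \<kappa> by auto
  define \<tau> where "\<tau> j = \<tau>0 (\<phi> j)" for j
  define \<omega> where "\<omega> j = \<omega>0 (\<phi> j)" for j
  define s where "s j = s0 (\<phi> j)" for j
  have \<tau>_ge: "j \<le> \<tau> j" for j
    unfolding \<tau>_def using *(1)[of "\<phi> j"] seq_suble[OF \<phi>, of j] by linarith
  have small: "1 / real (Suc (\<phi> j)) \<le> 1 / real (Suc j)" for j
    using seq_suble[OF \<phi>, of j] by (simp add: field_simps)
  have inv: "(\<lambda>j. 1 / real (Suc j)) \<longlonglongrightarrow> 0" by (rule LIMSEQ_Suc[OF lim_1_over_n])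
  have s01: "s j \<in> {0<..1}" for j using *(3)[of "\<phi> j"] \<kappa> by (auto simp: s_def)
  have slim: "s \<longlonglongrightarrow> a" using lim by (simp add: s_def[abs_def] comp_def)
  have xc: "continuous_on {0..1} (\<lambda>r. \<eta> * B r \<omega>')" by (intro continuous_intros B)
  have "skorokhod_dist 0 1 (\<xi> (\<tau> j) (\<omega> j)) x \<le> 1 / real (Suc j)" for j
    using *(4)[of "\<phi> j"] small[of j] unfolding \<tau>_def \<omega>_def by linarith
  then have "(\<lambda>j. skorokhod_dist 0 1 (\<xi> (\<tau> j) (\<omega> j)) x) \<longlonglongrightarrow> 0"
    by (intro real_tendsto_sandwich[OF _ _ tendsto_const inv] always_eventually allI skorokhod_dist_nonneg)
  then have "uniform_limit {0..1} (\<lambda>j. \<xi> (\<tau> j) (\<omega> j)) x sequentially"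
    by (intro uniform_limit_skorokhod_dist \<xi> x(1) continuous_on_eq[OF xc]) (simp add: x(2))
  moreover have "\<xi> (\<tau> j) (\<omega> j) r = Y (nat \<lfloor>real (\<tau> j) * r\<rfloor>) (\<omega> j) / sqrt (real (\<tau> j))" if "r \<in> {0..1}" for j r
    using \<xi>(2)[OF *(2) that] by (simp add: \<omega>_def)
  ultimately have unif: "uniform_limit {0..1} (\<lambda>j r. Y (nat \<lfloor>real (\<tau> j) * r\<rfloor>) (\<omega> j) / sqrt (real (\<tau> j))) (\<lambda>r. \<eta> * B r \<omega>') sequentially"
    using x(2) by (subst uniform_limit_cong'[where g = "\<lambda>j. \<xi> (\<tau> j) (\<omega> j)" and i = x]) auto
  have "(\<lambda>j. dickey_fuller K h Y (\<tau> j) (s j) (\<omega> j)) \<longlonglongrightarrow>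
    a / 2 * (K 0 * (\<eta> * B a \<omega>')\<^sup>2 + \<zeta> * (LINT r:{0..a}|lborel. (\<eta> * B r \<omega>')\<^sup>2 * deriv K (\<zeta> * (a - r)))
      - \<sigma>\<^sup>2 * (LINT r:{0..a}|lborel. K (\<zeta> * (a - r)))) / (LINT r:{0..a}|lborel. (\<eta> * B r \<omega>')\<^sup>2)"
  proof (rule dickey_fuller_pathwise[where K = K and h = h and Y = Y and \<tau> = \<tau> and \<omega> = \<omega> and s = s
        and x = "\<lambda>r. \<eta> * B r \<omega>'", OF K h \<zeta> _ _ xc unif _ slim _ a01])
    show "filterlim \<tau> at_top sequentially"
      by (rule filterlim_at_top_mono[OF filterlim_ident]) (simp add: \<tau>_ge)
    show "Y 0 (\<omega> j) = 0" for j using Y0 *(2) by (simp add: \<omega>_def)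
    show "s j \<in> {0..1}" for j using s01[of j] by auto
    show "0 < (LINT r:{0..a}|lborel. (\<eta> * B r \<omega>')\<^sup>2)"
      unfolding power_mult_distrib set_integral_mult_right using B(2)[OF a01] \<eta> by simp
    fix c :: real assume "c > 0"
    then have "\<forall>\<^sub>F j in sequentially. 1 / real (Suc j) < c" by (rule order_tendstoD(2)[OF inv])
    then show "\<forall>\<^sub>F j in sequentially. \<forall>m\<le>\<tau> j.
        \<bar>\<Sum>t=1..m. (Y t (\<omega> j) - Y (t - 1) (\<omega> j))\<^sup>2 - \<sigma>\<^sup>2\<bar> \<le> c * real (\<tau> j)"
    proof eventually_elim
      case (elim j)
      have "R (\<tau> j) (\<omega> j) \<le> c"
        using *(5)[of "\<phi> j"] small[of j] elim unfolding \<tau>_def \<omega>_def by linarith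
      then have "R (\<tau> j) (\<omega> j) * real (\<tau> j) \<le> c * real (\<tau> j)" by (intro mult_right_mono) auto
      then show ?case using R[OF *(2), of _ "\<tau> j" "\<phi> j"] unfolding \<omega>_def by (meson order_trans)
    qed
  qed
  then have "(\<lambda>j. dickey_fuller K h Y (\<tau> j) (s j) (\<omega> j)) \<longlonglongrightarrow> dickey_fuller_limit K \<zeta> (\<eta> / \<sigma>) B a \<omega>'"
    using dickey_fuller_limit_scaled[where B = B, OF \<eta> \<sigma>, of a K \<omega>' \<zeta>] a01 by simp
  \<comment> \<open>The assumed failure compares with the limit at the moving time
    \<open>s j\<close>. By continuity this tends to the value at a, as the process itself
    does.\<close>
  moreover have "(\<lambda>j. dickey_fuller_limit K \<zeta> (\<eta> / \<sigma>) B (s j) \<omega>') \<longlonglongrightarrow> dickey_fuller_limit K \<zeta> (\<eta> / \<sigma>) B a \<omega>'"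
    by (rule continuous_on_tendsto_compose[OF dickey_fuller_limit_continuous[where B = B, OF K B] slim a01])
       (use s01 in auto)
  ultimately have "(\<lambda>j. dickey_fuller K h Y (\<tau> j) (s j) (\<omega> j) - dickey_fuller_limit K \<zeta> (\<eta> / \<sigma>) B (s j) \<omega>') \<longlonglongrightarrow> 0"
    using tendsto_diff by fastforce
  then have "\<forall>\<^sub>F j in sequentially. \<bar>dickey_fuller K h Y (\<tau> j) (s j) (\<omega> j) - dickey_fuller_limit K \<zeta> (\<eta> / \<sigma>) B (s j) \<omega>'\<bar> < e"
    by (auto dest: tendstoD[OF _ e] simp: dist_real_def)
  then obtain j where "\<bar>dickey_fuller K h Y (\<tau> j) (s j) (\<omega> j) - dickey_fuller_limit K \<zeta> (\<eta> / \<sigma>) B (s j) \<omega>'\<bar> < e"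
    using eventually_happens'[OF sequentially_bot] by blast
  then show False using *(6)[of "\<phi> j"] by (simp add: \<tau>_def \<omega>_def s_def)
qed

theorem theorem2p1:
  fixes M :: "'a measure" and N\<^sub>1 :: "'b measure" and N\<^sub>2 :: "'c measure" and N :: "'d measure"
    and \<epsilon> Y :: "nat \<Rightarrow> 'a \<Rightarrow> real"
    and B\<^sub>1 :: "real \<Rightarrow> 'b \<Rightarrow> real" and B\<^sub>2 :: "real \<Rightarrow> 'c \<Rightarrow> real" and B :: "real \<Rightarrow> 'd \<Rightarrow> real"
    and K :: "real \<Rightarrow> real" and h :: "nat \<Rightarrow> real"
    and \<rho> \<eta> \<eta>' \<theta> \<zeta> \<kappa> :: real
  assumes "prob_space M"
    and "\<And>\<omega>. \<omega> \<in> space M \<Longrightarrow> Y 0 \<omega> = 0"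
    and "\<And>t \<omega>. 1 \<le> t \<Longrightarrow> \<omega> \<in> space M \<Longrightarrow> Y t \<omega> = \<rho> * Y (t - 1) \<omega> + \<epsilon> t \<omega>"
    and "\<rho> = 1"
    and "condition_E1 M \<epsilon> \<eta> \<eta>' N\<^sub>1 B\<^sub>1 N\<^sub>2 B\<^sub>2"
    and "\<theta> = \<eta> / innovation_sd M \<epsilon>"
    and "\<And>z. 0 \<le> K z"
    and "kernel_K1 K" and "kernel_K2 K" and "kernel_K3 K"
    and "\<And>T. 0 < h T"
    and "(\<lambda>T. real T / h T) \<longlonglongrightarrow> \<zeta>" and "1 \<le> \<zeta>"
    and "0 < \<kappa>" and "\<kappa> < 1"
    and "standard_brownian_motion N B"
  shows "weak_conv_skorokhod \<kappa> 1 M (dickey_fuller K h Y) N (dickey_fuller_limit K \<zeta> \<theta> B)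
    \<and> (AE \<omega> in N. continuous_on {0<..1} (\<lambda>s. dickey_fuller_limit K \<zeta> \<theta> B s \<omega>))"
proof
  note M = assms(1) and Y0 = assms(2) and E1 = assms(5) and B = assms(16) and h = assms(11)
    and \<zeta> = assms(12) and \<kappa> = assms(14,15)
  interpret M: prob_space M by (rule M)
  have N: "prob_space N" "prob_space N\<^sub>1" "prob_space N\<^sub>2" "standard_brownian_motion N\<^sub>1 B\<^sub>1"
    using B E1 by (simp_all add: standard_brownian_motion_def condition_E1_def)
  interpret D01: Metric_space "skorokhod_space 0 1" "skorokhod_dist 0 1"
    by (rule Metric_space_skorokhod)
  interpret D\<kappa>: Metric_space "skorokhod_space \<kappa> 1" "skorokhod_dist \<kappa> 1"
    by (rule Metric_space_skorokhod)
  have K: "bounded (range K)" "\<And>z. (K has_real_derivative deriv K z) (at z)"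
      "continuous_on UNIV (deriv K)" "bounded (range (deriv K))"
    using \<open>kernel_K1 K\<close> \<open>kernel_K2 K\<close>
    by (auto simp: kernel_K1_def kernel_K2_def DERIV_deriv_iff_real_differentiable
        intro!: differentiable_imp_continuous_on simp: differentiable_on_def intro: differentiable_at_withinI)
  define \<sigma> where "\<sigma> = innovation_sd M \<epsilon>"
  have \<sigma>: "\<sigma> > 0" unfolding \<sigma>_def by (rule innovation_sd_pos[OF M E1])
  have st: "strictly_stationary M \<epsilon>" and \<eta>: "\<eta> > 0"
    using E1 by (simp_all add: condition_E1_def)
  have \<epsilon>[measurable]: "\<epsilon> t \<in> borel_measurable M" if "t \<ge> 1" for t
    using st that by (simp add: strictly_stationary_def)
  have var: "(\<integral>\<omega>. (\<epsilon> i \<omega>)\<^sup>2 \<partial>M) = \<sigma>\<^sup>2" if "i \<ge> 1" for i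
    using strictly_stationary_integral_eq[OF st that, of "\<lambda>x. x\<^sup>2"] by (simp add: \<sigma>_def innovation_sd_def)
  have dY: "Y t \<omega> - Y (t - 1) \<omega> = \<epsilon> t \<omega>" if "t \<ge> 1" "\<omega> \<in> space M" for t \<omega>
    using assms(3)[OF that] \<open>\<rho> = 1\<close> by simp
  have Y: "Y t \<omega> = (\<Sum>i=1..t. \<epsilon> i \<omega>)" if w: "\<omega> \<in> space M" for t \<omega>
  proof (induction t)
    case (Suc t)
    then show ?case using dY[of "Suc t" \<omega>] w by simp
  qed (use Y0 w in simp)
  have Ym[measurable]: "Y t \<in> borel_measurable M" for t
    by (subst measurable_cong[OF Y]) (auto intro!: borel_measurable_sum)
  \<comment> \<open>\<open>S\<close> is the sum exactly as written in (E1); it agrees with Y on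
    \<open>space M\<close>.\<close>
  define S where "S t \<omega> = (\<Sum>i=1..t. \<epsilon> i \<omega>)" for t \<omega>
  define G where "G t \<omega> = (\<Sum>i=1..t. (\<epsilon> i \<omega>)\<^sup>2 - (\<integral>\<omega>'. (\<epsilon> i \<omega>')\<^sup>2 \<partial>M))" for t \<omega>
  have [measurable]: "S t \<in> borel_measurable M" "G t \<in> borel_measurable M" for t
    unfolding S_def G_def by (auto intro!: borel_measurable_sum borel_measurable_diff borel_measurable_power)
  have conv1: "weak_conv_skorokhod 0 1 M (\<lambda>T s \<omega>. S (nat \<lfloor>real T * s\<rfloor>) \<omega> / sqrt (real T)) N\<^sub>1 (\<lambda>s \<omega>. \<eta> * B\<^sub>1 s \<omega>)"
    and conv2: "weak_conv_skorokhod 0 1 M (\<lambda>T s \<omega>. G (nat \<lfloor>real T * s\<rfloor>) \<omega> / sqrt (real T)) N\<^sub>2 (\<lambda>s \<omega>. \<eta>' * B\<^sub>2 s \<omega>)"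
    using E1 by (simp_all add: condition_E1_def S_def G_def)
  \<comment> \<open>Controls the partial sums of all centred squares up to T at once, relative to
    the horizon.\<close>
  define R where "R T \<omega> = (MAX m\<in>{..T}. \<bar>G m \<omega>\<bar>) / real T" for T \<omega>
  have Rm: "R T \<in> borel_measurable M" for T
    unfolding R_def by (intro borel_measurable_divide borel_measurable_Max) auto
  have R0: "(\<lambda>T. measure M {\<omega>\<in>space M. e \<le> R T \<omega>}) \<longlonglongrightarrow> 0" if "e > 0" for e
    unfolding R_def by (rule weak_conv_skorokhod_partial_sums_negligible[OF M N(3) _ conv2 that]) measurable
  have R: "\<bar>\<Sum>t=1..m. (Y t \<omega> - Y (t - 1) \<omega>)\<^sup>2 - \<sigma>\<^sup>2\<bar> \<le> R T \<omega> * real T" if "\<omega> \<in> space M" "m \<le> T" for T \<omega> m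
  \<comment> \<open>For T = 0 only the empty sum remains, while \<open>R\<close> is a division by
    0.\<close>
  proof (cases "T = 0")
    case False
    have "(\<Sum>t=1..m. (Y t \<omega> - Y (t - 1) \<omega>)\<^sup>2 - \<sigma>\<^sup>2) = G m \<omega>"
      unfolding G_def using dY var that by (intro sum.cong) auto
    moreover have "\<bar>G m \<omega>\<bar> \<le> (MAX m\<in>{..T}. \<bar>G m \<omega>\<bar>)" using that by (intro Max_ge) auto
    ultimately show ?thesis using False by (simp add: R_def)
  qed (use that in simp)
  define \<xi> where "\<xi> T \<omega> = step_path 0 1 (real T) (\<lambda>j. S j \<omega> / sqrt (real T))" for T \<omega>
  have \<xi>: "skorokhod_version 0 1 M (\<lambda>s \<omega>. S (nat \<lfloor>real T * s\<rfloor>) \<omega> / sqrt (real T)) (\<xi> T)" for T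
    unfolding \<xi>_def by (rule step_path_version) auto
  have \<xi>_eq: "\<xi> T \<omega> r = Y (nat \<lfloor>real T * r\<rfloor>) \<omega> / sqrt (real T)" if "\<omega> \<in> space M" "r \<in> {0..1}" for T \<omega> r
    using that Y by (simp add: \<xi>_def step_path_def S_def)
  have \<xi>D: "\<xi> T \<omega> \<in> skorokhod_space 0 1" for T \<omega>
    unfolding \<xi>_def by (rule step_path_in_skorokhod_space) simp
  obtain Z where Z: "skorokhod_version 0 1 N (\<lambda>s \<omega>. \<eta> * B s \<omega>) Z" using scaled_brownian_version[OF B] by blast
  obtain Z1 where Z1: "skorokhod_version 0 1 N\<^sub>1 (\<lambda>s \<omega>. \<eta> * B\<^sub>1 s \<omega>) Z1" using scaled_brownian_version[OF N(4)] by blast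
  \<comment> \<open>The limit in (E1) lives on \<open>N\<^sub>1\<close>; here it is moved to N, so
    that the limit path and the limit process are functions of the same outcome.\<close>
  have conv: "(\<lambda>n. \<integral>\<omega>. f (\<xi> n \<omega>) \<partial>M) \<longlonglongrightarrow> (\<integral>\<omega>. f (Z \<omega>) \<partial>N)"
    if f: "continuous_map D01.mtopology euclideanreal f" "bounded (f ` skorokhod_space 0 1)" for f
    using weak_conv_skorokhodD[OF conv1 \<xi> Z1 f] brownian_functional_eq[OF N(4) Z1 B Z f] by simp
  obtain L where L: "skorokhod_version \<kappa> 1 N (dickey_fuller_limit K \<zeta> \<theta> B) L"
    using dickey_fuller_limit_version[OF K B \<kappa>] by blast
  \<comment> \<open>At a fixed horizon the process depends on s through m alone, so it is a step
    path with measurable entries.\<close>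
  define c where "c T m \<omega> = (1 / real m * (\<Sum>t=1..m. Y (t - 1) \<omega> * (Y t \<omega> - Y (t - 1) \<omega>) * K ((real m - real t) / h T))) /
        (1 / (real m)\<^sup>2 * (\<Sum>t=1..m. (Y (t - 1) \<omega>)\<^sup>2))" for T m \<omega>
  define \<Delta> where "\<Delta> T \<omega> = step_path \<kappa> 1 (real T) (\<lambda>j. c T j \<omega>)" for T \<omega>
  have \<Delta>: "skorokhod_version \<kappa> 1 M (dickey_fuller K h Y T) (\<Delta> T)" for T
    unfolding \<Delta>_def
  proof (rule step_path_version)
    show "c T j \<in> borel_measurable M" for j unfolding c_def by measurable
  qed (simp_all add: dickey_fuller_def Let_def c_def)
  have \<Delta>D: "\<Delta> T \<omega> \<in> skorokhod_space \<kappa> 1" for T \<omega>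
    unfolding \<Delta>_def by (rule step_path_in_skorokhod_space) simp
  have \<Delta>_eq: "\<Delta> T \<omega> s = dickey_fuller K h Y T s \<omega>" if "s \<in> {\<kappa>..1}" for T \<omega> s
    using that by (simp add: \<Delta>_def step_path_def c_def dickey_fuller_def Let_def)
  have good: "AE \<omega> in N. continuous_on {0..1} (\<lambda>t. B t \<omega>) \<and> (\<forall>s\<in>{0<..1}. 0 < (LINT r:{0..s}|lborel. (B r \<omega>)\<^sup>2))"
    using B brownian_integral_pos[OF B] by (auto simp: standard_brownian_motion_def)
  show "AE \<omega> in N. continuous_on {0<..1} (\<lambda>s. dickey_fuller_limit K \<zeta> \<theta> B s \<omega>)"
    using good by eventually_elim (rule dickey_fuller_limit_continuous[where B = B, OF K]; blast)
  have "(\<lambda>n. \<integral>\<omega>. f (\<Delta> n \<omega>) \<partial>M) \<longlonglongrightarrow> (\<integral>\<omega>. f (L \<omega>) \<partial>N)"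
    if f: "continuous_map D\<kappa>.mtopology euclideanreal f" "bounded (f ` skorokhod_space \<kappa> 1)" for f
  proof -
    obtain C where C: "\<And>x. x \<in> skorokhod_space \<kappa> 1 \<Longrightarrow> \<bar>f x\<bar> \<le> C"
      using f(2) unfolding bounded_iff real_norm_def by blast
    show ?thesis
    \<comment> \<open>The mapping theorem runs on D[0, 1], where (E1) is stated, while f lives on
      D[\<kappa>, 1]. U is f at the Dickey-Fuller path and V is f at the limit process.\<close>
    proof (rule D01.extended_mapping[OF M N(1), where \<xi> = \<xi> and \<zeta> = Z and R = R and C = C])
      show "\<xi> T \<in> M \<rightarrow>\<^sub>M D01.mborel" for T
        using \<xi> unfolding skorokhod_version_def skorokhod_borel_eq by blast
      show "Z \<in> N \<rightarrow>\<^sub>M D01.mborel"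
        using Z unfolding skorokhod_version_def skorokhod_borel_eq by blast
      show "(\<lambda>\<omega>. f (\<Delta> T \<omega>)) \<in> borel_measurable M" for T
        by (rule continuous_map_skorokhod_version_measurable[OF \<Delta> f(1)])
      show "(\<lambda>\<omega>. f (L \<omega>)) \<in> borel_measurable N"
        by (rule continuous_map_skorokhod_version_measurable[OF L f(1)])
      show "\<bar>f (\<Delta> T \<omega>)\<bar> \<le> C" for T \<omega> by (rule C[OF \<Delta>D])
      show "\<bar>f (L \<omega>)\<bar> \<le> C" if "\<omega> \<in> space N" for \<omega>
        by (rule C[OF skorokhod_version_in_space[OF L that]])
      have "AE \<omega> in N. \<forall>t\<in>{0..1}. Z \<omega> t = \<eta> * B t \<omega>"
        "AE \<omega> in N. \<forall>t\<in>{\<kappa>..1}. L \<omega> t = dickey_fuller_limit K \<zeta> \<theta> B t \<omega>"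
        using Z L by (auto simp: skorokhod_version_def)
      then show "AE \<omega>' in N. \<forall>e>0. \<exists>r>0. \<forall>\<^sub>F T in sequentially. \<forall>\<omega>\<in>space M.
          skorokhod_dist 0 1 (\<xi> T \<omega>) (Z \<omega>') < r \<longrightarrow> R T \<omega> < r \<longrightarrow> \<bar>f (\<Delta> T \<omega>) - f (L \<omega>')\<bar> < e"
        using good AE_space
      proof eventually_elim
        case (elim \<omega>')
        show ?case
        proof (intro allI impI)
          fix e :: real assume "e > 0"
          have LD: "L \<omega>' \<in> skorokhod_space \<kappa> 1" by (rule skorokhod_version_in_space[OF L elim(4)])
          obtain q where q: "q > 0" "\<And>y. y \<in> skorokhod_space \<kappa> 1 \<Longrightarrow> skorokhod_dist \<kappa> 1 y (L \<omega>') < q \<Longrightarrow> \<bar>f y - f (L \<omega>')\<bar> < e"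
            using D\<kappa>.continuous_map_real_dist[OF f(1) LD \<open>e > 0\<close>] by blast
          \<comment> \<open>A pointwise bound q / 2 gives distance at most q / 2, hence strictly
            below q.\<close>
          have "\<exists>r>0. \<forall>\<^sub>F T in sequentially. \<forall>\<omega>\<in>space M. skorokhod_dist 0 1 (\<xi> T \<omega>) (Z \<omega>') < r \<longrightarrow> R T \<omega> < r \<longrightarrow>
            (\<forall>s\<in>{\<kappa>..1}. \<bar>dickey_fuller K h Y T s \<omega> - dickey_fuller_limit K \<zeta> (\<eta> / \<sigma>) B s \<omega>'\<bar> < q / 2)"
            by (rule dickey_fuller_close[OF K h \<zeta> Y0 \<xi>D \<xi>_eq R skorokhod_version_in_space[OF Z elim(4)]])
               (use elim \<eta> \<sigma> \<kappa> q(1) in auto)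
          then obtain r where r: "r > 0" "\<forall>\<^sub>F T in sequentially. \<forall>\<omega>\<in>space M. skorokhod_dist 0 1 (\<xi> T \<omega>) (Z \<omega>') < r \<longrightarrow> R T \<omega> < r \<longrightarrow>
            (\<forall>s\<in>{\<kappa>..1}. \<bar>dickey_fuller K h Y T s \<omega> - dickey_fuller_limit K \<zeta> (\<eta> / \<sigma>) B s \<omega>'\<bar> < q / 2)"
            by blast
          from r(2) have "\<forall>\<^sub>F T in sequentially. \<forall>\<omega>\<in>space M.
            skorokhod_dist 0 1 (\<xi> T \<omega>) (Z \<omega>') < r \<longrightarrow> R T \<omega> < r \<longrightarrow> \<bar>f (\<Delta> T \<omega>) - f (L \<omega>')\<bar> < e"
          proof eventually_elim
            case (elim T)
            show ?case
            proof (intro ballI impI)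
              fix \<omega> assume w: "\<omega> \<in> space M" "skorokhod_dist 0 1 (\<xi> T \<omega>) (Z \<omega>') < r" "R T \<omega> < r"
              have "skorokhod_dist \<kappa> 1 (\<Delta> T \<omega>) (L \<omega>') \<le> q / 2"
              proof (rule skorokhod_dist_le_uniform[OF \<Delta>D LD])
                fix s assume s: "s \<in> {\<kappa>..1}"
                have "L \<omega>' s = dickey_fuller_limit K \<zeta> (\<eta> / \<sigma>) B s \<omega>'"
                  using \<open>\<forall>t\<in>{\<kappa>..1}. L \<omega>' t = dickey_fuller_limit K \<zeta> \<theta> B t \<omega>'\<close> s \<open>\<theta> = _\<close> by (simp add: \<sigma>_def)
                then show "\<bar>\<Delta> T \<omega> s - L \<omega>' s\<bar> \<le> q / 2"
                  using elim w s \<Delta>_eq[OF s] by (auto intro: less_imp_le)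
              qed (use q in simp)
              then show "\<bar>f (\<Delta> T \<omega>) - f (L \<omega>')\<bar> < e" using q(1) by (intro q(2) \<Delta>D) linarith
            qed
          qed
          then show "\<exists>r>0. \<forall>\<^sub>F T in sequentially. \<forall>\<omega>\<in>space M.
            skorokhod_dist 0 1 (\<xi> T \<omega>) (Z \<omega>') < r \<longrightarrow> R T \<omega> < r \<longrightarrow> \<bar>f (\<Delta> T \<omega>) - f (L \<omega>')\<bar> < e"
            using r(1) by blast
        qed
      qed
    qed (use conv R0 Rm in auto)
  qed
  then show "weak_conv_skorokhod \<kappa> 1 M (dickey_fuller K h Y) N (dickey_fuller_limit K \<zeta> \<theta> B)"
    unfolding weak_conv_skorokhod_def using \<Delta> L by blast
qed

end
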